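(* Let $d=2$ and let $V:(0,1)\to\mathbb{C}$ be measurable with $\int_0^1 r(1-\log r)|V(r)|\,dr<\infty$ and $\alpha_m(1)\ne0$ for all $m\in\mathbb{N}_0$. Given $f\in\mathscr{D}'(\mathbb{S}^1)$, the function $$u_f(r,\theta):=\sum_{m\in\mathbb{Z}}\frac{r^{|m|}\alpha_{|m|}(r)}{\alpha_{|m|}(1)}\widehat f_m e^{im\theta}$$ belongs to $\operatorname{Sol}_V^{dist}(\mathbb{B}^2)$ and has distributional boundary value $(u_f)_{db}=f$.
   Context: $\mathbb{B}^2$ is the open unit disk with polar coordinates $(r,\theta)$, $\mathbb{S}^1$ the unit circle; functions on $\mathbb{S}^1$ are identified with $2\pi$-periodic functions of $\theta$. $\mathscr{D}(\mathbb{S}^1)=C^\infty(\mathbb{S}^1)$, $\mathscr{D}'(\mathbb{S}^1)$ is its topological dual, $(f|\varphi)_{\mathscr{D}(\mathbb{S}^1)}$ the (bilinear) action of $f$ on $\varphi$, and $\widehat f_m=\frac{1}{2\pi}(f|e^{-im\theta})_{\mathscr{D}(\mathbb{S}^1)}$. $\mathbb{N}_0=\{0,1,2,\dots\}$. $\operatorname{Sol}_V^{dist}(\mathbb{B}^2)$ is the space of distributional solutions of $-\Delta u+V(|x|)u=0$: those $u\in L^1_{loc}(\mathbb{B}^2)$ with $\int_{\mathbb{B}^2}u(-\Delta\phi+V(|x|)\phi)\,dx=0$ for all $\phi\in C_0^\infty(\mathbb{B}^2)$ (with $Vu\phi$ integrable). Distributional boundary value: $u_{db}=f$ means $\lim_{r\to1^-}\int_0^{2\pi}u(r,\theta)\varphi(\theta)\,d\theta=(f|\varphi)_{\mathscr{D}(\mathbb{S}^1)}$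 for all $\varphi\in C^\infty(\mathbb{S}^1)$. Radial functions: for $m\in\mathbb{N}_0$ put $\ell_m=m-\frac12$ and let $y_m$ be the unique solution (with $y_m'$ locally absolutely continuous on $(0,1]$) of $$-y_m''+\frac{\ell_m(\ell_m+1)}{r^2}y_m+V(r)y_m=0\ \text{ a.e. on }(0,1),\qquad y_m(r)\sim r^{\ell_m+1},\ \ y_m'(r)\sim(\ell_m+1)r^{\ell_m}\ (r\to0^+)$$ (for $m=0$: $-y_0''-\frac{1}{4r^2}y_0+Vy_0=0$, $y_0\sim\sqrt r$, $y_0'\sim\frac{1}{2\sqrt r}$; existence is guaranteed by the integrability condition on $r(1-\log r)|V|$). Define $\alpha_m(r)=y_m(r)/r^{\ell_m+1}$ for $r\in(0,1]$ and $\alpha_m(0)=1$. *)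

theory Defs
  imports "HOL-Analysis.Analysis" "HOL-Library.Landau_Symbols"
begin

subsection \<open>Smooth functions and distributions on the circle\<close>

definition iter_deriv :: "nat \<Rightarrow> (real \<Rightarrow> complex) \<Rightarrow> real \<Rightarrow> complex" where
  "iter_deriv k \<phi> = ((\<lambda>g \<theta>. vector_derivative g (at \<theta>)) ^^ k) \<phi>"

text \<open>Functions on the unit circle are identified with functions of the angle of period \<open>2 * pi\<close>.\<close>

definition circle_smooth :: "(real \<Rightarrow> complex) set" where
  "circle_smooth = {\<phi>. (\<forall>\<theta>. \<phi> (\<theta> + 2 * pi) = \<phi> \<theta>) \<and>
                       (\<forall>k. iter_deriv k \<phi> differentiable_on UNIV)}"

text \<open>The usual Frechet topology on smooth functions on the circle (uniform convergence of every
  derivative), given through its basic neighbourhoods.\<close>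

definition circle_nbhd :: "nat \<Rightarrow> real \<Rightarrow> (real \<Rightarrow> complex) \<Rightarrow> (real \<Rightarrow> complex) set" where
  "circle_nbhd N \<epsilon> \<phi> =
     {\<psi> \<in> circle_smooth. \<forall>k\<le>N. \<forall>\<theta>. cmod (iter_deriv k \<psi> \<theta> - iter_deriv k \<phi> \<theta>) < \<epsilon>}"

definition circle_topology :: "(real \<Rightarrow> complex) topology" where
  "circle_topology = topology (\<lambda>U. U \<subseteq> circle_smooth \<and>
     (\<forall>\<phi>\<in>U. \<exists>N. \<exists>\<epsilon>>0. circle_nbhd N \<epsilon> \<phi> \<subseteq> U))"

lemma openin_circle_topology:
  "openin circle_topology U \<longleftrightarrow>
     U \<subseteq> circle_smooth \<and> (\<forall>\<phi>\<in>U. \<exists>N. \<exists>\<epsilon>>0. circle_nbhd N \<epsilon> \<phi> \<subseteq> U)"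
proof -
  let ?P = "\<lambda>U. U \<subseteq> circle_smooth \<and> (\<forall>\<phi>\<in>U. \<exists>N. \<exists>\<epsilon>>0. circle_nbhd N \<epsilon> \<phi> \<subseteq> U)"
  have "?P (S \<inter> T)" if S: "?P S" and T: "?P T" for S T
  proof (intro conjI ballI)
    show "S \<inter> T \<subseteq> circle_smooth" using S by blast
    fix \<phi> assume "\<phi> \<in> S \<inter> T"
    then obtain M \<delta> N \<epsilon> where *: "\<delta> > 0" "circle_nbhd M \<delta> \<phi> \<subseteq> S" "\<epsilon> > 0" "circle_nbhd N \<epsilon> \<phi> \<subseteq> T"
      using S T by (metis IntD1 IntD2)
    have "circle_nbhd (max M N) (min \<delta> \<epsilon>) \<phi> \<subseteq> circle_nbhd M \<delta> \<phi> \<inter> circle_nbhd N \<epsilon> \<phi>"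
      by (auto simp: circle_nbhd_def)
    with * show "\<exists>N. \<exists>\<epsilon>>0. circle_nbhd N \<epsilon> \<phi> \<subseteq> S \<inter> T"
      by (intro exI[of _ "max M N"] exI[of _ "min \<delta> \<epsilon>"]) auto
  qed
  moreover have "?P (\<Union>K)" if "\<forall>U\<in>K. ?P U" for K
    using that by (meson UnionE Union_least Union_upper order_trans)
  ultimately have "istopology ?P"
    unfolding istopology_def by blast
  then show ?thesis
    by (simp add: circle_topology_def topology_inverse')
qed

lemma topspace_circle_topology: "topspace circle_topology = circle_smooth"
proof -
  have "openin circle_topology circle_smooth"
    unfolding openin_circle_topology by (auto simp: circle_nbhd_def intro: exI[of _ "1::real"])
  then show ?thesis
    by (meson openin_circle_topology openin_subset openin_topspace subset_antisym)
qed

text \<open>Only the values of a distribution on \<^const>\<open>circle_smooth\<close> matter.\<close>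

definition circle_distribution :: "((real \<Rightarrow> complex) \<Rightarrow> complex) \<Rightarrow> bool" where
  "circle_distribution f \<longleftrightarrow>
     (\<forall>\<phi>\<in>circle_smooth. \<forall>\<psi>\<in>circle_smooth. \<forall>a b.
        f (\<lambda>\<theta>. a * \<phi> \<theta> + b * \<psi> \<theta>) = a * f \<phi> + b * f \<psi>) \<and>
     continuous_map circle_topology euclidean f"

definition fourier_coeff :: "((real \<Rightarrow> complex) \<Rightarrow> complex) \<Rightarrow> int \<Rightarrow> complex" where
  "fourier_coeff f m = f (\<lambda>\<theta>. exp (- \<i> * of_int m * of_real \<theta>)) / of_real (2 * pi)"

subsection \<open>Distributional solutions in the disk\<close>

text \<open>The plane is the type \<^typ>\<open>complex\<close>, with \<^term>\<open>Basis = {1, \<i>}\<close>.\<close>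

definition partial :: "complex \<Rightarrow> (complex \<Rightarrow> complex) \<Rightarrow> complex \<Rightarrow> complex" where
  "partial b \<phi> x = frechet_derivative \<phi> (at x) b"

definition laplacian :: "(complex \<Rightarrow> complex) \<Rightarrow> complex \<Rightarrow> complex" where
  "laplacian \<phi> x = (\<Sum>b\<in>Basis. partial b (partial b \<phi>) x)"

text \<open>All iterated partial derivatives exist and are (totally, over the reals) differentiable.\<close>

definition smooth_plane :: "(complex \<Rightarrow> complex) \<Rightarrow> bool" where
  "smooth_plane \<phi> \<longleftrightarrow> (\<forall>bs\<in>lists Basis. foldr partial bs \<phi> differentiable_on UNIV)"

text \<open>Test functions on the disk, extended by zero to the plane.\<close>

definition disk_test_function :: "(complex \<Rightarrow> complex) \<Rightarrow> bool" where
  "disk_test_function \<phi> \<longleftrightarrow>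
     smooth_plane \<phi> \<and> (\<exists>K. compact K \<and> K \<subseteq> ball 0 1 \<and> (\<forall>x. x \<notin> K \<longrightarrow> \<phi> x = 0))"

definition disk_L1_loc :: "(complex \<Rightarrow> complex) \<Rightarrow> bool" where
  "disk_L1_loc u \<longleftrightarrow> (\<forall>K. compact K \<and> K \<subseteq> ball 0 1 \<longrightarrow> set_integrable lebesgue K u)"

definition Sol_dist :: "(real \<Rightarrow> complex) \<Rightarrow> (complex \<Rightarrow> complex) set" where
  "Sol_dist V = {u. disk_L1_loc u \<and>
     (\<forall>\<phi>. disk_test_function \<phi> \<longrightarrow>
        set_integrable lebesgue (ball 0 1) (\<lambda>x. V (cmod x) * u x * \<phi> x) \<and>
        (LINT x:ball 0 1|lebesgue. u x * (- laplacian \<phi> x + V (cmod x) * \<phi> x)) = 0)}"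

text \<open>The integrability clause makes sure that the integrals in the limit are meaningful.\<close>

definition has_dist_boundary_value ::
  "(complex \<Rightarrow> complex) \<Rightarrow> ((real \<Rightarrow> complex) \<Rightarrow> complex) \<Rightarrow> bool" where
  "has_dist_boundary_value u f \<longleftrightarrow>
     (\<forall>\<phi>\<in>circle_smooth.
        (\<forall>\<^sub>F r in at_left 1. set_integrable lebesgue {0..2*pi} (\<lambda>\<theta>. u (rcis r \<theta>) * \<phi> \<theta>)) \<and>
        ((\<lambda>r. LINT \<theta>:{0..2*pi}|lebesgue. u (rcis r \<theta>) * \<phi> \<theta>) \<longlongrightarrow> f \<phi>) (at_left 1))"

subsection \<open>Radial functions\<close>

definition abs_continuous_on :: "real \<Rightarrow> real \<Rightarrow> (real \<Rightarrow> complex) \<Rightarrow> bool" where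
  "abs_continuous_on a b g \<longleftrightarrow>
     (\<forall>\<epsilon>>0. \<exists>\<delta>>0. \<forall>(n::nat) s t.
        (\<forall>i<n. a \<le> s i \<and> s i \<le> t i \<and> t i \<le> b) \<and>
        disjoint_family_on (\<lambda>i. {s i<..<t i}) {..<n} \<and>
        (\<Sum>i<n. t i - s i) < \<delta> \<longrightarrow> (\<Sum>i<n. cmod (g (t i) - g (s i))) < \<epsilon>)"

definition ell :: "nat \<Rightarrow> real" where
  "ell m = real m - 1/2"

definition radial_solution :: "(real \<Rightarrow> complex) \<Rightarrow> nat \<Rightarrow> (real \<Rightarrow> complex) \<Rightarrow> bool" where
  "radial_solution V m y \<longleftrightarrow> (\<exists>y'.
     (\<forall>r\<in>{0<..1}. (y has_vector_derivative y' r) (at r within {0<..1})) \<and>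
     (\<forall>a\<in>{0<..1}. abs_continuous_on a 1 y') \<and>
     (AE r in lebesgue_on {0<..<1}. \<exists>y2. (y' has_vector_derivative y2) (at r) \<and>
        - y2 + of_real (ell m * (ell m + 1) / r\<^sup>2) * y r + V r * y r = 0) \<and>
     y \<sim>[at_right 0] (\<lambda>r. of_real (r powr (ell m + 1))) \<and>
     y' \<sim>[at_right 0] (\<lambda>r. of_real ((ell m + 1) * r powr ell m)))"

definition alpha :: "(nat \<Rightarrow> real \<Rightarrow> complex) \<Rightarrow> nat \<Rightarrow> real \<Rightarrow> complex" where
  "alpha y m r = (if r = 0 then 1 else y m r / of_real (r powr (ell m + 1)))"

definition u_term ::
  "(nat \<Rightarrow> real \<Rightarrow> complex) \<Rightarrow> ((real \<Rightarrow> complex) \<Rightarrow> complex) \<Rightarrow> real \<Rightarrow> real \<Rightarrow> int \<Rightarrow> complex" where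
  "u_term y f r \<theta> m =
     of_real r ^ nat \<bar>m\<bar> * alpha y (nat \<bar>m\<bar>) r / alpha y (nat \<bar>m\<bar>) 1 *
     fourier_coeff f m * exp (\<i> * of_int m * of_real \<theta>)"

definition u_fun ::
  "(nat \<Rightarrow> real \<Rightarrow> complex) \<Rightarrow> ((real \<Rightarrow> complex) \<Rightarrow> complex) \<Rightarrow> complex \<Rightarrow> complex" where
  "u_fun y f z = (\<Sum>\<^sub>\<infinity>m. u_term y f (cmod z) (Arg z) m)"

end

theory Submission
  imports Defs
begin

text \<open>Separation of variables gives \<open>u_fun y f\<close> as a sum of the modes \<open>radial_mode y m\<close>, the functions
\<open>\<alpha>\<^sub>m(r) / \<alpha>\<^sub>m(1) * r^m * exp (\<i> m \<theta>)\<close> (with \<open>r^\<bar>m\<bar>\<close> and \<open>\<alpha>\<^sub>\<bar>\<^sub>m\<^sub>\<bar>\<close> for negative \<open>m\<close>), weighted by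
the Fourier coefficients of \<open>f\<close>. Three facts make the sum behave like the Poisson integral of \<open>f\<close>.

The quotients \<open>\<alpha>\<^sub>m(r) / \<alpha>\<^sub>m(1)\<close> are bounded uniformly in \<open>m\<close> and \<open>r\<close> (\<open>alpha_uniform_bounds\<close>). Green's
identity for the radial equation, applied to the comparison function known from variation of constants,
gives \<open>\<bar>\<alpha>\<^sub>m - 1\<bar> \<le> sup \<bar>\<alpha>\<^sub>m\<bar> * J / (2 m)\<close>, where \<open>J\<close> is the integral of \<open>r * \<bar>V r\<bar>\<close>. So \<open>\<alpha>\<^sub>m\<close> is close
to \<open>1\<close> for large \<open>m\<close>, and the finitely many other \<open>\<alpha>\<^sub>m(1)\<close> are nonzero by hypothesis.

The Fourier coefficients of a distribution grow at most polynomially and those of a smooth function decay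
faster than every power, and the Fourier series of a smooth function converges with all its derivatives;
hence \<open>f \<phi>\<close> is the absolutely convergent sum of the products of coefficients
(\<open>distribution_fourier_expansion\<close>). By the first bound, the integral of \<open>u_fun y f\<close> against \<open>\<phi>\<close> over the
circle of radius \<open>r\<close> is the same sum with uniformly bounded factors that tend to \<open>1\<close>. This is the boundary
value (\<open>has_dist_boundary_value_u_fun\<close>).

Every mode solves the equation weakly (\<open>weak_equation_mode\<close>). In polar coordinates the angular
integral against \<open>exp (\<i> m \<theta>)\<close> turns a test function into a function \<open>p\<close> of \<open>r\<close> and its Laplacian into
\<open>p'' + p' / r - m\<^sup>2 p / r\<^sup>2\<close>, and Green's identity for \<open>y\<^sub>m\<close> and \<open>sqrt r * p\<close> on \<open>[a, 1]\<close> leaves a boundary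
term at \<open>a\<close>, which vanishes in the limit \<open>a \<rightarrow> 0\<close>. The partial sums converge uniformly on the support of
the test function, so the weak equation passes to the sum (\<open>weak_equation_u_fun\<close>).\<close>

section \<open>Absolutely continuous functions\<close>

text \<open>Absolute continuity speaks of families enumerated by an initial segment of the natural numbers, while a
tagged division is a finite set of pairs.\<close>

lemma abs_continuous_on_finite:
  fixes g :: "real \<Rightarrow> complex"
  assumes "abs_continuous_on a b g" "\<epsilon> > 0"
  obtains \<delta> where "\<delta> > 0"
    "\<And>(I :: 'i set) s t. \<lbrakk>finite I; \<And>i. i \<in> I \<Longrightarrow> a \<le> s i \<and> s i \<le> t i \<and> t i \<le> b;
        disjoint_family_on (\<lambda>i. {s i<..<t i}) I; (\<Sum>i\<in>I. t i - s i) < \<delta>\<rbrakk> \<Longrightarrow>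
        (\<Sum>i\<in>I. cmod (g (t i) - g (s i))) < \<epsilon>"
proof -
  obtain \<delta> where \<delta>: "\<delta> > 0" and *: "\<And>(n::nat) s t. 
        (\<forall>i<n. a \<le> s i \<and> s i \<le> t i \<and> t i \<le> b) \<and>
        disjoint_family_on (\<lambda>i. {s i<..<t i}) {..<n} \<and>
        (\<Sum>i<n. t i - s i) < \<delta> \<Longrightarrow> (\<Sum>i<n. cmod (g (t i) - g (s i))) < \<epsilon>"
    using assms unfolding abs_continuous_on_def by blast
  show ?thesis
  proof (rule that[OF \<delta>])
    fix I :: "'i set" and s t
    assume fin: "finite I" and st: "\<And>i. i \<in> I \<Longrightarrow> a \<le> s i \<and> s i \<le> t i \<and> t i \<le> b"
      and dis: "disjoint_family_on (\<lambda>i. {s i<..<t i}) I" and sm: "(\<Sum>i\<in>I. t i - s i) < \<delta>"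
    obtain h where h: "bij_betw h {..<card I} I"
      using ex_bij_betw_nat_finite[OF fin] by (auto simp: atLeast0LessThan)
    have hI: "h i \<in> I" if "i < card I" for i using h that by (auto simp: bij_betw_def)
    have re: "(\<Sum>i<card I. k (h i)) = (\<Sum>i\<in>I. k i)" for k :: "'i \<Rightarrow> real"
      by (rule sum.reindex_bij_betw[OF h])
    have "(\<Sum>i<card I. cmod (g (t (h i)) - g (s (h i)))) < \<epsilon>"
    proof (rule *[of "card I" "\<lambda>i. s (h i)" "\<lambda>i. t (h i)"], intro conjI)
      show "\<forall>i<card I. a \<le> s (h i) \<and> s (h i) \<le> t (h i) \<and> t (h i) \<le> b" using st hI by blast
      show "disjoint_family_on (\<lambda>i. {s (h i)<..<t (h i)}) {..<card I}"
        unfolding disjoint_family_on_def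
      proof (intro ballI impI)
        fix m n assume mn: "m \<in> {..<card I}" "n \<in> {..<card I}" "m \<noteq> n"
        then have "h m \<noteq> h n" using h by (auto simp: bij_betw_def inj_on_def)
        then show "{s (h m)<..<t (h m)} \<inter> {s (h n)<..<t (h n)} = {}"
          using dis hI mn unfolding disjoint_family_on_def by blast
      qed
      show "(\<Sum>i<card I. t (h i) - s (h i)) < \<delta>" using re[of "\<lambda>i. t i - s i"] sm by simp
    qed
    then show "(\<Sum>i\<in>I. cmod (g (t i) - g (s i))) < \<epsilon>"
      using re[of "\<lambda>i. cmod (g (t i) - g (s i))"] by simp
  qed
qed

text \<open>On an interval tagged outside \<open>N\<close> the derivative controls the increment of \<open>g\<close>. The intervals tagged in
\<open>N\<close> lie in an open set of small measure, where absolute continuity controls the sum of the increments.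
A Henstock--Kurzweil gauge can arrange for both, and the integral of \<open>g'\<close> is obtained without knowing
beforehand that \<open>g'\<close> is integrable.\<close>

theorem fundamental_theorem_abs_continuous:
  fixes g g' :: "real \<Rightarrow> complex"
  assumes ab: "a \<le> b" and ac: "abs_continuous_on a b g" and N: "negligible N"
    and der: "\<And>x. x \<in> {a..b} - N \<Longrightarrow> (g has_vector_derivative g' x) (at x within {a..b})"
  shows "(g' has_integral (g b - g a)) {a..b}"
proof (cases "a = b")
  case True then show ?thesis by auto
next
  case False
  with ab have ab': "a < b" by simp
  define h where "h x = (if x \<in> N then 0 else g' x)" for x
  have "(h has_integral (g b - g a)) {a..b}"
    unfolding has_integral_factor_content_real
  proof (intro allI impI)
    fix e :: real assume e: "e > 0"
    define \<epsilon> where "\<epsilon> = e / 2 * (b - a)"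
    have \<epsilon>: "\<epsilon> > 0" using e ab' by (simp add: \<epsilon>_def)
    obtain \<delta> where \<delta>: "\<delta> > 0" and AC: 
      "\<And>(I :: (real \<times> real set) set) s t. \<lbrakk>finite I; \<And>i. i \<in> I \<Longrightarrow> a \<le> s i \<and> s i \<le> t i \<and> t i \<le> b;
        disjoint_family_on (\<lambda>i. {s i<..<t i}) I; (\<Sum>i\<in>I. t i - s i) < \<delta>\<rbrakk> \<Longrightarrow>
        (\<Sum>i\<in>I. cmod (g (t i) - g (s i))) < \<epsilon>"
      by (rule abs_continuous_on_finite[OF ac \<epsilon>]) blast
    have Nm: "N \<in> lmeasurable" "measure lebesgue N = 0"
      using N by (auto simp: negligible_iff_measure)
    obtain U where U: "open U" "N \<subseteq> U" "U \<in> lmeasurable" "measure lebesgue U < \<delta>"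
    proof -
      obtain U where U: "open U" "N \<subseteq> U" "U - N \<in> lmeasurable" "emeasure lebesgue (U - N) < ennreal \<delta>"
        using sets_lebesgue_outer_open[OF _ \<delta>, of N] Nm by blast
      have 1: "measure lebesgue (U - N) < \<delta>"
        using U(3,4) \<delta> by (simp add: emeasure_eq_measure2 ennreal_less_iff)
      have 2: "U = (U - N) \<union> N" using U(2) by blast
      have "U \<in> lmeasurable" using U(3) Nm 2 by (metis fmeasurable.Un)
      moreover have "measure lebesgue U \<le> measure lebesgue (U - N) + measure lebesgue N"
        using U(3) Nm 2 by (metis fmeasurableD measure_Un_le)
      ultimately show ?thesis using that U 1 Nm by simp
    qed
    have "\<exists>d>0. (x \<in> N \<longrightarrow> ball x d \<subseteq> U) \<and>
        (x \<in> {a..b} - N \<longrightarrow> (\<forall>y\<in>{a..b}. \<bar>y - x\<bar> < d \<longrightarrow> cmod (g y - g x - (y - x) *\<^sub>R g' x) \<le> e/2 * \<bar>y - x\<bar>))" for x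
    proof (cases "x \<in> N")
      case True
      then show ?thesis using U openE by (metis DiffD2 subsetD)
    next
      case xN: False
      show ?thesis
      proof (cases "x \<in> {a..b}")
        case True
        with xN have "(g has_derivative (\<lambda>t. t *\<^sub>R g' x)) (at x within {a..b})"
          using der[of x] by (auto simp: has_vector_derivative_def)
        then show ?thesis using e xN unfolding has_derivative_within_alt
          by (metis divide_pos_pos real_norm_def zero_less_numeral)
      next
        case False then show ?thesis using xN by (intro exI[of _ 1]) auto
      qed
    qed
    then obtain d where d: "\<And>x. d x > 0" "\<And>x. x \<in> N \<Longrightarrow> ball x (d x) \<subseteq> U"
      "\<And>x y. x \<in> {a..b} \<Longrightarrow> x \<notin> N \<Longrightarrow> y \<in> {a..b} \<Longrightarrow> \<bar>y - x\<bar> < d x \<Longrightarrow> cmod (g y - g x - (y - x) *\<^sub>R g' x) \<le> e/2 * \<bar>y - x\<bar>"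
      by (metis DiffI)
    show "\<exists>d. gauge d \<and> (\<forall>p. p tagged_division_of {a..b} \<and> d fine p \<longrightarrow> 
      norm ((\<Sum>(x, k)\<in>p. measure lborel k *\<^sub>R h x) - (g b - g a)) \<le> e * measure lborel {a..b})"
    proof (intro exI[of _ "\<lambda>x. ball x (d x)"] conjI allI impI)
      show "gauge (\<lambda>x. ball x (d x))" using d(1) by (auto simp: gauge_def)
      fix p assume "p tagged_division_of {a..b} \<and> (\<lambda>x. ball x (d x)) fine p"
      then have p: "p tagged_division_of {a..b}" and fine: "(\<lambda>x. ball x (d x)) fine p" by auto
      define lo hi where "lo = (\<lambda>q::real\<times>real set. Inf (snd q))" and "hi = (\<lambda>q::real\<times>real set. Sup (snd q))"
      have finp: "finite p" using p by blast
      have iv: "k = {lo (x,k)..hi (x,k)} \<and> lo (x,k) \<le> x \<and> x \<le> hi (x,k) \<and> a \<le> lo (x,k) \<and> hi (x,k) \<le> b \<and> k \<subseteq> ball x (d x)"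
        if "(x,k) \<in> p" for x k
      proof -
        have 1: "x \<in> k" "k \<subseteq> {a..b}" "\<exists>u v. k = cbox u v"
          using tagged_division_ofD(2,3,4)[OF p that] by blast+
        then obtain u v where k: "k = {u..v}" by auto
        moreover have "k \<subseteq> ball x (d x)" using fine that by (auto simp: fine_def)
        ultimately show ?thesis using 1 by (auto simp: lo_def hi_def)
      qed
      have "(\<Sum>(x, k)\<in>p. g (Sup k) - g (Inf k)) = g b - g a"
        using additive_tagged_division_1[OF ab p, of g] by simp
      then have gba: "g b - g a = (\<Sum>q\<in>p. g (hi q) - g (lo q))"
        by (simp add: lo_def hi_def case_prod_beta)
      define F where "F q = measure lborel (snd q) *\<^sub>R h (fst q) - (g (hi q) - g (lo q))" for q
      have "(\<Sum>(x, k)\<in>p. measure lborel k *\<^sub>R h x) - (g b - g a) = (\<Sum>q\<in>p. F q)"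
        unfolding gba F_def by (simp add: sum_subtractf case_prod_beta)
      also have "norm \<dots> \<le> (\<Sum>q\<in>p. cmod (F q))" by (rule norm_sum)
      also have "\<dots> = (\<Sum>q\<in>p \<inter> {q. fst q \<in> N}. cmod (F q)) + (\<Sum>q\<in>p - {q. fst q \<in> N}. cmod (F q))"
        using sum.Int_Diff[OF finp] by blast
      also have "(\<Sum>q\<in>p - {q. fst q \<in> N}. cmod (F q)) \<le> (\<Sum>q\<in>p - {q. fst q \<in> N}. e/2 * measure lborel (snd q))"
      proof (rule sum_mono)
        fix q assume q: "q \<in> p - {q. fst q \<in> N}"
        obtain x k where qk: "q = (x,k)" by fastforce
        have xk: "(x,k) \<in> p" "x \<notin> N" using q qk by auto
        note I = iv[OF xk(1)]
        have hk: "hi q \<in> k" "lo q \<in> k" using I by (auto simp: qk)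
        have 1: "cmod (g (hi q) - g x - (hi q - x) *\<^sub>R g' x) \<le> e/2 * \<bar>hi q - x\<bar>"
          using hk I xk by (intro d(3)) (auto simp: qk dist_real_def subset_iff)
        have 2: "cmod (g (lo q) - g x - (lo q - x) *\<^sub>R g' x) \<le> e/2 * \<bar>lo q - x\<bar>"
          using hk I xk by (intro d(3)) (auto simp: qk dist_real_def subset_iff)
        have ck: "measure lborel k = hi q - lo q" using I by (metis content_real order_trans qk)
        have "F q = (g (lo q) - g x - (lo q - x) *\<^sub>R g' x) - (g (hi q) - g x - (hi q - x) *\<^sub>R g' x)"
          using xk ck by (simp add: F_def h_def qk scaleR_left_diff_distrib)
        then have "cmod (F q) \<le> e/2 * \<bar>lo q - x\<bar> + e/2 * \<bar>hi q - x\<bar>"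
          using 1 2 norm_triangle_ineq4 by (smt (verit))
        also have "\<dots> = e/2 * (x - lo q) + e/2 * (hi q - x)"
          using conjunct1[OF conjunct2[OF I]] conjunct1[OF conjunct2[OF conjunct2[OF I]]] by (simp add: qk)
        also have "\<dots> = e/2 * measure lborel (snd q)"
          unfolding qk snd_conv ck[unfolded qk] by (simp add: algebra_simps)
        finally show "cmod (F q) \<le> e/2 * measure lborel (snd q)" .
      qed
      also have "\<dots> \<le> (\<Sum>q\<in>p. e/2 * measure lborel (snd q))"
        by (rule sum_mono2) (use finp e in auto)
      also have "\<dots> = e/2 * (\<Sum>q\<in>p. measure lborel (snd q))"
        by (rule sum_distrib_left[symmetric])
      also have "(\<Sum>q\<in>p. measure lborel (snd q)) = b - a"
        using additive_content_tagged_division[of p a b] p ab by (simp add: case_prod_beta)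
      also have "(\<Sum>q\<in>p \<inter> {q. fst q \<in> N}. cmod (F q)) = (\<Sum>q\<in>p \<inter> {q. fst q \<in> N}. cmod (g (hi q) - g (lo q)))"
        by (rule sum.cong) (auto simp: F_def h_def norm_minus_commute)
      also have "\<dots> < \<epsilon>"
      proof (rule AC)
        show f': "finite (p \<inter> {q. fst q \<in> N})" using finp by auto
        show "a \<le> lo q \<and> lo q \<le> hi q \<and> hi q \<le> b" if "q \<in> p \<inter> {q. fst q \<in> N}" for q
          using iv[of "fst q" "snd q"] that by auto
        show dj: "disjoint_family_on (\<lambda>i. {lo i<..<hi i}) (p \<inter> {q. fst q \<in> N})"
          unfolding disjoint_family_on_def
        proof (intro ballI impI)
          fix q r assume qr: "q \<in> p \<inter> {q. fst q \<in> N}" "r \<in> p \<inter> {q. fst q \<in> N}" "q \<noteq> r"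
          have "interior (snd q) \<inter> interior (snd r) = {}"
            using tagged_division_ofD(5)[OF p, of "fst q" "snd q" "fst r" "snd r"] qr by auto
          moreover have "interior (snd q) = {lo q<..<hi q}" "interior (snd r) = {lo r<..<hi r}"
            using iv[of "fst q" "snd q"] iv[of "fst r" "snd r"] qr interior_atLeastAtMost_real
            by (metis IntD1 prod.collapse)+
          ultimately show "{lo q<..<hi q} \<inter> {lo r<..<hi r} = {}" by simp
        qed
        have "(\<Sum>i\<in>p \<inter> {q. fst q \<in> N}. hi i - lo i) = (\<Sum>i\<in>p \<inter> {q. fst q \<in> N}. measure lebesgue {lo i<..<hi i})"
          by (rule sum.cong) (use iv in force)+
        also have "\<dots> = measure lebesgue (\<Union>i\<in>p \<inter> {q. fst q \<in> N}. {lo i<..<hi i})"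
          using f' dj fmeasurableD2[OF lmeasurable_box[of "lo _" "hi _"]]
          by (intro measure_finite_Union[symmetric]) auto
        also have "\<dots> \<le> measure lebesgue U"
        proof (rule measure_mono_fmeasurable)
          show "(\<Union>i\<in>p \<inter> {q. fst q \<in> N}. {lo i<..<hi i}) \<subseteq> U"
            using iv d(2) by fastforce
        qed (use U f' in auto)
        also have "\<dots> < \<delta>" by fact
        finally show "(\<Sum>i\<in>p \<inter> {q. fst q \<in> N}. hi i - lo i) < \<delta>" .
      qed
      finally show "norm ((\<Sum>(x, k)\<in>p. measure lborel k *\<^sub>R h x) - (g b - g a)) \<le> e * measure lborel {a..b}"
        using ab by (simp add: \<epsilon>_def)
    qed
  qed
  then show ?thesis
    by (rule has_integral_spike[OF N, rotated]) (auto simp: h_def)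
qed

section \<open>Green's identity for the radial equation\<close>

lemma abs_continuous_on_subset:
  assumes "abs_continuous_on a b g" "a \<le> a'" "b' \<le> b"
  shows "abs_continuous_on a' b' g"
  unfolding abs_continuous_on_def
proof (intro allI impI)
  fix \<epsilon> :: real assume "\<epsilon> > 0"
  then obtain \<delta> where d: "\<delta> > 0" "\<And>(n::nat) s t.
        (\<forall>i<n. a \<le> s i \<and> s i \<le> t i \<and> t i \<le> b) \<and> disjoint_family_on (\<lambda>i. {s i<..<t i}) {..<n} \<and>
        (\<Sum>i<n. t i - s i) < \<delta> \<Longrightarrow> (\<Sum>i<n. cmod (g (t i) - g (s i))) < \<epsilon>"
    using assms(1) unfolding abs_continuous_on_def by blast
  show "\<exists>\<delta>>0. \<forall>(n::nat) s t.
        (\<forall>i<n. a' \<le> s i \<and> s i \<le> t i \<and> t i \<le> b') \<and> disjoint_family_on (\<lambda>i. {s i<..<t i}) {..<n} \<and>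
        (\<Sum>i<n. t i - s i) < \<delta> \<longrightarrow> (\<Sum>i<n. cmod (g (t i) - g (s i))) < \<epsilon>"
  proof (intro exI[of _ \<delta>] conjI allI impI)
    fix n and s t :: "nat \<Rightarrow> real"
    assume *: "(\<forall>i<n. a' \<le> s i \<and> s i \<le> t i \<and> t i \<le> b') \<and> disjoint_family_on (\<lambda>i. {s i<..<t i}) {..<n} \<and>
        (\<Sum>i<n. t i - s i) < \<delta>"
    then have "\<forall>i<n. a \<le> s i \<and> s i \<le> t i \<and> t i \<le> b" using assms(2,3) by fastforce
    with * show "(\<Sum>i<n. cmod (g (t i) - g (s i))) < \<epsilon>" by (intro d(2)) simp
  qed (rule d(1))
qed

lemma abs_continuous_on_imp_continuous_on:
  assumes "abs_continuous_on a b g"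
  shows "continuous_on {a..b} g"
  unfolding continuous_on_iff
proof (intro ballI allI impI)
  fix x e :: real assume x: "x \<in> {a..b}" and e: "e > 0"
  obtain \<delta> where d: "\<delta> > 0" "\<And>(n::nat) s t.
        (\<forall>i<n. a \<le> s i \<and> s i \<le> t i \<and> t i \<le> b) \<and> disjoint_family_on (\<lambda>i. {s i<..<t i}) {..<n} \<and>
        (\<Sum>i<n. t i - s i) < \<delta> \<Longrightarrow> (\<Sum>i<n. cmod (g (t i) - g (s i))) < e"
    using assms e unfolding abs_continuous_on_def by blast
  have "dist (g y) (g x) < e" if y: "y \<in> {a..b}" "dist y x < \<delta>" for y
  proof (cases "x \<le> y")
    case True
    then show ?thesis
      using d(2)[of 1 "\<lambda>_. x" "\<lambda>_. y"] x y by (simp add: dist_norm disjoint_family_on_def)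
  next
    case False
    then show ?thesis
      using d(2)[of 1 "\<lambda>_. y" "\<lambda>_. x"] x y by (simp add: dist_norm disjoint_family_on_def norm_minus_commute)
  qed
  then show "\<exists>d>0. \<forall>x'\<in>{a..b}. dist x' x < d \<longrightarrow> dist (g x') (g x) < e" using d(1) by blast
qed

lemma abs_continuous_on_mult_lipschitz:
  assumes ac: "abs_continuous_on a b g" and M: "\<And>x. x \<in> {a..b} \<Longrightarrow> cmod (g x) \<le> M"
    and K: "\<And>x. x \<in> {a..b} \<Longrightarrow> cmod (h x) \<le> K"
    and L: "\<And>x y. x \<in> {a..b} \<Longrightarrow> y \<in> {a..b} \<Longrightarrow> cmod (h x - h y) \<le> L * \<bar>x - y\<bar>"
    and pos: "M \<ge> 0" "K \<ge> 0" "L \<ge> 0"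
  shows "abs_continuous_on a b (\<lambda>x. g x * h x)"
  unfolding abs_continuous_on_def
proof (intro allI impI)
  fix \<epsilon> :: real assume e: "\<epsilon> > 0"
  then have "\<epsilon> / (2 * (K + 1)) > 0" using pos by simp
  then obtain \<delta> where d: "\<delta> > 0" "\<And>(n::nat) s t.
        (\<forall>i<n. a \<le> s i \<and> s i \<le> t i \<and> t i \<le> b) \<and> disjoint_family_on (\<lambda>i. {s i<..<t i}) {..<n} \<and>
        (\<Sum>i<n. t i - s i) < \<delta> \<Longrightarrow> (\<Sum>i<n. cmod (g (t i) - g (s i))) < \<epsilon> / (2 * (K + 1))"
    using ac unfolding abs_continuous_on_def by blast
  have MLnn: "M * L \<ge> 0" using pos by simp
  define \<eta> where "\<eta> = min \<delta> (\<epsilon> / (2 * (M * L + 1)))"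
  have "\<eta> > 0" using d(1) e MLnn by (simp add: \<eta>_def)
  moreover have "(\<Sum>i<n. cmod (g (t i) * h (t i) - g (s i) * h (s i))) < \<epsilon>"
    if st: "\<forall>i<n. a \<le> s i \<and> s i \<le> t i \<and> t i \<le> b" and dis: "disjoint_family_on (\<lambda>i. {s i<..<t i}) {..<n}"
      and sm: "(\<Sum>i<n. t i - s i) < \<eta>" for n :: nat and s t
  proof -
    have 1: "(\<Sum>i<n. cmod (g (t i) - g (s i))) < \<epsilon> / (2 * (K + 1))"
      by (rule d(2)) (use st dis sm in \<open>simp add: \<eta>_def\<close>)
    have "(\<Sum>i<n. cmod (g (t i) * h (t i) - g (s i) * h (s i)))
        \<le> (\<Sum>i<n. K * cmod (g (t i) - g (s i)) + M * L * (t i - s i))"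
    proof (rule sum_mono)
      fix i assume "i \<in> {..<n}"
      then have i: "t i \<in> {a..b}" "s i \<in> {a..b}" "s i \<le> t i" using st by fastforce+
      have "g (t i) * h (t i) - g (s i) * h (s i) = (g (t i) - g (s i)) * h (t i) + g (s i) * (h (t i) - h (s i))"
        by (simp add: algebra_simps)
      then have "cmod (g (t i) * h (t i) - g (s i) * h (s i)) \<le>
          cmod (g (t i) - g (s i)) * cmod (h (t i)) + cmod (g (s i)) * cmod (h (t i) - h (s i))"
        by (metis norm_mult norm_triangle_ineq)
      also have "\<dots> \<le> cmod (g (t i) - g (s i)) * K + M * (L * \<bar>t i - s i\<bar>)"
        using i K[of "t i"] M[of "s i"] L[of "t i" "s i"] pos
        by (intro add_mono mult_mono) auto
      finally show "cmod (g (t i) * h (t i) - g (s i) * h (s i)) \<le> K * cmod (g (t i) - g (s i)) + M * L * (t i - s i)"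
        using i by (simp add: mult_ac)
    qed
    also have "\<dots> = K * (\<Sum>i<n. cmod (g (t i) - g (s i))) + M * L * (\<Sum>i<n. t i - s i)"
      by (simp add: sum.distrib sum_distrib_left)
    also have "\<dots> \<le> K * (\<epsilon> / (2 * (K + 1))) + M * L * (\<epsilon> / (2 * (M * L + 1)))"
      using 1 sm pos MLnn by (intro add_mono mult_left_mono) (auto simp: \<eta>_def)
    also have "\<dots> < \<epsilon> / 2 + \<epsilon> / 2"
    proof (rule add_strict_mono)
      have *: "c * (\<epsilon> / (2 * (c + 1))) < \<epsilon> / 2" if "c \<ge> 0" for c
        using e that by (simp add: field_simps)
      show "K * (\<epsilon> / (2 * (K + 1))) < \<epsilon> / 2" "M * L * (\<epsilon> / (2 * (M * L + 1))) < \<epsilon> / 2"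
        using *[OF pos(2)] *[OF MLnn] by blast+
    qed
    finally show ?thesis by simp
  qed
  ultimately show "\<exists>\<delta>>0. \<forall>(n::nat) s t.
        (\<forall>i<n. a \<le> s i \<and> s i \<le> t i \<and> t i \<le> b) \<and> disjoint_family_on (\<lambda>i. {s i<..<t i}) {..<n} \<and>
        (\<Sum>i<n. t i - s i) < \<delta> \<longrightarrow> (\<Sum>i<n. cmod (g (t i) * h (t i) - g (s i) * h (s i))) < \<epsilon>"
    by blast
qed

text \<open>A radial solution together with its derivative and the null set on which the equation may fail. The
coefficient \<open>l * (l + 1)\<close> with \<open>l = m - 1/2\<close> is written as \<open>m\<^sup>2 - 1/4\<close>.\<close>

locale radial_ode =
  fixes V :: "real \<Rightarrow> complex" and m :: nat and y y' :: "real \<Rightarrow> complex" and N :: "real set"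
  assumes dy: "\<And>r. r \<in> {0<..1} \<Longrightarrow> (y has_vector_derivative y' r) (at r within {0<..1})"
    and ac: "\<And>a. a \<in> {0<..1} \<Longrightarrow> abs_continuous_on a 1 y'"
    and N: "negligible N"
    and ode: "\<And>r. r \<in> {0<..<1} - N \<Longrightarrow> 
       (y' has_vector_derivative (of_real (((real m)\<^sup>2 - 1/4) / r\<^sup>2) * y r + V r * y r)) (at r)"
    and asy: "y \<sim>[at_right 0] (\<lambda>r. of_real (r powr (ell m + 1)))"
    and asy': "y' \<sim>[at_right 0] (\<lambda>r. of_real ((ell m + 1) * r powr ell m))"

lemma radial_solution_imp_radial_ode:
  assumes "radial_solution V m y"
  shows "\<exists>y' N. radial_ode V m y y' N"
proof -
  obtain y' where y': "\<forall>r\<in>{0<..1}. (y has_vector_derivative y' r) (at r within {0<..1})"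
     "\<forall>a\<in>{0<..1}. abs_continuous_on a 1 y'"
     and ae: "AE r in lebesgue_on {0<..<1}. \<exists>y2. (y' has_vector_derivative y2) (at r) \<and>
        - y2 + of_real (ell m * (ell m + 1) / r\<^sup>2) * y r + V r * y r = 0"
     and a: "y \<sim>[at_right 0] (\<lambda>r. of_real (r powr (ell m + 1)))"
     "y' \<sim>[at_right 0] (\<lambda>r. of_real ((ell m + 1) * r powr ell m))"
    using assms unfolding radial_solution_def by blast
  have l: "ell m * (ell m + 1) = (real m)\<^sup>2 - 1/4" by (simp add: ell_def power2_eq_square algebra_simps)
  have "AE r in lebesgue. r \<in> {0<..<1} \<longrightarrow> (\<exists>y2. (y' has_vector_derivative y2) (at r) \<and>
        - y2 + of_real (ell m * (ell m + 1) / r\<^sup>2) * y r + V r * y r = 0)"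
    using ae by (subst (asm) AE_restrict_space_iff) auto
  then obtain N where N: "N \<in> null_sets lebesgue" "{r. \<not> (r \<in> {0<..<1} \<longrightarrow> (\<exists>y2. (y' has_vector_derivative y2) (at r) \<and>
        - y2 + of_real (ell m * (ell m + 1) / r\<^sup>2) * y r + V r * y r = 0))} \<subseteq> N"
    unfolding eventually_ae_filter by auto
  have "radial_ode V m y y' N"
  proof
    show "negligible N" using N(1) by (simp add: negligible_iff_null_sets)
    fix r :: real assume r: "r \<in> {0<..<1} - N"
    then obtain y2 where "(y' has_vector_derivative y2) (at r)" "- y2 + of_real (ell m * (ell m + 1) / r\<^sup>2) * y r + V r * y r = 0"
      using N(2) by blast
    moreover from this have "of_real (((real m)\<^sup>2 - 1/4) / r\<^sup>2) * y r + V r * y r = y2"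
      unfolding l by algebra
    ultimately show "(y' has_vector_derivative (of_real (((real m)\<^sup>2 - 1/4) / r\<^sup>2) * y r + V r * y r)) (at r)"
      by simp
  qed (use y' a in auto)
  then show ?thesis by blast
qed

context radial_ode
begin

lemma continuous_y': "a > 0 \<Longrightarrow> continuous_on {a..1} y'"
  using ac abs_continuous_on_imp_continuous_on by (cases "a \<le> 1") auto

lemma continuous_y: "continuous_on {0<..1} y"
  using dy by (meson continuous_on_eq_continuous_within has_vector_derivative_continuous)

text \<open>The product \<open>y' * z\<close> is only absolutely continuous, but \<open>y * z'\<close> is differentiable everywhere. In the
difference of the two fundamental theorems the terms \<open>y' * z'\<close> cancel.\<close>

lemma green_identity:
  assumes ab: "0 < a" "a \<le> b" "b \<le> 1"
    and z: "\<And>r. r \<in> {a..b} \<Longrightarrow> (z has_vector_derivative z' r) (at r within {a..b})"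
    and z': "\<And>r. r \<in> {a..b} \<Longrightarrow> (z' has_vector_derivative z'' r) (at r within {a..b})"
  shows "((\<lambda>r. of_real (((real m)\<^sup>2 - 1/4) / r\<^sup>2) * y r * z r + V r * y r * z r - y r * z'' r) has_integral
           ((y' b * z b - y b * z' b) - (y' a * z a - y a * z' a))) {a..b}"
proof -
  have dy': "(y has_vector_derivative y' r) (at r within {a..b})" if "r \<in> {a..b}" for r
    by (rule has_vector_derivative_within_subset[OF dy]) (use that ab in auto)
  have cz: "continuous_on {a..b} z" "continuous_on {a..b} z'" "continuous_on {a..b} y'"
    using z z' has_vector_derivative_continuous continuous_on_subset[OF continuous_y'[OF ab(1)], of "{a..b}"] ab(3)
    unfolding continuous_on_eq_continuous_within by (blast, blast, auto)
  have cpt: "\<exists>B\<ge>0. \<forall>x\<in>{a..b}. cmod (k x) \<le> B" if "continuous_on {a..b} k" for k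
    using compact_imp_bounded[OF compact_continuous_image[OF that compact_Icc]]
    by (metis bounded_pos image_eqI less_imp_le)
  obtain M K L where M: "M \<ge> 0" "\<And>x. x\<in>{a..b} \<Longrightarrow> cmod (y' x) \<le> M" and K: "K \<ge> 0" "\<And>x. x\<in>{a..b} \<Longrightarrow> cmod (z x) \<le> K"
    and L: "L \<ge> 0" "\<And>x. x\<in>{a..b} \<Longrightarrow> cmod (z' x) \<le> L"
    using cpt[OF cz(1)] cpt[OF cz(2)] cpt[OF cz(3)] by metis
  have lip: "cmod (z x - z w) \<le> L * \<bar>x - w\<bar>" if "x \<in> {a..b}" "w \<in> {a..b}" for x w
  proof -
    have "norm (z x - z w) \<le> L * norm (x - w)"
    proof (rule differentiable_bound[of "{a..b}" z "\<lambda>r t. t *\<^sub>R z' r"])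
      show "onorm (\<lambda>t. t *\<^sub>R z' r) \<le> L" if "r \<in> {a..b}" for r
        using L(2)[OF that] by (intro onorm_le) (auto simp: mult.commute[of L] intro!: mult_left_mono)
    qed (use z that in \<open>auto simp: has_vector_derivative_def\<close>)
    then show ?thesis by simp
  qed
  have AC: "abs_continuous_on a b (\<lambda>x. y' x * z x)"
    using abs_continuous_on_subset[OF ac[of a], of a b] ab M K L lip
    by (intro abs_continuous_on_mult_lipschitz[where M=M and K=K and L=L]) auto
  have 1: "((\<lambda>r. y' r * z' r + (of_real (((real m)\<^sup>2 - 1/4) / r\<^sup>2) * y r + V r * y r) * z r) has_integral y' b * z b - y' a * z a) {a..b}"
  proof (rule fundamental_theorem_abs_continuous[OF ab(2) AC, of "insert b N"])
    fix x assume x: "x \<in> {a..b} - insert b N"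
    then have "(y' has_vector_derivative (of_real (((real m)\<^sup>2 - 1/4) / x\<^sup>2) * y x + V x * y x)) (at x within {a..b})"
      using ode[of x] ab by (auto intro: has_vector_derivative_at_within)
    then show "((\<lambda>x. y' x * z x) has_vector_derivative y' x * z' x + (of_real (((real m)\<^sup>2 - 1/4) / x\<^sup>2) * y x + V x * y x) * z x) (at x within {a..b})"
      using z[of x] x by (intro has_vector_derivative_mult) auto
  qed (use N in auto)
  have 2: "((\<lambda>r. y r * z'' r + y' r * z' r) has_integral y b * z' b - y a * z' a) {a..b}"
    using dy' z' by (intro fundamental_theorem_of_calculus ab has_vector_derivative_mult) auto
  show ?thesis
    using has_integral_diff[OF 1 2] by (simp add: algebra_simps)
qed

end

section \<open>Size of the radial functions\<close>

context radial_ode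
begin

text \<open>The locale knows a single \<open>y\<close>; as a constant family it fits the definition of \<^const>\<open>alpha\<close>.\<close>

abbreviation (input) "\<alpha> \<equiv> alpha (\<lambda>_. y) m"

lemma alpha_pos: "r > 0 \<Longrightarrow> \<alpha> r = y r / of_real (r powr (real m + 1/2))"
  by (simp add: alpha_def ell_def add.commute)

lemma y_eq_alpha: "r > 0 \<Longrightarrow> y r = \<alpha> r * of_real (r powr (real m + 1/2))"
  by (simp add: alpha_pos)

lemma tendsto_alpha_0: "(\<alpha> \<longlongrightarrow> 1) (at_right 0)"
proof -
  have "((\<lambda>x. if y x = 0 \<and> complex_of_real (x powr (ell m + 1)) = 0 then 1 
      else y x / complex_of_real (x powr (ell m + 1))) \<longlongrightarrow> 1) (at_right 0)"
    using asy unfolding asymp_equiv_def .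
  then show ?thesis
    by (rule Lim_transform_eventually)
       (auto simp: eventually_at_right_less alpha_def intro!: eventually_mono[OF eventually_at_right_less])
qed

lemma tendsto_y'_ratio:
  "((\<lambda>r. y' r / of_real ((real m + 1/2) * r powr (real m - 1/2))) \<longlongrightarrow> 1) (at_right 0)"
proof -
  have "((\<lambda>x. if y' x = 0 \<and> complex_of_real ((ell m + 1) * x powr ell m) = 0 then 1 
      else y' x / complex_of_real ((ell m + 1) * x powr ell m)) \<longlongrightarrow> 1) (at_right 0)"
    using asy' unfolding asymp_equiv_def .
  moreover have "\<forall>\<^sub>F x in at_right (0::real). (if y' x = 0 \<and> complex_of_real ((ell m + 1) * x powr ell m) = 0 then 1 
      else y' x / complex_of_real ((ell m + 1) * x powr ell m)) = y' x / of_real ((real m + 1/2) * x powr (real m - 1/2))"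
  proof (rule eventually_mono[OF eventually_at_right_less])
    fix x :: real assume "0 < x"
    moreover have "ell m + 1 = real m + 1/2" "real m + 1/2 > 0" "ell m = real m - 1/2" by (simp_all add: ell_def)
    ultimately show "(if y' x = 0 \<and> complex_of_real ((ell m + 1) * x powr ell m) = 0 then 1 
      else y' x / complex_of_real ((ell m + 1) * x powr ell m)) = y' x / of_real ((real m + 1/2) * x powr (real m - 1/2))"
      by (metis less_irrefl mult_eq_0_iff of_real_eq_0_iff powr_gt_zero)
  qed
  ultimately show ?thesis by (rule Lim_transform_eventually)
qed

lemma continuous_on_alpha: "continuous_on {0..1} (\<alpha>)"
proof -
  have 0: "\<alpha> 0 = 1" by (simp add: alpha_def)
  have "continuous_on {0<..1} (\<lambda>r. y r / of_real (r powr (real m + 1/2)))"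
    by (intro continuous_intros continuous_y) auto
  then have 1: "continuous_on {0<..1} (\<alpha>)"
    by (rule continuous_on_eq) (simp add: alpha_pos)
  show ?thesis
    unfolding continuous_on_def
  proof
    fix x :: real assume x: "x \<in> {0..1}"
    show "(\<alpha> \<longlongrightarrow> \<alpha> x) (at x within {0..1})"
    proof (cases "x = 0")
      case True
      have "(\<alpha> \<longlongrightarrow> 1) (at 0 within {0..1})"
        using tendsto_alpha_0 by (simp add: at_within_Icc_at_right)
      then show ?thesis using True 0 by simp
    next
      case False
      with x have x: "x \<in> {0<..1}" by auto
      have "at x within {0..1} = at x within {0<..1}"
        by (rule at_within_nhd[of _ "{0<..}"]) (use x in auto)
      then show ?thesis using 1 x by (auto simp: continuous_on_def)
    qed
  qed
qed

lemma tendsto_sqrt_y: "((\<lambda>r. of_real (sqrt r) * y r) \<longlongrightarrow> 0) (at_right 0)"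
proof -
  have "((\<lambda>r. of_real (sqrt r) * (\<alpha> r * of_real (r powr (real m + 1/2)))) \<longlongrightarrow> 
     of_real (sqrt 0) * (1 * of_real (0 powr (real m + 1/2)))) (at_right 0)"
    by (intro tendsto_intros tendsto_alpha_0) (auto simp: eventually_at_right_less intro: eventually_mono[OF eventually_at_right_less])
  then have "((\<lambda>r. of_real (sqrt r) * (\<alpha> r * of_real (r powr (real m + 1/2)))) \<longlongrightarrow> 0) (at_right 0)" by simp
  then show ?thesis
    by (rule Lim_transform_eventually) (use y_eq_alpha in \<open>auto intro!: eventually_mono[OF eventually_at_right_less]\<close>)
qed

text \<open>To leading order the two terms are \<open>(m + 1/2) * r^m\<close> and \<open>r^m / 2\<close>. They tend to \<open>0\<close> if \<open>m > 0\<close>; if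
\<open>m = 0\<close> they cancel, by the normalisation of \<open>y'\<close> at \<open>0\<close>.\<close>

lemma tendsto_sqrt_y':
  "((\<lambda>r. of_real (sqrt r) * y' r - y r / (2 * of_real (sqrt r))) \<longlongrightarrow> 0) (at_right 0)"
proof -
  let ?\<rho> = "\<lambda>r. y' r / of_real ((real m + 1/2) * r powr (real m - 1/2))"
  have "((\<lambda>r. (?\<rho> r * of_real (real m + 1/2) - \<alpha> r / 2) * of_real r ^ m) \<longlongrightarrow> 
     (1 * of_real (real m + 1/2) - 1 / 2) * of_real 0 ^ m) (at_right 0)"
    by (intro tendsto_intros tendsto_alpha_0 tendsto_y'_ratio) auto
  moreover have "(1 * complex_of_real (real m + 1/2) - 1 / 2) * of_real 0 ^ m = 0"
    by (cases m) auto
  ultimately have "((\<lambda>r. (?\<rho> r * of_real (real m + 1/2) - \<alpha> r / 2) * of_real r ^ m) \<longlongrightarrow> 0) (at_right 0)"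
    by (simp only:)
  moreover have "\<forall>\<^sub>F r in at_right (0::real). (?\<rho> r * of_real (real m + 1/2) - \<alpha> r / 2) * of_real r ^ m
      = of_real (sqrt r) * y' r - y r / (2 * of_real (sqrt r))"
  proof (rule eventually_mono[OF eventually_at_right_less])
    fix r :: real assume r: "0 < r"
    have s: "sqrt r = r powr (1/2)" using r by (simp add: powr_half_sqrt)
    have e: "r powr (real m - 1/2) * r powr (1/2) = r ^ m" "r powr (real m + 1/2) = r ^ m * r powr (1/2)"
      using r by (simp_all add: powr_add[symmetric] powr_realpow[symmetric] )
    have n: "r powr (real m - 1/2) \<noteq> 0" "r powr (1/2) \<noteq> 0" "real m + 1/2 \<noteq> 0" using r by auto
    have "?\<rho> r * of_real (real m + 1/2) = y' r / of_real (r powr (real m - 1/2))"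
      using n by (simp add: divide_simps del: of_real_add)
    then have "?\<rho> r * of_real (real m + 1/2) * of_real r ^ m = of_real (sqrt r) * y' r"
      using n unfolding s by (simp add: e(1)[symmetric] flip: of_real_power)
    moreover have "\<alpha> r / 2 * of_real r ^ m = y r / (2 * of_real (sqrt r))"
      unfolding alpha_pos[OF r] s e(2) using r n by (simp add: divide_simps)
    ultimately show "(?\<rho> r * of_real (real m + 1/2) - \<alpha> r / 2) * of_real r ^ m
      = of_real (sqrt r) * y' r - y r / (2 * of_real (sqrt r))" by (simp add: left_diff_distrib)
  qed
  ultimately show ?thesis by (rule Lim_transform_eventually)
qed

text \<open>This is variation of constants in the form of Green's identity on \<open>[a, r]\<close>. The comparison function \<open>z\<close>
solves the equation without potential, with \<open>z r = 0\<close> and \<open>z' r = - r powr (- m - 1/2)\<close>. The boundary term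
at \<open>r\<close> is \<open>\<alpha> r\<close>, the one at \<open>a\<close> tends to \<open>1\<close> as \<open>a \<rightarrow> 0\<close>, and the integrand \<open>V s * y s * z s\<close> is at most
\<open>M * (s * \<bar>V s\<bar>) / (2 * m)\<close>. The smallness for large \<open>m\<close> comes from the Wronskian \<open>2 * m\<close> of
\<open>s powr (1/2 - m)\<close> and \<open>s powr (1/2 + m)\<close>.\<close>

lemma alpha_diff_bound:
  assumes J: "((\<lambda>s. s * cmod (V s)) has_integral J) {0..1}" and m: "m \<ge> 1"
    and M: "\<And>r. r \<in> {0..1} \<Longrightarrow> cmod (\<alpha> r) \<le> M"
    and r: "r \<in> {0<..1}"
  shows "cmod (\<alpha> r - 1) \<le> M * J / (2 * m)"
proof -
  define p q c :: real where "p = m + 1/2" and "q = 1/2 - m" and "c = r powr (- 2 * m)"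
  \<comment> \<open>The exponents \<open>p\<close> and \<open>q\<close> are the two roots of \<open>k * (k - 1) = m\<^sup>2 - 1/4\<close>.\<close>
  define z where "z = (\<lambda>s. complex_of_real ((s powr q - c * s powr p) / (2 * m)))"
  define z' where "z' = (\<lambda>s. complex_of_real ((q * s powr (q - 1) - c * (p * s powr (p - 1))) / (2 * m)))"
  define z'' where "z'' = (\<lambda>s. complex_of_real ((q * ((q - 1) * s powr (q - 1 - 1)) - c * (p * ((p - 1) * s powr (p - 1 - 1)))) / (2 * m)))"
  define T where "T = (\<lambda>s. y' s * z s - y s * z' s)"
  have m0: "real m > 0" using m by simp
  have M0: "M \<ge> 0" using order_trans[OF norm_ge_zero M[of 0]] by simp
  have qp: "q * (q - 1) = (real m)\<^sup>2 - 1/4" "p * (p - 1) = (real m)\<^sup>2 - 1/4"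
    by (simp_all add: p_def q_def power2_eq_square algebra_simps)
  have z''_eq: "z'' s = of_real (((real m)\<^sup>2 - 1/4) / s\<^sup>2) * z s" if "s > 0" for s
  proof -
    have "s powr (k - 1 - 1) = s powr k / s\<^sup>2" for k
      using that by (simp add: powr_diff power2_eq_square)
    then have "z'' s = complex_of_real ((q * (q - 1) * (s powr q / s\<^sup>2) - c * (p * (p - 1) * (s powr p / s\<^sup>2))) / (2 * m))"
      unfolding z''_def by (simp only: mult.assoc)
    also have "\<dots> = of_real (((real m)\<^sup>2 - 1/4) / s\<^sup>2) * z s"
      unfolding qp z_def of_real_mult[symmetric] by (rule arg_cong[of _ _ of_real]) (use that m0 in \<open>simp add: field_simps\<close>)
    finally show ?thesis .
  qed
  have dz: "(z has_vector_derivative z' s) (at s within S)" "(z' has_vector_derivative z'' s) (at s within S)" if "s > 0" for s S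
  proof -
    have "((\<lambda>s. (s powr q - c * s powr p) / (2 * m)) has_real_derivative (q * s powr (q - 1) - c * (p * s powr (p - 1))) / (2 * m)) (at s within S)"
      by (intro DERIV_cdivide DERIV_diff DERIV_cmult DERIV_subset[OF has_real_derivative_powr] that subset_UNIV)
    then show "(z has_vector_derivative z' s) (at s within S)"
      unfolding z_def z'_def by (intro has_vector_derivative_of_real) (simp add: has_real_derivative_iff_has_vector_derivative)
    have "((\<lambda>s. (q * s powr (q - 1) - c * (p * s powr (p - 1))) / (2 * m)) has_real_derivative (q * ((q - 1) * s powr (q - 1 - 1)) - c * (p * ((p - 1) * s powr (p - 1 - 1)))) / (2 * m)) (at s within S)"
      by (intro DERIV_cdivide DERIV_diff DERIV_cmult DERIV_subset[OF has_real_derivative_powr] that subset_UNIV)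
    then show "(z' has_vector_derivative z'' s) (at s within S)"
      unfolding z''_def z'_def by (intro has_vector_derivative_of_real) (simp add: has_real_derivative_iff_has_vector_derivative)
  qed
  have r0: "r > 0" "r \<le> 1" using r by auto
  have Tr: "T r = \<alpha> r"
  proof -
    have e: "c * r powr p = r powr q" "c * r powr (p - 1) = r powr (-p)" "r powr (q - 1) = r powr (-p)"
      unfolding c_def p_def q_def powr_add[symmetric] by (rule arg_cong[of _ _ "(powr) r"], simp)+
    have "(q * r powr (q - 1) - c * (p * r powr (p - 1))) = q * r powr (q - 1) - p * (c * r powr (p - 1))" by simp
    also have "\<dots> = - (2 * m) * r powr (-p)" unfolding e by (simp add: p_def q_def algebra_simps)
    finally have "(q * r powr (q - 1) - c * (p * r powr (p - 1))) / (2 * m) = - (r powr (-p))"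
      using m0 by simp
    then have z'r: "z' r = of_real (- (r powr (-p)))" unfolding z'_def by (simp only:)
    have zr: "z r = 0" unfolding z_def e by simp
    have "of_real (r powr p) * complex_of_real (r powr (-p)) = 1"
      unfolding of_real_mult[symmetric] powr_add[symmetric] using r0 by simp
    then show ?thesis
      unfolding T_def zr z'r by (subst y_eq_alpha[OF r0(1)]) (simp add: p_def[symmetric] mult.assoc)
  qed
  have T0: "(T \<longlongrightarrow> 1) (at_right 0)"
  proof -
    let ?\<rho> = "\<lambda>r. y' r / of_real ((real m + 1/2) * r powr (real m - 1/2))"
    have "((\<lambda>s. ?\<rho> s * of_real (p * (1 - c * s ^ (2 * m)) / (2 * m)) - \<alpha> s * of_real ((q - c * p * s ^ (2 * m)) / (2 * m))) \<longlongrightarrow>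
        1 * of_real (p * (1 - c * 0 ^ (2 * m)) / (2 * m)) - 1 * of_real ((q - c * p * 0 ^ (2 * m)) / (2 * m))) (at_right 0)"
      using m0 by (intro tendsto_intros tendsto_y'_ratio tendsto_alpha_0) auto
    moreover have "1 * complex_of_real (p * (1 - c * 0 ^ (2 * m)) / (2 * m)) - 1 * of_real ((q - c * p * 0 ^ (2 * m)) / (2 * m)) = 1"
    proof -
      have "p * (1 - c * 0 ^ (2 * m)) / (2 * m) - (q - c * p * 0 ^ (2 * m)) / (2 * m) = 1"
        using m0 by (simp add: power_0_left p_def q_def field_simps)
      then show ?thesis by (metis mult_1 of_real_1 of_real_diff)
    qed
    ultimately have "((\<lambda>s. ?\<rho> s * of_real (p * (1 - c * s ^ (2 * m)) / (2 * m)) - \<alpha> s * of_real ((q - c * p * s ^ (2 * m)) / (2 * m))) \<longlongrightarrow> 1) (at_right 0)"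
      by simp
    moreover have "\<forall>\<^sub>F s in at_right (0::real). ?\<rho> s * of_real (p * (1 - c * s ^ (2 * m)) / (2 * m)) - \<alpha> s * of_real ((q - c * p * s ^ (2 * m)) / (2 * m)) = T s"
    proof (rule eventually_mono[OF eventually_at_right_less])
      fix s :: real assume s: "0 < s"
      have y': "y' s = ?\<rho> s * of_real (p * s powr (p - 1))"
      proof -
        have "p - 1 = real m - 1/2" by (simp add: p_def)
        moreover have "(real m + 1/2) * s powr (real m - 1/2) \<noteq> 0" using s by auto
        ultimately show ?thesis
          unfolding p_def by (metis nonzero_eq_divide_eq of_real_eq_0_iff)
      qed
      have s2: "s ^ (2 * m) = s powr (2 * m)" using s by (simp add: powr_realpow[symmetric])
      have e: "s powr (p - 1) * s powr q = 1" "s powr (p - 1) * s powr p = s ^ (2 * m)"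
         "s powr p * s powr (q - 1) = 1" "s powr p * s powr (p - 1) = s ^ (2 * m)"
        using s unfolding s2 by (simp_all add: powr_add[symmetric] p_def q_def)
      have "p * s powr (p - 1) * ((s powr q - c * s powr p) / (2 * m)) = p * (s powr (p - 1) * s powr q - c * (s powr (p - 1) * s powr p)) / (2 * m)"
        by (simp add: algebra_simps)
      then have 1: "p * s powr (p - 1) * ((s powr q - c * s powr p) / (2 * m)) = p * (1 - c * s ^ (2 * m)) / (2 * m)"
        unfolding e .
      have "s powr p * ((q * s powr (q - 1) - c * (p * s powr (p - 1))) / (2 * m)) = (q * (s powr p * s powr (q - 1)) - c * p * (s powr p * s powr (p - 1))) / (2 * m)"
        by (simp add: algebra_simps)
      then have 2: "s powr p * ((q * s powr (q - 1) - c * (p * s powr (p - 1))) / (2 * m)) = (q - c * p * s ^ (2 * m)) / (2 * m)"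
        unfolding e by simp
      show "?\<rho> s * of_real (p * (1 - c * s ^ (2 * m)) / (2 * m)) - \<alpha> s * of_real ((q - c * p * s ^ (2 * m)) / (2 * m)) = T s"
      proof -
        have "?\<rho> s * of_real (p * s powr (p - 1) * X) = y' s * of_real X" for X
          using y' by (metis mult.assoc of_real_mult)
        moreover have "\<alpha> s * of_real (s powr p * X) = y s * of_real X" for X
          using y_eq_alpha[OF s] unfolding p_def by (metis mult.assoc of_real_mult)
        ultimately show ?thesis unfolding T_def z_def z'_def 1[symmetric] 2[symmetric] by (simp only:)
      qed
    qed
    ultimately show ?thesis by (rule Lim_transform_eventually)
  qed
  have bound: "cmod (T r - T a) \<le> M * J / (2 * m)" if a: "0 < a" "a < r" for a
  proof -
    have "((\<lambda>s. of_real (((real m)\<^sup>2 - 1/4) / s\<^sup>2) * y s * z s + V s * y s * z s - y s * z'' s) has_integral (T r - T a)) {a..r}"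
      unfolding T_def by (rule green_identity) (use a r0 dz in auto)
    then have 1: "((\<lambda>s. V s * y s * z s) has_integral (T r - T a)) {a..r}"
      by (rule has_integral_eq[rotated]) (use a in \<open>auto simp: z''_eq\<close>)
    have 2: "(\<lambda>s. M / (2 * m) * (s * cmod (V s))) integrable_on {a..r}"
      by (rule integrable_on_subinterval[OF has_integral_integrable[OF has_integral_mult_right[OF J]]]) (use a r0 in auto)
    have "cmod (integral {a..r} (\<lambda>s. V s * y s * z s)) \<le> integral {a..r} (\<lambda>s. M / (2 * m) * (s * cmod (V s)))"
    proof (rule integral_norm_bound_integral[OF has_integral_integrable[OF 1] 2])
      fix s assume s: "s \<in> {a..r}"
      then have s0: "s > 0" "s \<le> r" "s \<le> 1" using a r0 by auto
      have "c * s powr p = s powr q * (c * s powr (2 * m))"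
        using s0 by (simp add: p_def q_def powr_add[symmetric])
      moreover have c1: "c * s powr (2 * m) \<le> 1"
        using s0 r0 powr_mono2[of "2 * m" s r] by (simp add: c_def powr_minus divide_simps)
      moreover have "c * s powr p \<ge> 0" by (simp add: c_def)
      ultimately have "0 \<le> s powr q - c * s powr p" "s powr q - c * s powr p \<le> s powr q"
        using mult_left_le[OF c1 powr_ge_zero[of s q]] by linarith+
      then have zb: "cmod (z s) \<le> s powr q / (2 * m)"
        unfolding z_def norm_of_real using m0 by (simp add: divide_right_mono)
      have yb: "cmod (y s) \<le> M * s powr p"
        using M[of s] s0 unfolding y_eq_alpha[OF s0(1)] p_def norm_mult norm_of_real by (simp add: mult_right_mono)
      have pq: "s powr p * s powr q = s" using s0 by (simp add: powr_add[symmetric] p_def q_def)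
      have "cmod (V s * y s * z s) \<le> cmod (V s) * (M * s powr p) * (s powr q / (2 * m))"
        unfolding norm_mult using yb zb M0 by (intro mult_mono) auto
      also have "\<dots> = cmod (V s) * M * (s powr p * s powr q) / (2 * m)" by simp
      also have "\<dots> = M / (2 * m) * (s * cmod (V s))" unfolding pq by (simp add: mult_ac)
      finally show "cmod (V s * y s * z s) \<le> M / (2 * m) * (s * cmod (V s))" .
    qed
    also have "\<dots> \<le> integral {0..1} (\<lambda>s. M / (2 * m) * (s * cmod (V s)))"
      by (rule integral_subset_le[OF _ 2 has_integral_integrable[OF has_integral_mult_right[OF J]]]) (use a r0 M0 in auto)
    also have "\<dots> = M / (2 * m) * J" using integral_unique[OF J] by simp
    finally show ?thesis using integral_unique[OF 1] by simp
  qed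
  have "((\<lambda>a. cmod (T r - T a)) \<longlongrightarrow> cmod (T r - 1)) (at_right 0)" by (intro tendsto_intros T0)
  moreover have "\<forall>\<^sub>F a in at_right 0. cmod (T r - T a) \<le> M * J / (2 * m)"
    using eventually_at_right_real[OF r0(1)] by eventually_elim (use bound in auto)
  ultimately have "cmod (T r - 1) \<le> M * J / (2 * m)"
    by (rule tendsto_upperbound) simp
  then show ?thesis by (simp add: Tr)
qed

end

text \<open>With \<open>M = sup \<bar>\<alpha>\<bar>\<close> the bound of \<open>alpha_diff_bound\<close> improves itself: for \<open>m \<ge> 2 * J\<close> it yields
\<open>M \<le> 1 + M / 4\<close>, hence \<open>M \<le> 2\<close> and \<open>\<bar>\<alpha> 1 - 1\<bar> \<le> 1/2\<close>. Finitely many \<open>m\<close> remain.\<close>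

lemma alpha_uniform_bounds:
  fixes y :: "nat \<Rightarrow> real \<Rightarrow> complex"
  assumes J: "((\<lambda>s. s * cmod (V s)) has_integral J) {0..1}"
    and sol: "\<And>m. radial_solution V m (y m)" and nz: "\<And>m. alpha y m 1 \<noteq> 0"
  obtains C c where "C > 0" "c > 0" "\<And>m r. r \<in> {0..1} \<Longrightarrow> cmod (alpha y m r) \<le> C" 
    "\<And>m. c \<le> cmod (alpha y m 1)" "\<And>m. continuous_on {0..1} (alpha y m)"
proof -
  have al: "alpha y m = alpha (\<lambda>_. y m) m" for m by (simp add: alpha_def fun_eq_iff)
  have cont: "continuous_on {0..1} (alpha y m)" for m
    using radial_solution_imp_radial_ode[OF sol[of m]] radial_ode.continuous_on_alpha unfolding al by blast
  define M where "M m = Sup ((\<lambda>r. cmod (alpha y m r)) ` {0..1})" for m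
  have bdd: "bdd_above ((\<lambda>r. cmod (alpha y m r)) ` {0..1})" for m
    using compact_continuous_image[OF continuous_on_norm[OF cont[of m]] compact_Icc]
    by (simp add: bounded_imp_bdd_above compact_imp_bounded)
  have M: "cmod (alpha y m r) \<le> M m" if "r \<in> {0..1}" for m r
    unfolding M_def using bdd that by (intro cSUP_upper) auto
  have M1: "M m \<ge> 1" for m using M[of 0 m] by (simp add: alpha_def)
  have J0: "J \<ge> 0" using J by (rule has_integral_nonneg) auto
  have d: "cmod (alpha y m r - 1) \<le> M m * J / (2 * m)" if "m \<ge> 1" "r \<in> {0<..1}" for m r
    using radial_solution_imp_radial_ode[OF sol[of m]] radial_ode.alpha_diff_bound[OF _ J that(1) _ that(2), where M="M m"] M
    unfolding al by blast
  define n where "n = nat \<lceil>2 * J\<rceil> + 1"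
  have big: "M m \<le> 2 \<and> cmod (alpha y m 1 - 1) \<le> 1/2" if "m \<ge> n" for m
  proof -
    have m: "m \<ge> 1" "real m \<ge> 2 * J" "real m > 0" using that J0 unfolding n_def by linarith+
    have "M m \<le> 1 + M m * J / (2 * m)"
      unfolding M_def
    proof (rule cSUP_least)
      fix r :: real assume r: "r \<in> {0..1}"
      show "cmod (alpha y m r) \<le> 1 + (SUP r\<in>{0..1}. cmod (alpha y m r)) * J / (2 * m)"
      proof (cases "r = 0")
        case True
        then show ?thesis using M1[of m] J0 m by (simp add: alpha_def[of y m 0] M_def[symmetric])
      next
        case False
        then have "cmod (alpha y m r - 1) \<le> M m * J / (2 * m)" using d[of m r] m r by auto
        moreover have "cmod (alpha y m r) \<le> 1 + cmod (alpha y m r - 1)"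
          using norm_triangle_sub[of "alpha y m r" 1] by simp
        ultimately show ?thesis by (simp add: M_def)
      qed
    qed auto
    moreover have "M m * J / (2 * m) \<le> M m / 4"
    proof -
      have "M m * (2 * J) \<le> M m * m" using M1[of m] m by (intro mult_left_mono) auto
      then show ?thesis using m by (simp add: field_simps)
    qed
    ultimately have "M m \<le> 2" "M m * J / real (2 * m) \<le> 1/2" by linarith+
    moreover have "cmod (alpha y m 1 - 1) \<le> M m * J / real (2 * m)" using d[of m 1] m by simp
    ultimately show ?thesis by linarith
  qed
  define C where "C = 2 + (\<Sum>m<n. M m)"
  define c where "c = Min (insert (1/2) ((\<lambda>m. cmod (alpha y m 1)) ` {..<n}))"
  have s0: "(\<Sum>m<n. M m) \<ge> 0" using M1 by (intro sum_nonneg) (meson dual_order.trans zero_le_one)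
  show ?thesis
  proof (rule that)
    show "C > 0" using s0 by (simp add: C_def)
    show "c > 0" using nz by (simp add: c_def)
    show "cmod (alpha y m r) \<le> C" if "r \<in> {0..1}" for m r
    proof (cases "m < n")
      case True
      have "M m \<le> (\<Sum>m<n. M m)"
        using True M1 by (intro member_le_sum) (auto intro: order_trans[OF zero_le_one])
      then show ?thesis using M[OF that, of m] by (simp add: C_def)
    next
      case False
      then show ?thesis using M[OF that, of m] big[of m] s0 by (simp add: C_def)
    qed
    show "c \<le> cmod (alpha y m 1)" for m
    proof (cases "m < n")
      case True
      then show ?thesis unfolding c_def by (intro Min_le) auto
    next
      case False
      have "c \<le> 1/2" unfolding c_def by (intro Min_le) auto
      moreover have "1 \<le> cmod (alpha y m 1) + cmod (alpha y m 1 - 1)"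
        using norm_triangle_sub[of 1 "alpha y m 1"] by (simp add: norm_minus_commute)
      ultimately show ?thesis using big[of m] False by simp
    qed
  qed (rule cont)
qed

section \<open>Smooth functions and distributions on the circle\<close>

definition circle_exp :: "int \<Rightarrow> real \<Rightarrow> complex" where
  "circle_exp m \<theta> = exp (\<i> * of_int m * of_real \<theta>)"

lemma circle_exp_0 [simp]: "circle_exp 0 \<theta> = 1" "circle_exp m 0 = 1"
  by (simp_all add: circle_exp_def)

lemma norm_circle_exp [simp]: "cmod (circle_exp m \<theta>) = 1"
proof -
  have "circle_exp m \<theta> = cis (of_int m * \<theta>)" by (simp add: circle_exp_def cis_conv_exp mult.assoc)
  then show ?thesis by simp
qed

lemma circle_exp_add_index: "circle_exp (m + n) \<theta> = circle_exp m \<theta> * circle_exp n \<theta>"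
  by (simp add: circle_exp_def ring_distribs flip: exp_add)

lemma circle_exp_add_angle: "circle_exp m (\<theta> + t) = circle_exp m \<theta> * circle_exp m t"
  by (simp add: circle_exp_def ring_distribs flip: exp_add)

lemma circle_exp_2pi [simp]: "circle_exp m (2 * pi) = 1"
  unfolding circle_exp_def by (simp add: exp_eq_1 mult.assoc)

lemma circle_exp_periodic [simp]: "circle_exp m (\<theta> + 2 * pi) = circle_exp m \<theta>"
  by (simp add: circle_exp_add_angle)

lemma has_vector_derivative_circle_exp:
  "(circle_exp m has_vector_derivative \<i> * of_int m * circle_exp m \<theta>) (at \<theta> within S)"
proof -
  have "((\<lambda>z. exp (\<i> * of_int m * z)) has_field_derivative \<i> * of_int m * exp (\<i> * of_int m * of_real \<theta>)) (at (of_real \<theta>))"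
    by (auto intro!: derivative_eq_intros)
  then have "((\<lambda>t. exp (\<i> * of_int m * of_real t)) has_vector_derivative \<i> * of_int m * exp (\<i> * of_int m * of_real \<theta>)) (at \<theta> within S)"
    by (rule has_vector_derivative_real_field)
  then show ?thesis by (simp add: circle_exp_def[abs_def])
qed

lemma continuous_on_circle_exp [continuous_intros]: "continuous_on S (circle_exp m)"
  unfolding circle_exp_def[abs_def] by (intro continuous_intros)

lemma iter_deriv_0 [simp]: "iter_deriv 0 \<phi> = \<phi>"
  by (simp add: iter_deriv_def)

lemma iter_deriv_Suc: "iter_deriv (Suc k) \<phi> = (\<lambda>\<theta>. vector_derivative (iter_deriv k \<phi>) (at \<theta>))"
  by (simp add: iter_deriv_def)

lemma iter_deriv_add: "iter_deriv j (iter_deriv k \<phi>) = iter_deriv (j + k) \<phi>"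
  by (simp add: iter_deriv_def funpow_add)

lemma iter_deriv_circle_exp: "iter_deriv k (circle_exp m) = (\<lambda>\<theta>. (\<i> * of_int m) ^ k * circle_exp m \<theta>)"
proof (induction k)
  case (Suc k)
  have "((\<lambda>\<theta>. (\<i> * of_int m) ^ k * circle_exp m \<theta>) has_vector_derivative (\<i> * of_int m) ^ k * (\<i> * of_int m * circle_exp m \<theta>)) (at \<theta>)" for \<theta>
    by (intro has_vector_derivative_mult_right has_vector_derivative_circle_exp)
  then show ?case
    unfolding iter_deriv_Suc Suc by (simp add: vector_derivative_at fun_eq_iff mult_ac)
qed simp

lemma circle_smooth_has_vector_derivative:
  assumes "\<phi> \<in> circle_smooth"
  shows "(iter_deriv k \<phi> has_vector_derivative iter_deriv (Suc k) \<phi> \<theta>) (at \<theta> within S)"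
proof -
  have "iter_deriv k \<phi> differentiable (at \<theta>)"
    using assms by (auto simp: circle_smooth_def differentiable_on_def)
  then show ?thesis
    unfolding iter_deriv_Suc
    by (rule has_vector_derivative_at_within[OF iffD1[OF vector_derivative_works]])
qed

lemma continuous_on_iter_deriv:
  assumes "\<phi> \<in> circle_smooth" shows "continuous_on S (iter_deriv k \<phi>)"
  using circle_smooth_has_vector_derivative[OF assms] has_vector_derivative_continuous
  unfolding continuous_on_eq_continuous_within by blast

lemma iter_deriv_periodic:
  assumes "\<phi> \<in> circle_smooth" shows "iter_deriv k \<phi> (\<theta> + 2 * pi) = iter_deriv k \<phi> \<theta>"
proof (induction k arbitrary: \<theta>)
  case 0
  then show ?case using assms by (simp add: circle_smooth_def)
next
  case (Suc k)
  have "((iter_deriv k \<phi> \<circ> (\<lambda>x. x + 2 * pi)) has_vector_derivative 1 *\<^sub>R iter_deriv (Suc k) \<phi> (\<theta> + 2 * pi)) (at \<theta>)"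
    by (rule vector_diff_chain_at)
       (auto intro!: derivative_eq_intros circle_smooth_has_vector_derivative[OF assms])
  moreover have "iter_deriv k \<phi> \<circ> (\<lambda>x. x + 2 * pi) = iter_deriv k \<phi>" using Suc by auto
  ultimately have "(iter_deriv k \<phi> has_vector_derivative iter_deriv (Suc k) \<phi> (\<theta> + 2 * pi)) (at \<theta>)" by simp
  then show ?case
    using circle_smooth_has_vector_derivative[OF assms] vector_derivative_unique_at by blast
qed

lemma circle_smooth_iter_deriv:
  assumes "\<phi> \<in> circle_smooth" shows "iter_deriv k \<phi> \<in> circle_smooth"
  using assms iter_deriv_periodic[OF assms, of k]
  by (simp add: circle_smooth_def iter_deriv_add)

lemma circle_exp_smooth: "circle_exp m \<in> circle_smooth"
proof -
  have "(\<lambda>\<theta>. (\<i> * of_int m) ^ k * circle_exp m \<theta>) differentiable (at x)" for k x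
    by (rule differentiableI_vector[OF has_vector_derivative_mult_right[OF has_vector_derivative_circle_exp]])
  then show ?thesis
    unfolding circle_smooth_def differentiable_on_def mem_Collect_eq iter_deriv_circle_exp
    by (simp only: circle_exp_periodic) blast
qed

lemma
  assumes "\<phi> \<in> circle_smooth" "\<psi> \<in> circle_smooth"
  shows iter_deriv_linear: "iter_deriv k (\<lambda>\<theta>. a * \<phi> \<theta> + b * \<psi> \<theta>) = (\<lambda>\<theta>. a * iter_deriv k \<phi> \<theta> + b * iter_deriv k \<psi> \<theta>)"
    and circle_smooth_linear: "(\<lambda>\<theta>. a * \<phi> \<theta> + b * \<psi> \<theta>) \<in> circle_smooth"
proof -
  have der: "((\<lambda>\<theta>. a * iter_deriv k \<phi> \<theta> + b * iter_deriv k \<psi> \<theta>) has_vector_derivative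
      a * iter_deriv (Suc k) \<phi> \<theta> + b * iter_deriv (Suc k) \<psi> \<theta>) (at \<theta>)" for k \<theta>
    using assms by (intro has_vector_derivative_add has_vector_derivative_mult_right circle_smooth_has_vector_derivative)
  have eq: "iter_deriv k (\<lambda>\<theta>. a * \<phi> \<theta> + b * \<psi> \<theta>) = (\<lambda>\<theta>. a * iter_deriv k \<phi> \<theta> + b * iter_deriv k \<psi> \<theta>)" for k
  proof (induction k)
    case (Suc k)
    show ?case unfolding iter_deriv_Suc[of k "\<lambda>\<theta>. a * \<phi> \<theta> + b * \<psi> \<theta>"] Suc
      using der by (simp add: vector_derivative_at fun_eq_iff)
  qed simp
  then show "iter_deriv k (\<lambda>\<theta>. a * \<phi> \<theta> + b * \<psi> \<theta>) = (\<lambda>\<theta>. a * iter_deriv k \<phi> \<theta> + b * iter_deriv k \<psi> \<theta>)" .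
  show "(\<lambda>\<theta>. a * \<phi> \<theta> + b * \<psi> \<theta>) \<in> circle_smooth"
    unfolding circle_smooth_def eq differentiable_on_def
    using iter_deriv_periodic[OF assms(1), of 0] iter_deriv_periodic[OF assms(2), of 0]
    by (auto intro: differentiableI_vector[OF der] simp: eq)
qed

lemma circle_smooth_zero: "(\<lambda>_. 0) \<in> circle_smooth" and iter_deriv_zero: "iter_deriv k (\<lambda>_. 0) = (\<lambda>_. 0)"
  using circle_smooth_linear[OF circle_exp_smooth[of 0] circle_exp_smooth[of 0], where a = 0 and b = 0]
    iter_deriv_linear[OF circle_exp_smooth[of 0] circle_exp_smooth[of 0], where k = k and a = 0 and b = 0]
  by simp_all

lemma circle_distribution_linear:
  assumes "circle_distribution f" "\<phi> \<in> circle_smooth" "\<psi> \<in> circle_smooth"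
  shows "f (\<lambda>\<theta>. a * \<phi> \<theta> + b * \<psi> \<theta>) = a * f \<phi> + b * f \<psi>"
  using assms unfolding circle_distribution_def by simp

lemma
  assumes "finite F" "\<And>m. m \<in> F \<Longrightarrow> \<phi> m \<in> circle_smooth"
  shows circle_smooth_sum: "(\<lambda>\<theta>. \<Sum>m\<in>F. c m * \<phi> m \<theta>) \<in> circle_smooth"
    and iter_deriv_sum: "iter_deriv k (\<lambda>\<theta>. \<Sum>m\<in>F. c m * \<phi> m \<theta>) = (\<lambda>\<theta>. \<Sum>m\<in>F. c m * iter_deriv k (\<phi> m) \<theta>)"
    and circle_distribution_sum: "circle_distribution f \<Longrightarrow> f (\<lambda>\<theta>. \<Sum>m\<in>F. c m * \<phi> m \<theta>) = (\<Sum>m\<in>F. c m * f (\<phi> m))"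
proof -
  have "(\<lambda>\<theta>. \<Sum>m\<in>F. c m * \<phi> m \<theta>) \<in> circle_smooth \<and>
    iter_deriv k (\<lambda>\<theta>. \<Sum>m\<in>F. c m * \<phi> m \<theta>) = (\<lambda>\<theta>. \<Sum>m\<in>F. c m * iter_deriv k (\<phi> m) \<theta>) \<and>
    (circle_distribution f \<longrightarrow> f (\<lambda>\<theta>. \<Sum>m\<in>F. c m * \<phi> m \<theta>) = (\<Sum>m\<in>F. c m * f (\<phi> m)))"
    using assms
  proof (induction F rule: finite_induct)
    case empty
    have "f (\<lambda>\<theta>. 0) = 0" if "circle_distribution f"
    proof -
      have "f (\<lambda>\<theta>. 0 * circle_exp 0 \<theta> + 0 * circle_exp 0 \<theta>) = 0 * f (circle_exp 0) + 0 * f (circle_exp 0)"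
        by (rule circle_distribution_linear[OF that circle_exp_smooth circle_exp_smooth])
      then show ?thesis by simp
    qed
    then show ?case by (simp add: circle_smooth_zero iter_deriv_zero)
  next
    case (insert m F)
    let ?S = "\<lambda>\<theta>. \<Sum>m\<in>F. c m * \<phi> m \<theta>"
    have S: "?S \<in> circle_smooth" and m: "\<phi> m \<in> circle_smooth" using insert by auto
    have e: "(\<lambda>\<theta>. \<Sum>m\<in>insert m F. c m * \<phi> m \<theta>) = (\<lambda>\<theta>. c m * \<phi> m \<theta> + 1 * ?S \<theta>)"
      using insert(1,2) by (simp add: fun_eq_iff)
    have "f (\<lambda>\<theta>. c m * \<phi> m \<theta> + 1 * ?S \<theta>) = c m * f (\<phi> m) + 1 * f ?S" if "circle_distribution f"
      by (rule circle_distribution_linear[OF that m S])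
    then show ?case
      unfolding e iter_deriv_linear[OF m S] using circle_smooth_linear[OF m S, of "c m" 1] insert by auto
  qed
  then show "(\<lambda>\<theta>. \<Sum>m\<in>F. c m * \<phi> m \<theta>) \<in> circle_smooth"
    "iter_deriv k (\<lambda>\<theta>. \<Sum>m\<in>F. c m * \<phi> m \<theta>) = (\<lambda>\<theta>. \<Sum>m\<in>F. c m * iter_deriv k (\<phi> m) \<theta>)"
    "circle_distribution f \<Longrightarrow> f (\<lambda>\<theta>. \<Sum>m\<in>F. c m * \<phi> m \<theta>) = (\<Sum>m\<in>F. c m * f (\<phi> m))" by blast+
qed

lemma circle_distribution_nbhd:
  assumes f: "circle_distribution f" and \<phi>: "\<phi> \<in> circle_smooth" and e: "e > 0"
  obtains N \<epsilon> where "\<epsilon> > 0" "\<And>\<psi>. \<psi> \<in> circle_nbhd N \<epsilon> \<phi> \<Longrightarrow> cmod (f \<psi> - f \<phi>) < e"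
proof -
  have "openin circle_topology {\<psi> \<in> topspace circle_topology. f \<psi> \<in> ball (f \<phi>) e}"
    using f by (intro openin_continuous_map_preimage[of _ euclidean]) (auto simp: circle_distribution_def)
  moreover have "\<phi> \<in> {\<psi> \<in> topspace circle_topology. f \<psi> \<in> ball (f \<phi>) e}"
    using \<phi> e by (simp add: topspace_circle_topology)
  ultimately obtain N \<epsilon> where "\<epsilon> > 0" "circle_nbhd N \<epsilon> \<phi> \<subseteq> {\<psi> \<in> topspace circle_topology. f \<psi> \<in> ball (f \<phi>) e}"
    unfolding openin_circle_topology by blast
  then show ?thesis
    by (intro that[of \<epsilon> N]) (auto simp: dist_norm norm_minus_commute)
qed

lemma fourier_coeff_eq: "fourier_coeff f m = f (circle_exp (- m)) / of_real (2 * pi)"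
  by (simp add: fourier_coeff_def circle_exp_def[abs_def])

text \<open>A distribution is bounded by \<open>1\<close> on a neighbourhood of \<open>0\<close> that involves \<open>N\<close> derivatives. The exponential
of frequency \<open>m\<close> enters that neighbourhood after division by a multiple of \<open>(1 + \<bar>m\<bar>)^N\<close>, because its
\<open>k\<close>-th derivative has modulus \<open>\<bar>m\<bar>^k\<close>.\<close>

lemma fourier_coeff_growth:
  assumes f: "circle_distribution f"
  obtains C N where "C \<ge> 0" "\<And>m. cmod (fourier_coeff f m) \<le> C * (1 + \<bar>real_of_int m\<bar>) ^ N"
proof -
  have f0: "f (\<lambda>_. 0) = 0"
    using circle_distribution_sum[of "{}" "\<lambda>_. circle_exp 0" f "\<lambda>_. 0"] f by simp
  obtain N \<epsilon> where \<epsilon>: "\<epsilon> > 0" and nb: "\<And>\<psi>. \<psi> \<in> circle_nbhd N \<epsilon> (\<lambda>_. 0) \<Longrightarrow> cmod (f \<psi>) < 1"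
    using circle_distribution_nbhd[OF f circle_smooth_zero zero_less_one] unfolding f0 diff_zero by metis
  show ?thesis
  proof (rule that[of "2 / \<epsilon>" N])
    fix m :: int
    define R where "R = (1 + \<bar>real_of_int m\<bar>) ^ N"
    have R: "R \<ge> 1" by (simp add: R_def)
    define c where "c = \<epsilon> / (2 * R)"
    have c: "c > 0" using \<epsilon> R by (simp add: c_def)
    have "(\<lambda>\<theta>. of_real c * circle_exp (-m) \<theta> + 0 * circle_exp 0 \<theta>) \<in> circle_nbhd N \<epsilon> (\<lambda>_. 0)"
      unfolding circle_nbhd_def
    proof (intro CollectI conjI allI impI circle_smooth_linear circle_exp_smooth)
      fix k \<theta> assume k: "k \<le> N"
      have "\<bar>real_of_int m\<bar> ^ k \<le> (1 + \<bar>real_of_int m\<bar>) ^ k" by (intro power_mono) auto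
      also have "\<dots> \<le> R" unfolding R_def using k by (intro power_increasing) auto
      finally have "c * \<bar>real_of_int m\<bar> ^ k \<le> c * R" using c by (intro mult_left_mono) auto
      also have "\<dots> < \<epsilon>" using R \<epsilon> by (simp add: c_def)
      finally show "cmod (iter_deriv k (\<lambda>\<theta>. of_real c * circle_exp (-m) \<theta> + 0 * circle_exp 0 \<theta>) \<theta> - iter_deriv k (\<lambda>_. 0) \<theta>) < \<epsilon>"
        unfolding iter_deriv_linear[OF circle_exp_smooth circle_exp_smooth] iter_deriv_zero iter_deriv_circle_exp
        using c by (simp add: norm_mult norm_power)
    qed
    then have "cmod (f (\<lambda>\<theta>. of_real c * circle_exp (-m) \<theta> + 0 * circle_exp 0 \<theta>)) < 1" by (rule nb)
    moreover have "f (\<lambda>\<theta>. of_real c * circle_exp (-m) \<theta> + 0 * circle_exp 0 \<theta>) = of_real c * f (circle_exp (-m)) + 0 * f (circle_exp 0)"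
      by (rule circle_distribution_linear[OF f circle_exp_smooth circle_exp_smooth])
    ultimately have "c * cmod (f (circle_exp (-m))) < 1" using c by (simp add: norm_mult)
    then have 1: "cmod (f (circle_exp (-m))) \<le> 2 / \<epsilon> * R" using c \<epsilon> R by (simp add: c_def field_simps)
    have "cmod (fourier_coeff f m) = cmod (f (circle_exp (-m))) / (2 * pi)"
      by (simp add: fourier_coeff_eq norm_divide)
    also have "\<dots> \<le> cmod (f (circle_exp (-m)))"
      using pi_gt3 mult_left_mono[of 1 "2 * pi" "cmod (f (circle_exp (-m)))"] by (simp add: divide_le_eq)
    finally show "cmod (fourier_coeff f m) \<le> 2 / \<epsilon> * (1 + \<bar>real_of_int m\<bar>) ^ N"
      using 1 by (simp add: R_def)
  qed (use \<epsilon> in auto)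
qed

section \<open>Fourier series on the circle\<close>

definition circle_coeff :: "(real \<Rightarrow> complex) \<Rightarrow> int \<Rightarrow> complex" where
  "circle_coeff \<phi> m = integral {0..2*pi} (\<lambda>t. \<phi> t * circle_exp (- m) t) / of_real (2 * pi)"

lemma circle_coeff_bound:
  assumes "continuous_on {0..2*pi} g" "\<And>t. t \<in> {0..2*pi} \<Longrightarrow> cmod (g t) \<le> B"
  shows "cmod (circle_coeff g m) \<le> B"
proof -
  have "cmod (integral {0..2*pi} (\<lambda>t. g t * circle_exp (- m) t)) \<le> B * (2 * pi - 0)"
    by (rule integral_bound) (use assms in \<open>auto simp: norm_mult intro!: continuous_intros\<close>)
  then show ?thesis
    by (simp add: circle_coeff_def norm_divide divide_le_eq)
qed

lemma circle_coeff_deriv: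
  assumes "\<phi> \<in> circle_smooth"
  shows "circle_coeff (iter_deriv k \<phi>) m = (\<i> * of_int m) ^ k * circle_coeff \<phi> m"
proof (induction k)
  case (Suc k)
  let ?g = "iter_deriv k \<phi>" and ?g' = "iter_deriv (Suc k) \<phi>"
  have "((\<lambda>t. ?g t * (\<i> * of_int (- m) * circle_exp (- m) t) + ?g' t * circle_exp (- m) t) has_integral
      ?g (2 * pi) * circle_exp (- m) (2 * pi) - ?g 0 * circle_exp (- m) 0) {0..2*pi}"
    by (rule fundamental_theorem_of_calculus)
       (simp, rule has_vector_derivative_mult[OF circle_smooth_has_vector_derivative[OF assms] has_vector_derivative_circle_exp])
  moreover have "?g (2 * pi) = ?g 0" using iter_deriv_periodic[OF assms, of k 0] by simp
  ultimately have "((\<lambda>t. ?g t * (\<i> * of_int (- m) * circle_exp (- m) t) + ?g' t * circle_exp (- m) t) has_integral 0) {0..2*pi}"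
    by simp
  moreover have "((\<lambda>t. ?g t * circle_exp (- m) t) has_integral integral {0..2*pi} (\<lambda>t. ?g t * circle_exp (- m) t)) {0..2*pi}"
    by (intro integrable_integral integrable_continuous_real continuous_intros continuous_on_iter_deriv assms)
  then have "((\<lambda>t. \<i> * of_int m * (?g t * circle_exp (- m) t)) has_integral \<i> * of_int m * integral {0..2*pi} (\<lambda>t. ?g t * circle_exp (- m) t)) {0..2*pi}"
    by (rule has_integral_mult_right)
  ultimately have "((\<lambda>t. ?g t * (\<i> * of_int (- m) * circle_exp (- m) t) + ?g' t * circle_exp (- m) t + \<i> * of_int m * (?g t * circle_exp (- m) t)) has_integral
       0 + \<i> * of_int m * integral {0..2*pi} (\<lambda>t. ?g t * circle_exp (- m) t)) {0..2*pi}"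
    by (rule has_integral_add)
  then have "((\<lambda>t. ?g' t * circle_exp (- m) t) has_integral \<i> * of_int m * integral {0..2*pi} (\<lambda>t. ?g t * circle_exp (- m) t)) {0..2*pi}"
    by (simp add: algebra_simps)
  then show ?case
    using Suc unfolding circle_coeff_def by (simp add: integral_unique mult_ac)
qed simp

text \<open>The \<open>k\<close>-th derivative has the coefficients \<open>(\<i> * m)^k * circle_coeff \<phi> m\<close>, which are bounded. The bound
of \<open>\<phi>\<close> itself replaces \<open>\<bar>m\<bar>^k\<close> by \<open>(1 + \<bar>m\<bar>)^k\<close>.\<close>

lemma circle_coeff_decay:
  assumes "\<phi> \<in> circle_smooth"
  obtains B where "B \<ge> 0" "\<And>m. cmod (circle_coeff \<phi> m) \<le> B / (1 + \<bar>real_of_int m\<bar>) ^ k"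
proof -
  have bd: "\<exists>B. \<forall>t\<in>{0..2*pi}. cmod (iter_deriv j \<phi> t) \<le> B" for j
    using compact_imp_bounded[OF compact_continuous_image[OF continuous_on_iter_deriv[OF assms] compact_Icc]]
    by (metis bounded_iff image_eqI)
  obtain B0 Bk where B: "\<And>t. t \<in> {0..2*pi} \<Longrightarrow> cmod (iter_deriv 0 \<phi> t) \<le> B0" "\<And>t. t \<in> {0..2*pi} \<Longrightarrow> cmod (iter_deriv k \<phi> t) \<le> Bk"
    using bd[of 0] bd[of k] by blast
  have B0: "B0 \<ge> 0" "Bk \<ge> 0" using B[of 0] order_trans[OF norm_ge_zero] by auto
  show ?thesis
  proof (rule that[of "2 ^ k * (B0 + Bk)"])
    fix m :: int
    have 0: "cmod (circle_coeff \<phi> m) \<le> B0"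
      using circle_coeff_bound[OF continuous_on_iter_deriv[OF assms] B(1)] by simp
    have 1: "\<bar>real_of_int m\<bar> ^ k * cmod (circle_coeff \<phi> m) \<le> Bk"
      using circle_coeff_bound[OF continuous_on_iter_deriv[OF assms] B(2), of m]
      unfolding circle_coeff_deriv[OF assms] by (simp add: norm_mult norm_power)
    have "(1 + \<bar>real_of_int m\<bar>) ^ k \<le> 2 ^ k * (1 + \<bar>real_of_int m\<bar> ^ k)"
    proof (cases "m = 0")
      case False
      then have "1 + \<bar>real_of_int m\<bar> \<le> 2 * \<bar>real_of_int m\<bar>" by linarith
      then have "(1 + \<bar>real_of_int m\<bar>) ^ k \<le> (2 * \<bar>real_of_int m\<bar>) ^ k" by (intro power_mono) auto
      then show ?thesis unfolding power_mult_distrib by (simp add: ring_distribs add_increasing)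
    next
      case True
      have "(1::real) * 1 \<le> 2 ^ k * (1 + 0 ^ k)" by (intro mult_mono) auto
      then show ?thesis using True by simp
    qed
    then have "(1 + \<bar>real_of_int m\<bar>) ^ k * cmod (circle_coeff \<phi> m) \<le> 2 ^ k * (1 + \<bar>real_of_int m\<bar> ^ k) * cmod (circle_coeff \<phi> m)"
      by (rule mult_right_mono) simp
    also have "\<dots> = 2 ^ k * (cmod (circle_coeff \<phi> m) + \<bar>real_of_int m\<bar> ^ k * cmod (circle_coeff \<phi> m))"
      by (simp add: ring_distribs)
    also have "\<dots> \<le> 2 ^ k * (B0 + Bk)" using 0 1 by (intro mult_left_mono add_mono) auto
    finally show "cmod (circle_coeff \<phi> m) \<le> 2 ^ k * (B0 + Bk) / (1 + \<bar>real_of_int m\<bar>) ^ k"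
      by (simp add: le_divide_eq mult.commute)
  qed (use B0 in auto)
qed

lemma integral_periodic_shift:
  fixes F :: "real \<Rightarrow> complex"
  assumes cont: "continuous_on UNIV F" and per: "\<And>t. F (t + 2 * pi) = F t" and s: "0 \<le> s" "s \<le> 2 * pi"
  shows "integral {0..2*pi} (\<lambda>t. F (t + s)) = integral {0..2*pi} F"
proof -
  have int: "F integrable_on {a..b}" for a b
    by (rule integrable_continuous_real[OF continuous_on_subset[OF cont]]) auto
  have "integral {0..2*pi} (F \<circ> (+) s) = integral {0+s..2*pi+s} F" by (rule integral_shift_Icc_real)
  also have "\<dots> = integral {s..2*pi} F + integral {2*pi..2*pi+s} F"
    using s by (subst Henstock_Kurzweil_Integration.integral_combine[OF _ _ int]) auto
  also have "integral {2*pi..2*pi+s} F = integral {0..s} (F \<circ> (+) (2*pi))"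
    using integral_shift_Icc_real[of 0 s F "2*pi"] by (simp add: add.commute)
  also have "F \<circ> (+) (2*pi) = F" using per by (auto simp: add.commute)
  also have "integral {s..2*pi} F + integral {0..s} F = integral {0..2*pi} F"
    using s by (subst add.commute) (rule Henstock_Kurzweil_Integration.integral_combine[OF _ _ int])
  finally show ?thesis by (simp add: comp_def add.commute)
qed

text \<open>A shift of the variable by \<open>pi / \<bar>m\<bar>\<close> changes the sign of the exponential. Twice the coefficient is thus the
mean of \<open>g t - g (t + pi / \<bar>m\<bar>)\<close> times an exponential, which is small by uniform continuity.\<close>

lemma riemann_lebesgue_circle:
  fixes g :: "real \<Rightarrow> complex"
  assumes cont: "continuous_on UNIV g" and per: "\<And>t. g (t + 2 * pi) = g t" and e: "e > 0"
  obtains n :: nat where "\<And>m. \<bar>m\<bar> \<ge> int n \<Longrightarrow> cmod (circle_coeff g m) \<le> e"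
proof -
  have uc: "uniformly_continuous_on {0..3*pi} g"
    by (intro compact_uniformly_continuous continuous_on_subset[OF cont]) auto
  obtain d where d: "d > 0" "\<And>x x'. x \<in> {0..3*pi} \<Longrightarrow> x' \<in> {0..3*pi} \<Longrightarrow> dist x' x < d \<Longrightarrow> dist (g x') (g x) < e"
    using uc[unfolded uniformly_continuous_on_def, rule_format, OF e] by blast
  define n where "n = nat \<lceil>pi / d\<rceil> + 1"
  have n: "real n > pi / d" unfolding n_def by linarith
  show ?thesis
  proof (rule that[of n])
    fix m :: int assume m: "\<bar>m\<bar> \<ge> int n"
    define s where "s = pi / \<bar>real_of_int m\<bar>"
    have m1: "\<bar>real_of_int m\<bar> \<ge> 1" "\<bar>real_of_int m\<bar> > pi / d" using m n unfolding n_def by linarith+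
    have s: "0 \<le> s" "s \<le> pi" "s < d" using m1 d(1) by (auto simp: s_def divide_le_eq field_simps)
    have em: "circle_exp (- m) s = -1"
    proof (cases "m > 0")
      case True
      then have "circle_exp (- m) s = exp (- (\<i> * of_real pi))" by (simp add: circle_exp_def s_def)
      then show ?thesis by (simp add: exp_minus)
    next
      case False
      with m1 have "m < 0" by linarith
      then have "circle_exp (- m) s = exp (\<i> * of_real pi)" by (simp add: circle_exp_def s_def)
      then show ?thesis by simp
    qed
    let ?I = "integral {0..2*pi} (\<lambda>t. g t * circle_exp (- m) t)"
    have contg: "continuous_on S (\<lambda>t. g (t + s))" for S
      using continuous_on_compose2[OF cont, of S "\<lambda>t. t + s"] by (simp add: continuous_intros)
    have contg0: "continuous_on S g" for S using cont continuous_on_subset by blast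
    have "?I = integral {0..2*pi} (\<lambda>t. g (t + s) * circle_exp (- m) (t + s))"
      by (rule integral_periodic_shift[symmetric]) (use s per in \<open>auto intro!: continuous_intros cont\<close>)
    also have "\<dots> = - integral {0..2*pi} (\<lambda>t. g (t + s) * circle_exp (- m) t)"
      unfolding circle_exp_add_angle em by simp
    finally have "?I + ?I = ?I - integral {0..2*pi} (\<lambda>t. g (t + s) * circle_exp (- m) t)" by simp
    also have "\<dots> = integral {0..2*pi} (\<lambda>t. (g t - g (t + s)) * circle_exp (- m) t)"
      unfolding left_diff_distrib
      by (intro integral_diff[symmetric] integrable_continuous_real continuous_intros contg contg0)
    also have "cmod \<dots> \<le> e * (2 * pi - 0)"
    proof (rule integral_bound)
      fix t assume "t \<in> {0..2*pi}"
      then have "dist (g (t + s)) (g t) < e" using s by (intro d(2)) (auto simp: dist_norm)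
      then show "cmod ((g t - g (t + s)) * circle_exp (- m) t) \<le> e"
        by (simp add: norm_mult dist_norm norm_minus_commute)
    qed (auto intro!: continuous_intros contg contg0)
    finally have "cmod (2 * ?I) \<le> e * (2 * pi)" by (simp only: mult_2) simp
    then have "cmod ?I \<le> e * pi" by (simp add: norm_mult)
    also have "e * pi \<le> e * (2 * pi)" using e by simp
    finally have "cmod ?I \<le> e * (2 * pi)" .
    then show "cmod (circle_coeff g m) \<le> e"
      by (simp add: circle_coeff_def norm_divide divide_le_eq)
  qed
qed

lemma circle_coeff_one: "circle_coeff (\<lambda>_. 1) m = (if m = 0 then 1 else 0)"
proof (cases "m = 0")
  case False
  have e: "circle_exp 0 = (\<lambda>_. 1)" by (simp add: fun_eq_iff)
  have A: "circle_coeff (\<lambda>\<theta>. (\<i> * of_int 0) ^ 1 * circle_exp 0 \<theta>) m = 0" by (simp add: circle_coeff_def)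
  have "\<i> * of_int m * circle_coeff (\<lambda>_. 1) m = 0"
    using circle_coeff_deriv[OF circle_exp_smooth[of 0], of 1 m] unfolding iter_deriv_circle_exp A by (simp add: e)
  then show ?thesis using False by simp
qed (simp add: circle_coeff_def scaleR_conv_of_real)

lemma has_vector_derivative_slope_tendsto:
  fixes f :: "real \<Rightarrow> 'a::real_normed_vector"
  assumes "(f has_vector_derivative D) (at x)"
  shows "((\<lambda>y. (f y - f x) /\<^sub>R (y - x)) \<longlongrightarrow> D) (at x)"
proof -
  have "((\<lambda>y. (f y - f x - (y - x) *\<^sub>R D) /\<^sub>R norm (y - x)) \<longlongrightarrow> 0) (at x)"
    using assms unfolding has_vector_derivative_def has_derivative_at_within by simp
  then have "((\<lambda>y. norm ((f y - f x - (y - x) *\<^sub>R D) /\<^sub>R norm (y - x))) \<longlongrightarrow> 0) (at x)"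
    by (rule tendsto_norm_zero)
  moreover have "norm ((f y - f x) /\<^sub>R (y - x) - D) = norm ((f y - f x - (y - x) *\<^sub>R D) /\<^sub>R norm (y - x))"
    if "y \<noteq> x" for y
  proof -
    have "(f y - f x) /\<^sub>R (y - x) - D = (f y - f x - (y - x) *\<^sub>R D) /\<^sub>R (y - x)"
      using that by (simp add: scaleR_diff_right)
    then show ?thesis by simp
  qed
  then have "\<forall>\<^sub>F y in at x. norm ((f y - f x) /\<^sub>R (y - x) - D) \<le> norm ((f y - f x - (y - x) *\<^sub>R D) /\<^sub>R norm (y - x))"
    by (auto simp: eventually_at_filter)
  ultimately have "((\<lambda>y. (f y - f x) /\<^sub>R (y - x) - D) \<longlongrightarrow> 0) (at x)"
    by (rule Lim_null_comparison[rotated])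
  then show ?thesis by (rule LIM_zero_cancel)
qed

text \<open>Chernoff's argument. Divide \<open>h - h t0\<close> by \<open>exp (\<i> t) - exp (\<i> t0)\<close>; since \<open>h\<close> is continuously
differentiable, the quotient \<open>g\<close> extends continuously to the zeros of the denominator. In terms of the
coefficients of \<open>g\<close> the series telescopes, and the two terms that remain besides \<open>h t0\<close> tend to \<open>0\<close> by
\<open>riemann_lebesgue_circle\<close>.\<close>

lemma fourier_partial_sums_tendsto:
  assumes h: "h \<in> circle_smooth"
  shows "(\<lambda>n. \<Sum>m=-int n..int n. circle_coeff h m * circle_exp m t0) \<longlonglongrightarrow> h t0"
proof -
  have hp: "h (t + 2 * pi) = h t" for t using h by (simp add: circle_smooth_def)
  have hpn: "h (t + 2 * pi * real n) = h t" for t n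
  proof (induction n)
    case (Suc n)
    show ?case using Suc hp[of "t + 2 * pi * real n"] by (simp add: algebra_simps)
  qed simp
  have hpi: "h t = h s" if "circle_exp 1 t = circle_exp 1 s" for t s
  proof -
    have "exp (\<i> * of_real t) = exp (\<i> * of_real s)" using that by (simp add: circle_exp_def)
    then obtain n :: int where "\<i> * complex_of_real t = \<i> * of_real s + of_int (2 * n) * pi * \<i>"
      unfolding exp_eq by auto
    then have "\<i> * complex_of_real t = \<i> * complex_of_real (s + 2 * n * pi)" by (simp add: algebra_simps)
    then have n: "t = s + 2 * n * pi" by (metis complex_i_not_zero mult_left_cancel of_real_eq_iff)
    show ?thesis
    proof (cases "n \<ge> 0")
      case True
      then show ?thesis using n hpn[of s "nat n"] by (simp add: mult_ac)
    next
      case False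
      then have "s = t + 2 * pi * real (nat (- n))" using n by (simp add: algebra_simps)
      then show ?thesis using hpn[of t "nat (- n)"] by simp
    qed
  qed
  let ?E = "circle_exp 1"
  define g where "g t = (if ?E t = ?E t0 then iter_deriv 1 h t / (\<i> * ?E t) else (h t - h t0) / (?E t - ?E t0))" for t
  have E0: "?E t \<noteq> 0" for t using norm_circle_exp[of 1 t] by fastforce
  have gp: "g (t + 2 * pi) = g t" for t
    unfolding g_def circle_exp_periodic hp iter_deriv_periodic[OF h] by simp
  have hcont: "continuous_on S h" for S using continuous_on_iter_deriv[OF h, of S 0] by simp
  have gc: "continuous_on UNIV g"
    unfolding continuous_on_eq_continuous_at[OF open_UNIV]
  proof (intro ballI)
    fix t :: real
    show "isCont g t"
    proof (cases "?E t = ?E t0")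
      case True
      have dh: "(h has_vector_derivative iter_deriv 1 h t) (at t)"
        using circle_smooth_has_vector_derivative[OF h, of 0 t UNIV] by simp
      have dE: "(?E has_vector_derivative \<i> * ?E t) (at t)"
        using has_vector_derivative_circle_exp[of 1 t UNIV] by simp
      have "((\<lambda>x. ((h x - h t) /\<^sub>R (x - t)) / ((?E x - ?E t) /\<^sub>R (x - t))) \<longlongrightarrow> iter_deriv 1 h t / (\<i> * ?E t)) (at t)"
        by (intro tendsto_divide has_vector_derivative_slope_tendsto[OF dh] has_vector_derivative_slope_tendsto[OF dE]) (simp add: E0)
      then have l: "((\<lambda>x. (h x - h t) / (?E x - ?E t)) \<longlongrightarrow> iter_deriv 1 h t / (\<i> * ?E t)) (at t)"
        by (rule Lim_transform_eventually) (simp add: eventually_at_filter scaleR_conv_of_real divide_simps)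
      have "\<forall>\<^sub>F x in at t. (?E x - ?E t) /\<^sub>R (x - t) \<noteq> 0"
        by (rule tendsto_imp_eventually_ne[OF has_vector_derivative_slope_tendsto[OF dE]]) (simp add: E0)
      then have "\<forall>\<^sub>F x in at t. ?E x \<noteq> ?E t" by eventually_elim auto
      then have "\<forall>\<^sub>F x in at t. (h x - h t) / (?E x - ?E t) = g x"
        by eventually_elim (use True hpi[OF True] in \<open>simp add: g_def\<close>)
      with l have "(g \<longlongrightarrow> iter_deriv 1 h t / (\<i> * ?E t)) (at t)"
        by (rule Lim_transform_eventually)
      moreover have "g t = iter_deriv 1 h t / (\<i> * ?E t)" using True by (simp add: g_def)
      ultimately show ?thesis by (simp add: isCont_def)
    next
      case False
      have c: "isCont h t" "isCont ?E t"
        using hcont[of UNIV] continuous_on_circle_exp[of UNIV 1] by (auto simp: continuous_on_eq_continuous_at)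
      have "isCont (\<lambda>t. (h t - h t0) / (?E t - ?E t0)) t"
        using c False by (intro continuous_intros) auto
      moreover have "\<forall>\<^sub>F x in nhds t. (h x - h t0) / (?E x - ?E t0) = g x"
      proof -
        have "\<forall>\<^sub>F x in nhds t. ?E x \<noteq> ?E t0"
          using tendsto_imp_eventually_ne[OF iffD1[OF tendsto_at_iff_tendsto_nhds c(2)[unfolded isCont_def]] False] .
        then show ?thesis by eventually_elim (simp add: g_def)
      qed
      ultimately show ?thesis using isCont_cong by fastforce
    qed
  qed
  have gE: "h t - h t0 = g t * ?E t - ?E t0 * g t" for t
  proof (cases "?E t = ?E t0")
    case True
    then show ?thesis using hpi[OF True] by simp
  next
    case False
    then have "g t * (?E t - ?E t0) = h t - h t0" by (simp add: g_def)
    then show ?thesis by (simp add: algebra_simps)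
  qed
  have gcS: "continuous_on S g" for S using gc continuous_on_subset by blast
  have rec: "circle_coeff h m - h t0 * circle_coeff (\<lambda>_. 1) m = circle_coeff g (m - 1) - ?E t0 * circle_coeff g m" for m
  proof -
    have i: "(\<lambda>t. h t * circle_exp (- m) t) integrable_on {0..2*pi}" "(\<lambda>t. h t0 * circle_exp (- m) t) integrable_on {0..2*pi}"
      "(\<lambda>t. g t * circle_exp (- (m - 1)) t) integrable_on {0..2*pi}" "(\<lambda>t. ?E t0 * (g t * circle_exp (- m) t)) integrable_on {0..2*pi}"
      by (intro integrable_continuous_real continuous_intros hcont gcS)+
    have e: "h t * circle_exp (- m) t - h t0 * circle_exp (- m) t = g t * circle_exp (- (m - 1)) t - ?E t0 * (g t * circle_exp (- m) t)" for t
    proof -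
      have "circle_exp (- (m - 1)) t = ?E t * circle_exp (- m) t" by (simp flip: circle_exp_add_index)
      then have "g t * circle_exp (- (m - 1)) t - ?E t0 * (g t * circle_exp (- m) t) = (g t * ?E t - ?E t0 * g t) * circle_exp (- m) t"
        by (simp add: algebra_simps)
      then show ?thesis unfolding gE[symmetric] by (simp add: algebra_simps)
    qed
    have "integral {0..2*pi} (\<lambda>t. h t * circle_exp (- m) t) - integral {0..2*pi} (\<lambda>t. h t0 * circle_exp (- m) t)
       = integral {0..2*pi} (\<lambda>t. g t * circle_exp (- (m - 1)) t) - integral {0..2*pi} (\<lambda>t. ?E t0 * (g t * circle_exp (- m) t))"
      unfolding integral_diff[OF i(1,2), symmetric] integral_diff[OF i(3,4), symmetric] e ..
    then have "(integral {0..2*pi} (\<lambda>t. h t * circle_exp (- m) t) - h t0 * integral {0..2*pi} (\<lambda>t. 1 * circle_exp (- m) t)) / of_real (2 * pi)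
       = (integral {0..2*pi} (\<lambda>t. g t * circle_exp (- (m - 1)) t) - ?E t0 * integral {0..2*pi} (\<lambda>t. g t * circle_exp (- m) t)) / of_real (2 * pi)"
      by simp
    then show ?thesis unfolding circle_coeff_def diff_divide_distrib by simp
  qed
  \<comment> \<open>The phases make \<open>rec\<close> a difference of consecutive values.\<close>
  define a where "a m = circle_coeff g m * circle_exp (m + 1) t0" for m
  have rec': "circle_coeff h m * circle_exp m t0 = (if m = 0 then h t0 else 0) + (a (m - 1) - a m)" for m
  proof -
    have "circle_exp (m + 1) t0 = ?E t0 * circle_exp m t0" by (simp add: circle_exp_add_index)
    then have "(circle_coeff g (m - 1) - ?E t0 * circle_coeff g m) * circle_exp m t0 = a (m - 1) - a m"
      by (simp add: a_def algebra_simps)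
    then have "(circle_coeff h m - h t0 * circle_coeff (\<lambda>_. 1) m) * circle_exp m t0 = a (m - 1) - a m"
      unfolding rec .
    then show ?thesis unfolding circle_coeff_one by (auto simp: algebra_simps)
  qed
  have tele: "(\<Sum>m=-int n..int n. a (m - 1) - a m) = a (- int n - 1) - a (int n)" for n
  proof (induction n)
    case (Suc n)
    have "{- int (Suc n)..int (Suc n)} = insert (- int (Suc n)) (insert (int (Suc n)) {- int n..int n})" by auto
    then have "(\<Sum>m=-int (Suc n)..int (Suc n). a (m - 1) - a m) =
       (a (- int (Suc n) - 1) - a (- int (Suc n))) + ((a (int (Suc n) - 1) - a (int (Suc n))) + (a (- int n - 1) - a (int n)))"
      by (simp add: Suc del: of_nat_Suc)
    moreover have "a (- int (Suc n)) = a (- int n - 1)" "a (int (Suc n) - 1) = a (int n)"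
      by (rule arg_cong[of _ _ a], simp)+
    ultimately show ?case by algebra
  qed simp
  have partial: "(\<Sum>m=-int n..int n. circle_coeff h m * circle_exp m t0) = h t0 + (a (- int n - 1) - a (int n))" for n
    unfolding rec' sum.distrib tele by (simp add: sum.delta)
  have a0: "(\<lambda>n. a (- int n - 1)) \<longlonglongrightarrow> 0" "(\<lambda>n. a (int n)) \<longlonglongrightarrow> 0"
  proof -
    have "\<exists>N. \<forall>n\<ge>N. cmod (a (- int n - 1)) < e \<and> cmod (a (int n)) < e" if pos: "e > 0" for e
    proof -
      obtain N where "\<And>m. \<bar>m\<bar> \<ge> int N \<Longrightarrow> cmod (circle_coeff g m) \<le> e / 2"
        by (rule riemann_lebesgue_circle[OF gc gp half_gt_zero[OF pos]]) blast
      then have "cmod (a (- int n - 1)) \<le> e / 2 \<and> cmod (a (int n)) \<le> e / 2" if "n \<ge> N" for n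
        using that by (simp add: a_def norm_mult)
      then show ?thesis using pos by (intro exI[of _ N]) force
    qed
    then show "(\<lambda>n. a (- int n - 1)) \<longlonglongrightarrow> 0" "(\<lambda>n. a (int n)) \<longlonglongrightarrow> 0"
      unfolding LIMSEQ_iff by (metis diff_zero)+
  qed
  have "(\<lambda>n. h t0 + (a (- int n - 1) - a (int n))) \<longlonglongrightarrow> h t0 + (0 - 0)"
    by (intro tendsto_intros a0)
  then show ?thesis unfolding partial by simp
qed

lemma summable_on_int_abs:
  fixes b :: "nat \<Rightarrow> real"
  assumes "summable b" "\<And>n. b n \<ge> 0"
  shows "(\<lambda>m::int. b (nat \<bar>m\<bar>)) summable_on UNIV"
proof -
  have b: "b summable_on UNIV" "(\<lambda>n. b (Suc n)) summable_on UNIV"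
    using assms summable_Suc_iff[of b] by (auto intro!: norm_summable_imp_summable_on)
  have "(\<lambda>m::int. b (nat \<bar>m\<bar>)) summable_on (int ` UNIV)"
    by (subst summable_on_reindex) (use b in \<open>auto simp: comp_def\<close>)
  moreover have "(\<lambda>m::int. b (nat \<bar>m\<bar>)) summable_on ((\<lambda>n. - int (Suc n)) ` UNIV)"
    by (subst summable_on_reindex) (use b in \<open>auto simp: comp_def inj_on_def nat_add_distrib\<close>)
  ultimately have "(\<lambda>m::int. b (nat \<bar>m\<bar>)) summable_on (int ` UNIV \<union> (\<lambda>n. - int (Suc n)) ` UNIV)"
    by (rule summable_on_Un_disjoint) auto
  moreover have "int ` UNIV \<union> (\<lambda>n. - int (Suc n)) ` UNIV = UNIV"
  proof (intro equalityI subsetI UNIV_I)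
    fix m :: int
    show "m \<in> int ` UNIV \<union> (\<lambda>n. - int (Suc n)) ` UNIV"
    proof (cases m rule: int_cases)
      case (neg n) then show ?thesis by blast
    qed auto
  qed
  ultimately show ?thesis by simp
qed

lemma summable_on_int_inverse_square: "(\<lambda>m::int. C / (1 + \<bar>real_of_int m\<bar>)\<^sup>2) summable_on UNIV"
proof -
  have "summable (\<lambda>n. inverse ((real (Suc n))\<^sup>2))"
    using inverse_power_summable[of 2, where 'a=real] summable_Suc_iff[of "\<lambda>n. inverse ((real n)\<^sup>2)"] by simp
  then have "summable (\<lambda>n. 1 / (1 + real n)\<^sup>2)" by (simp add: inverse_eq_divide)
  then have "(\<lambda>m::int. 1 / (1 + real (nat \<bar>m\<bar>))\<^sup>2) summable_on UNIV"
    by (rule summable_on_int_abs) auto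
  then have "(\<lambda>m::int. C * (1 / (1 + real (nat \<bar>m\<bar>))\<^sup>2)) summable_on UNIV"
    by (rule summable_on_cmult_right)
  then show ?thesis by simp
qed

lemma summable_on_int_poly_geometric:
  assumes "0 \<le> r" "r < 1"
  shows "(\<lambda>m::int. C * (1 + \<bar>real_of_int m\<bar>) ^ N * r ^ nat \<bar>m\<bar>) summable_on UNIV"
proof -
  have "(\<lambda>n. (1 + inverse (real (Suc n))) ^ N * r) \<longlonglongrightarrow> 1 ^ N * r"
    by (intro tendsto_intros LIMSEQ_inverse_real_of_nat_add)
  then have "\<forall>\<^sub>F n in sequentially. (1 + inverse (real (Suc n))) ^ N * r < (1 + r) / 2"
    using assms by (intro order_tendstoD) auto
  then obtain n0 where n0: "\<And>n. n \<ge> n0 \<Longrightarrow> (1 + inverse (real (Suc n))) ^ N * r < (1 + r) / 2"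
    by (auto simp: eventually_sequentially)
  have "summable (\<lambda>n. (1 + real n) ^ N * r ^ n)"
  proof (rule summable_ratio_test)
    show "(1 + r) / 2 < 1" using assms by simp
    fix n assume n: "n \<ge> n0"
    have "1 + real (Suc n) = (1 + real n) * (1 + inverse (real (Suc n)))" by (simp add: field_simps)
    then have "(1 + real (Suc n)) ^ N * r ^ Suc n = (1 + inverse (real (Suc n))) ^ N * r * ((1 + real n) ^ N * r ^ n)"
      by (simp add: power_mult_distrib)
    also have "\<dots> \<le> (1 + r) / 2 * ((1 + real n) ^ N * r ^ n)"
      using n0[OF n] assms by (intro mult_right_mono) auto
    finally show "norm ((1 + real (Suc n)) ^ N * r ^ Suc n) \<le> (1 + r) / 2 * norm ((1 + real n) ^ N * r ^ n)"
      using assms by (simp add: abs_mult)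
  qed
  then have "(\<lambda>m::int. (1 + real (nat \<bar>m\<bar>)) ^ N * r ^ nat \<bar>m\<bar>) summable_on UNIV"
    by (rule summable_on_int_abs) (use assms in auto)
  then have "(\<lambda>m::int. C * ((1 + real (nat \<bar>m\<bar>)) ^ N * r ^ nat \<bar>m\<bar>)) summable_on UNIV"
    by (rule summable_on_cmult_right)
  then show ?thesis by (simp add: mult.assoc)
qed

lemma fourier_series_has_sum:
  assumes h: "h \<in> circle_smooth"
  shows "((\<lambda>m. circle_coeff h m * circle_exp m t) has_sum h t) UNIV"
proof -
  obtain B where B: "\<And>m. cmod (circle_coeff h m) \<le> B / (1 + \<bar>real_of_int m\<bar>) ^ 2"
    using circle_coeff_decay[OF h] by blast
  have "(\<lambda>m. norm (circle_coeff h m * circle_exp m t)) summable_on UNIV"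
    by (rule Infinite_Sum.abs_summable_on_comparison_test'[OF summable_on_int_inverse_square[of B]]) (use B in \<open>auto simp: norm_mult\<close>)
  then have hs: "((\<lambda>m. circle_coeff h m * circle_exp m t) has_sum (\<Sum>\<^sub>\<infinity>m. circle_coeff h m * circle_exp m t)) UNIV"
    by (rule has_sum_infsum[OF abs_summable_summable])
  have "filterlim (\<lambda>n. {- int n..int n}) (finite_subsets_at_top UNIV) sequentially"
    unfolding filterlim_finite_subsets_at_top
  proof (intro allI impI)
    fix X :: "int set" assume X: "finite X \<and> X \<subseteq> UNIV"
    define K where "K = (\<Sum>m\<in>X. nat \<bar>m\<bar>)"
    have K: "\<bar>m\<bar> \<le> int K" if "m \<in> X" for m
    proof -
      have "nat \<bar>m\<bar> \<le> K"
        unfolding K_def by (rule member_le_sum) (use that X in auto)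
      then show ?thesis by linarith
    qed
    have "X \<subseteq> {- int n..int n}" if "n \<ge> K" for n using K that by fastforce
    then show "\<forall>\<^sub>F n in sequentially. finite {- int n..int n} \<and> X \<subseteq> {- int n..int n} \<and> {- int n..int n} \<subseteq> UNIV"
      by (auto simp: eventually_sequentially)
  qed
  then have "(\<lambda>n. \<Sum>m=-int n..int n. circle_coeff h m * circle_exp m t) \<longlonglongrightarrow> (\<Sum>\<^sub>\<infinity>m. circle_coeff h m * circle_exp m t)"
    by (rule filterlim_compose[OF hs[unfolded has_sum_def]])
  then have "(\<Sum>\<^sub>\<infinity>m. circle_coeff h m * circle_exp m t) = h t"
    using fourier_partial_sums_tendsto[OF h] LIMSEQ_unique by blast
  then show ?thesis using hs by simp
qed

text \<open>The Fourier series of \<open>\<phi>\<close> may be differentiated termwise, and by \<open>circle_coeff_decay\<close> each differentiated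
series converges uniformly. So the series converges to \<open>\<phi>\<close> in the topology of smooth functions, and \<open>f\<close> can
be applied term by term.\<close>

theorem distribution_fourier_expansion:
  assumes f: "circle_distribution f" and \<phi>: "\<phi> \<in> circle_smooth"
  shows "((\<lambda>m. fourier_coeff f m * integral {0..2*pi} (\<lambda>\<theta>. circle_exp m \<theta> * \<phi> \<theta>)) has_sum f \<phi>) UNIV"
proof -
  let ?S = "\<lambda>F \<theta>. \<Sum>m\<in>F. circle_coeff \<phi> m * circle_exp m \<theta>"
  have uni: "uniform_limit UNIV (\<lambda>F \<theta>. \<Sum>m\<in>F. circle_coeff (iter_deriv k \<phi>) m * circle_exp m \<theta>) (iter_deriv k \<phi>) (finite_subsets_at_top UNIV)" for k
  proof -
    obtain B where B: "\<And>m. cmod (circle_coeff (iter_deriv k \<phi>) m) \<le> B / (1 + \<bar>real_of_int m\<bar>) ^ 2"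
      using circle_coeff_decay[OF circle_smooth_iter_deriv[OF \<phi>]] by blast
    show ?thesis
      by (rule Weierstrass_m_test_general'[OF _ fourier_series_has_sum[OF circle_smooth_iter_deriv[OF \<phi>]] summable_on_int_inverse_square[of B]])
         (use B in \<open>simp add: norm_mult\<close>)
  qed
  have der: "iter_deriv k (?S F) \<theta> = (\<Sum>m\<in>F. circle_coeff (iter_deriv k \<phi>) m * circle_exp m \<theta>)" if "finite F" for k F \<theta>
    using iter_deriv_sum[OF that, of circle_exp k "circle_coeff \<phi>"]
    by (simp add: circle_exp_smooth iter_deriv_circle_exp circle_coeff_deriv[OF \<phi>] mult_ac)
  have "((\<lambda>F. f (?S F)) \<longlongrightarrow> f \<phi>) (finite_subsets_at_top UNIV)"
    unfolding tendsto_iff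
  proof (intro allI impI)
    fix e :: real assume "e > 0"
    then obtain N \<epsilon> where \<epsilon>: "\<epsilon> > 0" and nb: "\<And>\<psi>. \<psi> \<in> circle_nbhd N \<epsilon> \<phi> \<Longrightarrow> cmod (f \<psi> - f \<phi>) < e"
      using circle_distribution_nbhd[OF f \<phi>] by metis
    have "\<forall>\<^sub>F F in finite_subsets_at_top UNIV. \<forall>k\<in>{..N}. \<forall>\<theta>\<in>UNIV. dist (\<Sum>m\<in>F. circle_coeff (iter_deriv k \<phi>) m * circle_exp m \<theta>) (iter_deriv k \<phi> \<theta>) < \<epsilon>"
      by (rule eventually_ball_finite[OF finite_atMost], rule ballI, rule uniform_limitD[OF uni \<epsilon>])
    moreover have "\<forall>\<^sub>F F in finite_subsets_at_top (UNIV::int set). finite F"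
      by (simp add: eventually_finite_subsets_at_top_weakI)
    ultimately show "\<forall>\<^sub>F F in finite_subsets_at_top UNIV. dist (f (?S F)) (f \<phi>) < e"
    proof eventually_elim
      case (elim F)
      have "?S F \<in> circle_nbhd N \<epsilon> \<phi>"
        unfolding circle_nbhd_def
        using elim circle_smooth_sum[of F circle_exp "circle_coeff \<phi>"] circle_exp_smooth by (auto simp: der dist_norm)
      then show ?case using nb by (simp add: dist_norm)
    qed
  qed
  then have "((\<lambda>F. \<Sum>m\<in>F. circle_coeff \<phi> m * f (circle_exp m)) \<longlongrightarrow> f \<phi>) (finite_subsets_at_top UNIV)"
    by (rule Lim_transform_eventually)
       (auto intro!: eventually_finite_subsets_at_top_weakI circle_distribution_sum f circle_exp_smooth)
  then have "((\<lambda>m. circle_coeff \<phi> m * f (circle_exp m)) has_sum f \<phi>) UNIV" by (simp add: has_sum_def)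
  then have "((\<lambda>m. circle_coeff \<phi> (- m) * f (circle_exp (- m))) has_sum f \<phi>) UNIV"
    by (subst has_sum_reindex_bij_betw[where g = uminus]) (auto intro: bij_uminus)
  then show ?thesis
    by (rule has_sum_cong[THEN iffD1, rotated]) (simp add: circle_coeff_def fourier_coeff_eq mult.commute)
qed

lemma fourier_coeff_integral_abs_summable:
  assumes f: "circle_distribution f" and \<phi>: "\<phi> \<in> circle_smooth"
  shows "(\<lambda>m. K * (cmod (fourier_coeff f m) * cmod (integral {0..2*pi} (\<lambda>\<theta>. circle_exp m \<theta> * \<phi> \<theta>)))) summable_on UNIV"
proof -
  obtain C N where C: "C \<ge> 0" "\<And>m. cmod (fourier_coeff f m) \<le> C * (1 + \<bar>real_of_int m\<bar>) ^ N"
    using fourier_coeff_growth[OF f] by blast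
  obtain B where B: "B \<ge> 0" "\<And>m. cmod (circle_coeff \<phi> m) \<le> B / (1 + \<bar>real_of_int m\<bar>) ^ (N + 2)"
    using circle_coeff_decay[OF \<phi>] by blast
  have "(\<lambda>m. cmod (fourier_coeff f m * integral {0..2*pi} (\<lambda>\<theta>. circle_exp m \<theta> * \<phi> \<theta>))) summable_on UNIV"
  proof (rule Infinite_Sum.abs_summable_on_comparison_test'[OF summable_on_int_inverse_square[of "C * (2 * pi * B)"]])
    fix m :: int
    have "integral {0..2*pi} (\<lambda>\<theta>. circle_exp m \<theta> * \<phi> \<theta>) = of_real (2 * pi) * circle_coeff \<phi> (- m)"
      by (simp add: circle_coeff_def mult.commute)
    then have "cmod (integral {0..2*pi} (\<lambda>\<theta>. circle_exp m \<theta> * \<phi> \<theta>)) \<le> 2 * pi * (B / (1 + \<bar>real_of_int m\<bar>) ^ (N + 2))"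
      using mult_left_mono[OF B(2)[of "- m"], of "2 * pi"] by (simp add: norm_mult)
    then have "cmod (fourier_coeff f m * integral {0..2*pi} (\<lambda>\<theta>. circle_exp m \<theta> * \<phi> \<theta>)) \<le> C * (1 + \<bar>real_of_int m\<bar>) ^ N * (2 * pi * (B / (1 + \<bar>real_of_int m\<bar>) ^ (N + 2)))"
      unfolding norm_mult using C by (intro mult_mono) auto
    also have "\<dots> = C * (2 * pi * B) / (1 + \<bar>real_of_int m\<bar>)\<^sup>2"
    proof -
      have "C * q ^ N * (2 * pi * (B / q ^ (N + 2))) = C * (2 * pi * B) / q\<^sup>2" if "q > 0" for q :: real
        using that by (simp add: power_add power2_eq_square)
      then show ?thesis by simp
    qed
    finally show "cmod (fourier_coeff f m * integral {0..2*pi} (\<lambda>\<theta>. circle_exp m \<theta> * \<phi> \<theta>)) \<le> C * (2 * pi * B) / (1 + \<bar>real_of_int m\<bar>)\<^sup>2" .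
  qed
  then show ?thesis by (simp add: norm_mult summable_on_cmult_right)
qed

section \<open>The series in the disk and its boundary value\<close>

text \<open>The harmonic function \<open>r^\<bar>m\<bar> * exp (\<i> m \<theta>)\<close>, expressed by \<open>z\<close> so that its continuity across the cut of the
argument and at the origin is evident.\<close>

definition disk_power :: "int \<Rightarrow> complex \<Rightarrow> complex" where
  "disk_power m z = (if m \<ge> 0 then z ^ nat m else cnj z ^ nat (- m))"

definition radial_mode :: "(nat \<Rightarrow> real \<Rightarrow> complex) \<Rightarrow> int \<Rightarrow> complex \<Rightarrow> complex" where
  "radial_mode y m z = alpha y (nat \<bar>m\<bar>) (cmod z) / alpha y (nat \<bar>m\<bar>) 1 * disk_power m z"

lemma circle_exp_eq_cis: "circle_exp m \<theta> = cis (of_int m * \<theta>)"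
  by (simp add: circle_exp_def cis_conv_exp mult.assoc)

lemma disk_power_rcis: "disk_power m (rcis r \<theta>) = of_real r ^ nat \<bar>m\<bar> * circle_exp m \<theta>"
proof (cases "m \<ge> 0")
  case True
  then show ?thesis
    by (simp add: disk_power_def rcis_def power_mult_distrib Complex.DeMoivre circle_exp_eq_cis)
next
  case False
  then have "real (nat (- m)) = - real_of_int m" "nat \<bar>m\<bar> = nat (- m)" by auto
  with False show ?thesis
    by (simp add: disk_power_def rcis_def power_mult_distrib cis_cnj Complex.DeMoivre circle_exp_eq_cis del: of_nat_nat)
qed

lemma norm_disk_power: "cmod (disk_power m z) = cmod z ^ nat \<bar>m\<bar>"
  by (simp add: disk_power_def norm_power)

lemma continuous_on_disk_power: "continuous_on S (disk_power m)"
  unfolding disk_power_def by (cases "m \<ge> 0") (auto intro!: continuous_intros)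

lemma u_term_eq_mode: "0 \<le> r \<Longrightarrow> u_term y f r \<theta> m = fourier_coeff f m * radial_mode y m (rcis r \<theta>)"
  by (simp add: u_term_def radial_mode_def disk_power_rcis circle_exp_def)

lemma u_fun_eq: "u_fun y f z = (\<Sum>\<^sub>\<infinity>m. fourier_coeff f m * radial_mode y m z)"
  by (simp add: u_fun_def u_term_eq_mode rcis_cmod_Arg)

text \<open>The properties of the radial functions on which the convergence of the series rests.\<close>

locale radial_family =
  fixes y :: "nat \<Rightarrow> real \<Rightarrow> complex" and K :: real
  assumes K: "\<And>m r. r \<in> {0..1} \<Longrightarrow> cmod (alpha y m r / alpha y m 1) \<le> K"
    and alpha_cont: "\<And>m. continuous_on {0..1} (alpha y m)"
    and alpha_nz: "\<And>m. alpha y m 1 \<noteq> 0"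
begin

lemma K_nonneg: "K \<ge> 0"
  using order_trans[OF norm_ge_zero K[of 0 0]] by simp

lemma norm_radial_mode_le: "cmod z \<le> 1 \<Longrightarrow> cmod (radial_mode y m z) \<le> K * cmod z ^ nat \<bar>m\<bar>"
  unfolding radial_mode_def norm_mult norm_disk_power by (intro mult_right_mono K) auto

lemma continuous_on_radial_mode: "continuous_on (cball 0 1) (radial_mode y m)"
  unfolding radial_mode_def
  by (intro continuous_intros continuous_on_disk_power continuous_on_compose2[OF alpha_cont])
     (auto simp: alpha_nz)

end

locale radial_series = radial_family +
  fixes f :: "(real \<Rightarrow> complex) \<Rightarrow> complex"
  assumes f: "circle_distribution f"
begin

text \<open>The geometric factor \<open>r^\<bar>m\<bar>\<close> beats the polynomial growth of the Fourier coefficients.\<close>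

lemma mode_term_bound:
  assumes "0 \<le> r" "r < 1"
  obtains M where "M summable_on UNIV" "\<And>m z. cmod z \<le> r \<Longrightarrow> cmod (fourier_coeff f m * radial_mode y m z) \<le> M m"
    "\<And>m. M m \<ge> 0"
proof -
  obtain C N where C: "C \<ge> 0" "\<And>m. cmod (fourier_coeff f m) \<le> C * (1 + \<bar>real_of_int m\<bar>) ^ N"
    using fourier_coeff_growth[OF f] by blast
  show ?thesis
  proof (rule that[OF summable_on_int_poly_geometric[OF assms, of "C * K" N]])
    fix m z assume z: "cmod z \<le> r"
    have "cmod (radial_mode y m z) \<le> K * r ^ nat \<bar>m\<bar>"
      using norm_radial_mode_le[of z m] power_mono[OF z norm_ge_zero, of "nat \<bar>m\<bar>"] z assms K_nonneg
      by (smt (verit) mult_left_mono)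
    then have "cmod (fourier_coeff f m * radial_mode y m z) \<le> C * (1 + \<bar>real_of_int m\<bar>) ^ N * (K * r ^ nat \<bar>m\<bar>)"
      unfolding norm_mult using C by (intro mult_mono) auto
    then show "cmod (fourier_coeff f m * radial_mode y m z) \<le> C * K * (1 + \<bar>real_of_int m\<bar>) ^ N * r ^ nat \<bar>m\<bar>"
      by (simp add: mult_ac)
  qed (use C assms K_nonneg in auto)
qed

lemma summable_u_term:
  assumes "r \<in> {0..<1}" shows "u_term y f r \<theta> summable_on UNIV"
proof -
  have r: "0 \<le> r" "r < 1" using assms by auto
  obtain M where M: "M summable_on UNIV" "\<And>m z. cmod z \<le> r \<Longrightarrow> cmod (fourier_coeff f m * radial_mode y m z) \<le> M m"
    by (rule mode_term_bound[OF r]) blast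
  have "(\<lambda>m. fourier_coeff f m * radial_mode y m (rcis r \<theta>)) summable_on UNIV"
    by (rule abs_summable_summable[OF Infinite_Sum.abs_summable_on_comparison_test'[OF M(1)]]) (use M(2) r in simp)
  moreover have "u_term y f r \<theta> = (\<lambda>m. fourier_coeff f m * radial_mode y m (rcis r \<theta>))"
    using u_term_eq_mode[OF r(1)] by (simp add: fun_eq_iff)
  ultimately show ?thesis by simp
qed

lemma uniform_limit_u_fun:
  assumes "0 \<le> r" "r < 1"
  shows "uniform_limit (cball 0 r) (\<lambda>F z. \<Sum>m\<in>F. fourier_coeff f m * radial_mode y m z) (u_fun y f) (finite_subsets_at_top UNIV)"
proof -
  obtain M where M: "M summable_on UNIV" "\<And>m z. cmod z \<le> r \<Longrightarrow> cmod (fourier_coeff f m * radial_mode y m z) \<le> M m"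
    by (rule mode_term_bound[OF assms]) blast
  show ?thesis
    unfolding u_fun_eq[abs_def] by (rule Weierstrass_m_test_general[OF _ M(1)]) (use M(2) in auto)
qed

lemma continuous_on_u_fun: "continuous_on (ball 0 1) (u_fun y f)"
  unfolding continuous_on_eq_continuous_at[OF open_ball]
proof
  fix z :: complex assume "z \<in> ball 0 1"
  then obtain r where r: "cmod z < r" "r < 1" using dense by (metis dist_0_norm mem_ball)
  then have r0: "0 \<le> r" using norm_ge_zero[of z] by linarith
  have "continuous_on (cball 0 r) (u_fun y f)"
  proof (rule uniform_limit_theorem[OF _ uniform_limit_u_fun[OF r0 r(2)]])
    show "\<forall>\<^sub>F F in finite_subsets_at_top UNIV. continuous_on (cball 0 r) (\<lambda>z. \<Sum>m\<in>F. fourier_coeff f m * radial_mode y m z)"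
      using r by (intro always_eventually allI continuous_intros continuous_on_subset[OF continuous_on_radial_mode]) auto
  qed simp
  then have "continuous_on (ball 0 r) (u_fun y f)" by (rule continuous_on_subset) auto
  then show "isCont (u_fun y f) z"
    using r by (simp add: continuous_on_eq_continuous_at)
qed

text \<open>For \<open>r < 1\<close> uniform convergence allows integration term by term. The resulting series in \<open>r\<close> is
dominated on all of \<open>[0, 1]\<close> by a multiple of the series of \<open>fourier_coeff_integral_abs_summable\<close>, so its
sum \<open>G\<close> is continuous up to \<open>r = 1\<close>. There all radial factors are \<open>1\<close> and \<open>G\<close> takes the value \<open>f \<phi>\<close>.\<close>

lemma has_dist_boundary_value_u_fun: "has_dist_boundary_value (u_fun y f) f"
  unfolding has_dist_boundary_value_def
proof (intro ballI conjI)
  fix \<phi> assume \<phi>: "\<phi> \<in> circle_smooth"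
  have cphi: "continuous_on S \<phi>" for S using continuous_on_iter_deriv[OF \<phi>, of S 0] by simp
  have crcis: "continuous_on S (rcis r)" for S r unfolding rcis_def[abs_def] by (intro continuous_intros)
  have cont: "continuous_on {0..2*pi} (\<lambda>\<theta>. u_fun y f (rcis r \<theta>) * \<phi> \<theta>)" if "r \<in> {0..<1}" for r
    by (intro continuous_intros cphi continuous_on_compose2[OF continuous_on_u_fun crcis]) (use that in auto)
  have si: "set_integrable lebesgue {0..2*pi} (\<lambda>\<theta>. u_fun y f (rcis r \<theta>) * \<phi> \<theta>)" if "r \<in> {0..<1}" for r
    by (rule absolutely_integrable_continuous_real[OF cont[OF that]])
  have ev: "\<forall>\<^sub>F r in at_left (1::real). r \<in> {0..<1}"
    using eventually_at_left_real[of 0 1] by (auto elim: eventually_mono)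
  show "\<forall>\<^sub>F r in at_left 1. set_integrable lebesgue {0..2*pi} (\<lambda>\<theta>. u_fun y f (rcis r \<theta>) * \<phi> \<theta>)"
    using ev by eventually_elim (rule si)
  define I where "I m = integral {0..2*pi} (\<lambda>\<theta>. circle_exp m \<theta> * \<phi> \<theta>)" for m
  define T where "T m r = fourier_coeff f m * (of_real r ^ nat \<bar>m\<bar> * (alpha y (nat \<bar>m\<bar>) r / alpha y (nat \<bar>m\<bar>) 1)) * I m" for m r
  define G where "G r = (\<Sum>\<^sub>\<infinity>m. T m r)" for r
  have T1: "T m 1 = fourier_coeff f m * I m" for m by (simp add: T_def alpha_nz)
  have G1: "G 1 = f \<phi>"
    unfolding G_def T1 I_def using distribution_fourier_expansion[OF f \<phi>] by (rule infsumI)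
  have Tb: "cmod (T m r) \<le> K * (cmod (fourier_coeff f m) * cmod (I m))" if "r \<in> {0..1}" for m r
  proof -
    have "cmod (of_real r ^ nat \<bar>m\<bar> * (alpha y (nat \<bar>m\<bar>) r / alpha y (nat \<bar>m\<bar>) 1)) \<le> 1 * K"
      unfolding norm_mult using that K[OF that, of "nat \<bar>m\<bar>"]
      by (intro mult_mono) (auto simp: norm_power power_le_one)
    then have "cmod (T m r) \<le> cmod (fourier_coeff f m) * K * cmod (I m)"
      unfolding T_def norm_mult[of _ "I m"] norm_mult[of "fourier_coeff f m"] by (intro mult_right_mono mult_left_mono) auto
    then show ?thesis by (simp add: mult_ac)
  qed
  have uT: "uniform_limit {0..1} (\<lambda>F r. \<Sum>m\<in>F. T m r) G (finite_subsets_at_top UNIV)"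
    unfolding G_def[abs_def] I_def
    by (rule Weierstrass_m_test_general[OF _ fourier_coeff_integral_abs_summable[OF f \<phi>, of K]])
       (use Tb in \<open>simp add: I_def\<close>)
  have "continuous_on {0..1} G"
  proof (rule uniform_limit_theorem[OF _ uT])
    show "\<forall>\<^sub>F F in finite_subsets_at_top UNIV. continuous_on {0..1} (\<lambda>r. \<Sum>m\<in>F. T m r)"
      unfolding T_def using alpha_nz by (intro always_eventually allI continuous_intros alpha_cont) auto
  qed simp
  then have "(G \<longlongrightarrow> G 1) (at 1 within {0..1})" by (simp add: continuous_on_def)
  then have "(G \<longlongrightarrow> f \<phi>) (at_left 1)" by (simp add: G1 at_within_Icc_at_left)
  moreover have "G r = (LINT \<theta>:{0..2*pi}|lebesgue. u_fun y f (rcis r \<theta>) * \<phi> \<theta>)" if r: "r \<in> {0..<1}" for r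
  proof -
    have r': "0 \<le> r" "r < 1" using r by auto
    obtain M where M: "M summable_on UNIV" "\<And>m z. cmod z \<le> r \<Longrightarrow> cmod (fourier_coeff f m * radial_mode y m z) \<le> M m" "\<And>m. M m \<ge> 0"
      by (rule mode_term_bound[OF r']) blast
    obtain B where B: "\<And>\<theta>. \<theta> \<in> {0..2*pi} \<Longrightarrow> cmod (\<phi> \<theta>) \<le> B"
      using compact_imp_bounded[OF compact_continuous_image[OF cphi compact_Icc]] by (metis bounded_iff image_eqI)
    let ?t = "\<lambda>m \<theta>. fourier_coeff f m * radial_mode y m (rcis r \<theta>) * \<phi> \<theta>"
    have "uniform_limit {0..2*pi} (\<lambda>F \<theta>. \<Sum>m\<in>F. ?t m \<theta>) (\<lambda>\<theta>. \<Sum>\<^sub>\<infinity>m. ?t m \<theta>) (finite_subsets_at_top UNIV)"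
    proof (rule Weierstrass_m_test_general)
      show "(\<lambda>m. M m * B) summable_on UNIV" by (rule summable_on_cmult_left[OF M(1)])
      show "cmod (?t m \<theta>) \<le> M m * B" if "\<theta> \<in> {0..2*pi}" for m \<theta>
        unfolding norm_mult[of _ "\<phi> \<theta>"] using M(2)[of "rcis r \<theta>" m] r' B[OF that] M(3) by (intro mult_mono) auto
    qed
    moreover have "(\<Sum>\<^sub>\<infinity>m. ?t m \<theta>) = u_fun y f (rcis r \<theta>) * \<phi> \<theta>" for \<theta>
      unfolding u_fun_eq by (rule infsum_cmult_left') 
    ultimately have u: "uniform_limit {0..2*pi} (\<lambda>F \<theta>. \<Sum>m\<in>F. ?t m \<theta>) (\<lambda>\<theta>. u_fun y f (rcis r \<theta>) * \<phi> \<theta>) (finite_subsets_at_top UNIV)"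
      by simp
    have ct: "continuous_on {0..2*pi} (?t m)" for m
      by (intro continuous_intros cphi continuous_on_compose2[OF continuous_on_radial_mode crcis]) (use r' in auto)
    obtain A J where A: "\<And>F. ((\<lambda>\<theta>. \<Sum>m\<in>F. ?t m \<theta>) has_integral A F) {0..2*pi}"
      and J: "((\<lambda>\<theta>. u_fun y f (rcis r \<theta>) * \<phi> \<theta>) has_integral J) {0..2*pi}" and AJ: "(A \<longlongrightarrow> J) (finite_subsets_at_top UNIV)"
      by (rule uniform_limit_integral[OF u continuous_on_sum[OF ct]]) auto
    have It: "(?t m has_integral T m r) {0..2*pi}" for m
    proof -
      have "((\<lambda>\<theta>. circle_exp m \<theta> * \<phi> \<theta>) has_integral I m) {0..2*pi}"
        unfolding I_def by (intro integrable_integral integrable_continuous_real continuous_intros cphi)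
      then have "((\<lambda>\<theta>. fourier_coeff f m * (of_real r ^ nat \<bar>m\<bar> * (alpha y (nat \<bar>m\<bar>) r / alpha y (nat \<bar>m\<bar>) 1)) * (circle_exp m \<theta> * \<phi> \<theta>)) has_integral T m r) {0..2*pi}"
        unfolding T_def by (rule has_integral_mult_right)
      moreover have "fourier_coeff f m * (of_real r ^ nat \<bar>m\<bar> * (alpha y (nat \<bar>m\<bar>) r / alpha y (nat \<bar>m\<bar>) 1)) * (circle_exp m \<theta> * \<phi> \<theta>) = ?t m \<theta>" for \<theta>
        using r' by (simp add: radial_mode_def disk_power_rcis)
      ultimately show ?thesis by simp
    qed
    have "A F = (\<Sum>m\<in>F. T m r)" if "finite F" for F
      using has_integral_unique[OF A has_integral_sum[OF that It]] .
    then have "\<forall>\<^sub>F F in finite_subsets_at_top UNIV. A F = (\<Sum>m\<in>F. T m r)"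
      by (intro eventually_finite_subsets_at_top_weakI) auto
    with AJ have "((\<lambda>F. \<Sum>m\<in>F. T m r) \<longlongrightarrow> J) (finite_subsets_at_top UNIV)"
      by (rule Lim_transform_eventually)
    then have "((\<lambda>m. T m r) has_sum J) UNIV" by (simp add: has_sum_def)
    then have "G r = J" unfolding G_def by (rule infsumI)
    also have "\<dots> = (LINT \<theta>:{0..2*pi}|lebesgue. u_fun y f (rcis r \<theta>) * \<phi> \<theta>)"
      using set_lebesgue_integral_eq_integral(2)[OF si[OF r]] integral_unique[OF J] by simp
    finally show ?thesis .
  qed
  then have "\<forall>\<^sub>F r in at_left 1. G r = (LINT \<theta>:{0..2*pi}|lebesgue. u_fun y f (rcis r \<theta>) * \<phi> \<theta>)"
    using ev by (auto elim: eventually_mono)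
  ultimately show "((\<lambda>r. LINT \<theta>:{0..2*pi}|lebesgue. u_fun y f (rcis r \<theta>) * \<phi> \<theta>) \<longlongrightarrow> f \<phi>) (at_left 1)"
    by (rule Lim_transform_eventually)
qed

end

section \<open>Polar coordinates in the plane\<close>

lemma lborel_complex_eq:
  "(lborel :: complex measure) = distr (lborel \<Otimes>\<^sub>M lborel) borel (\<lambda>(x, y). Complex x y)"
proof (rule lborel_eqI)
  fix l u :: complex assume le: "\<And>b. b \<in> Basis \<Longrightarrow> l \<bullet> b \<le> u \<bullet> b"
  have le': "Re l \<le> Re u" "Im l \<le> Im u" using le[of 1] le[of \<i>] by (auto simp: Basis_complex_def)
  have m: "(\<lambda>(x, y). Complex x y) \<in> borel_measurable (lborel \<Otimes>\<^sub>M lborel)"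
    unfolding Complex_eq by measurable
  have "(\<lambda>(x, y). Complex x y) -` box l u \<inter> space (lborel \<Otimes>\<^sub>M lborel) = {Re l<..<Re u} \<times> {Im l<..<Im u}"
    by (auto simp: box_def Basis_complex_def space_pair_measure)
  then have "emeasure (distr (lborel \<Otimes>\<^sub>M lborel) borel (\<lambda>(x, y). Complex x y)) (box l u)
      = emeasure (lborel \<Otimes>\<^sub>M lborel) ({Re l<..<Re u} \<times> {Im l<..<Im u})"
    by (subst emeasure_distr[OF m]) auto
  also have "\<dots> = emeasure lborel {Re l<..<Re u} * emeasure lborel {Im l<..<Im u}"
    by (rule lborel.emeasure_pair_measure_Times) auto
  also have "\<dots> = ennreal (Re u - Re l) * ennreal (Im u - Im l)"
    using le' by simp
  also have "\<dots> = ennreal (\<Prod>b\<in>Basis. (u - l) \<bullet> b)"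
    using le' by (simp add: Basis_complex_def ennreal_mult)
  finally show "emeasure (distr (lborel \<Otimes>\<^sub>M lborel) borel (\<lambda>(x, y). Complex x y)) (box l u) = ennreal (\<Prod>b\<in>Basis. (u - l) \<bullet> b)" .
qed simp

lemma nn_integral_lborel_complex:
  fixes F :: "complex \<Rightarrow> ennreal"
  assumes [measurable]: "F \<in> borel_measurable borel"
  shows "(\<integral>\<^sup>+z. F z \<partial>lborel) = (\<integral>\<^sup>+x. \<integral>\<^sup>+y. F (Complex x y) \<partial>lborel \<partial>lborel)"
    and "(\<integral>\<^sup>+z. F z \<partial>lborel) = (\<integral>\<^sup>+y. \<integral>\<^sup>+x. F (Complex x y) \<partial>lborel \<partial>lborel)"
proof -
  have [measurable]: "(\<lambda>(x, y). Complex x y) \<in> borel_measurable (lborel \<Otimes>\<^sub>M lborel)"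
    unfolding Complex_eq by measurable
  have m: "(\<lambda>p. F (case p of (x, y) \<Rightarrow> Complex x y)) \<in> borel_measurable (lborel \<Otimes>\<^sub>M lborel)" by measurable
  have "(\<integral>\<^sup>+z. F z \<partial>lborel) = (\<integral>\<^sup>+p. F (case p of (x, y) \<Rightarrow> Complex x y) \<partial>(lborel \<Otimes>\<^sub>M lborel))"
    by (subst lborel_complex_eq, rule nn_integral_distr) auto
  then show "(\<integral>\<^sup>+z. F z \<partial>lborel) = (\<integral>\<^sup>+x. \<integral>\<^sup>+y. F (Complex x y) \<partial>lborel \<partial>lborel)"
     "(\<integral>\<^sup>+z. F z \<partial>lborel) = (\<integral>\<^sup>+y. \<integral>\<^sup>+x. F (Complex x y) \<partial>lborel \<partial>lborel)"
    using lborel.nn_integral_fst[OF m] lborel_pair.nn_integral_snd[OF m] by simp_all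
qed

lemma nn_integral_shear:
  fixes F :: "complex \<Rightarrow> ennreal"
  assumes [measurable]: "F \<in> borel_measurable borel"
  shows "(\<integral>\<^sup>+z. F (Complex (Re z + a * Im z) (Im z)) \<partial>lborel) = (\<integral>\<^sup>+z. F z \<partial>lborel)"
    and "(\<integral>\<^sup>+z. F (Complex (Re z) (Im z + a * Re z)) \<partial>lborel) = (\<integral>\<^sup>+z. F z \<partial>lborel)"
proof -
  have mC: "(\<lambda>z. Complex (g z) (h z)) \<in> borel_measurable M" if [measurable]: "g \<in> borel_measurable M" "h \<in> borel_measurable M"
    for g h and M :: "'b measure"
    unfolding Complex_eq by measurable
  have [measurable]: "(\<lambda>z. F (Complex (g z) (h z))) \<in> borel_measurable M" if "g \<in> borel_measurable M" "h \<in> borel_measurable M"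
    for g h and M :: "'b measure"
    using measurable_compose[OF mC[OF that] assms] .
  have "(\<integral>\<^sup>+z. F (Complex (Re z + a * Im z) (Im z)) \<partial>lborel) = (\<integral>\<^sup>+y. \<integral>\<^sup>+x. F (Complex (x + a * y) y) \<partial>lborel \<partial>lborel)"
    by (subst nn_integral_lborel_complex(2)) (auto intro!: measurable_compose[OF mC assms])
  also have "\<dots> = (\<integral>\<^sup>+y. \<integral>\<^sup>+x. F (Complex x y) \<partial>lborel \<partial>lborel)"
  proof (rule nn_integral_cong)
    show "(\<integral>\<^sup>+x. F (Complex (x + a * y) y) \<partial>lborel) = (\<integral>\<^sup>+x. F (Complex x y) \<partial>lborel)" for y
      using nn_integral_real_affine[of "\<lambda>x. F (Complex x y)" 1 "a * y"] measurable_compose[OF mC assms]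
      by (simp add: add.commute)
  qed
  also have "(\<integral>\<^sup>+y. \<integral>\<^sup>+x. F (Complex x y) \<partial>lborel \<partial>lborel) = (\<integral>\<^sup>+z. F z \<partial>lborel)"
    by (rule nn_integral_lborel_complex(2)[symmetric]) fact
  finally show "(\<integral>\<^sup>+z. F (Complex (Re z + a * Im z) (Im z)) \<partial>lborel) = (\<integral>\<^sup>+z. F z \<partial>lborel)" .
  have "(\<integral>\<^sup>+z. F (Complex (Re z) (Im z + a * Re z)) \<partial>lborel) = (\<integral>\<^sup>+x. \<integral>\<^sup>+y. F (Complex x (y + a * x)) \<partial>lborel \<partial>lborel)"
    by (subst nn_integral_lborel_complex(1)) (auto intro!: measurable_compose[OF mC assms])
  also have "\<dots> = (\<integral>\<^sup>+x. \<integral>\<^sup>+y. F (Complex x y) \<partial>lborel \<partial>lborel)"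
  proof (rule nn_integral_cong)
    show "(\<integral>\<^sup>+y. F (Complex x (y + a * x)) \<partial>lborel) = (\<integral>\<^sup>+y. F (Complex x y) \<partial>lborel)" for x
      using nn_integral_real_affine[of "\<lambda>y. F (Complex x y)" 1 "a * x"] measurable_compose[OF mC assms]
      by (simp add: add.commute)
  qed
  also have "(\<integral>\<^sup>+x. \<integral>\<^sup>+y. F (Complex x y) \<partial>lborel \<partial>lborel) = (\<integral>\<^sup>+z. F z \<partial>lborel)"
    by (rule nn_integral_lborel_complex(1)[symmetric]) fact
  finally show "(\<integral>\<^sup>+z. F (Complex (Re z) (Im z + a * Re z)) \<partial>lborel) = (\<integral>\<^sup>+z. F z \<partial>lborel)" .
qed

text \<open>A rotation is a product of three shears, with parameters \<open>- tan (\<theta> / 2)\<close>, \<open>sin \<theta>\<close> and \<open>- tan (\<theta> / 2)\<close>, and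
a shear preserves the integral by Fubini's theorem and invariance under translations of the line. The angle
\<open>pi\<close>, which has no such factorisation, is a null set for the averaging in \<open>nn_integral_polar\<close>.\<close>

lemma nn_integral_rotate:
  fixes F :: "complex \<Rightarrow> ennreal"
  assumes [measurable]: "F \<in> borel_measurable borel" and c: "cos (\<theta> / 2) \<noteq> 0"
  shows "(\<integral>\<^sup>+z. F (cis \<theta> * z) \<partial>lborel) = (\<integral>\<^sup>+z. F z \<partial>lborel)"
proof -
  define t where "t = tan (\<theta> / 2)"
  let ?X = "\<lambda>z. Complex (Re z + (- t) * Im z) (Im z)" and ?Y = "\<lambda>z. Complex (Re z) (Im z + sin \<theta> * Re z)"
  have s: "sin \<theta> = 2 * sin (\<theta> / 2) * cos (\<theta> / 2)" using sin_double[of "\<theta> / 2"] by simp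
  have cs: "cos \<theta> = 1 - 2 * (sin (\<theta> / 2))\<^sup>2" using cos_double_sin[of "\<theta> / 2"] by simp
  have ts: "t * sin \<theta> = 1 - cos \<theta>"
    using c unfolding t_def tan_def s cs by (simp add: power2_eq_square)
  have t2: "t * (1 + cos \<theta>) = sin \<theta>"
    using c cos_double_cos[of "\<theta> / 2"] unfolding t_def tan_def s by (simp add: power2_eq_square)
  have c1: "1 - t * sin \<theta> = cos \<theta>" using ts by simp
  have rot: "cis \<theta> * z = ?X (?Y (?X z))" for z
  proof (rule complex_eqI)
    have "Re (?X (?Y (?X z))) = (1 - t * sin \<theta>) * Re z - t * (1 + (1 - t * sin \<theta>)) * Im z"
      by (simp add: algebra_simps)
    also have "\<dots> = cos \<theta> * Re z - sin \<theta> * Im z" unfolding c1 t2 by simp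
    finally show "Re (cis \<theta> * z) = Re (?X (?Y (?X z)))" by simp
    have "Im (?X (?Y (?X z))) = sin \<theta> * Re z + (1 - t * sin \<theta>) * Im z"
      by (simp add: algebra_simps)
    then show "Im (cis \<theta> * z) = Im (?X (?Y (?X z)))" unfolding ts by (simp add: algebra_simps)
  qed
  have X: "?X \<in> borel_measurable borel" and Y: "?Y \<in> borel_measurable borel"
    unfolding Complex_eq by measurable
  have 1: "(\<lambda>z. F (?X z)) \<in> borel_measurable borel" using measurable_compose[OF X assms(1)] .
  have 2: "(\<lambda>z. F (?X (?Y z))) \<in> borel_measurable borel" using measurable_compose[OF Y 1] .
  show ?thesis
    unfolding rot
    using nn_integral_shear(1)[OF 2, of "- t"] nn_integral_shear(2)[OF 1, of "sin \<theta>"] nn_integral_shear(1)[OF assms(1), of "- t"]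
    by simp
qed

lemma nn_integral_periodic_shift:
  fixes p :: "real \<Rightarrow> ennreal"
  assumes [measurable]: "p \<in> borel_measurable borel" and per: "\<And>t. p (t + 2 * pi) = p t"
    and a: "- (2 * pi) < a" "a < 2 * pi"
  shows "(\<integral>\<^sup>+t. p (t + a) * indicator {0..<2*pi} t \<partial>lborel) = (\<integral>\<^sup>+t. p t * indicator {0..<2*pi} t \<partial>lborel)"
proof -
  have *: "(\<integral>\<^sup>+t. p (t + a) * indicator {0..<2*pi} t \<partial>lborel) = (\<integral>\<^sup>+t. p t * indicator {0..<2*pi} t \<partial>lborel)"
    if a: "0 \<le> a" "a < 2 * pi" for a
  proof -
    have sh: "(\<integral>\<^sup>+t. q t \<partial>lborel) = (\<integral>\<^sup>+t. q (t + b) \<partial>lborel)" if "q \<in> borel_measurable borel" for q :: "real \<Rightarrow> ennreal" and b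
      using nn_integral_real_affine[OF that, of 1 b] by (simp add: add.commute)
    have "(\<integral>\<^sup>+t. p (t + a) * indicator {0..<2*pi} t \<partial>lborel) = (\<integral>\<^sup>+t. p (t + a) * indicator {a..<a+2*pi} (t + a) \<partial>lborel)"
      by (intro nn_integral_cong) (auto simp: indicator_def)
    also have "\<dots> = (\<integral>\<^sup>+t. p t * indicator {a..<a+2*pi} t \<partial>lborel)"
      by (subst (2) sh[of _ a]) auto
    also have "\<dots> = (\<integral>\<^sup>+t. p t * indicator {a..<2*pi} t + p t * indicator {2*pi..<2*pi+a} t \<partial>lborel)"
      using a by (intro nn_integral_cong) (auto simp: indicator_def)
    also have "\<dots> = (\<integral>\<^sup>+t. p t * indicator {a..<2*pi} t \<partial>lborel) + (\<integral>\<^sup>+t. p t * indicator {2*pi..<2*pi+a} t \<partial>lborel)"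
      by (rule nn_integral_add) auto
    also have "(\<integral>\<^sup>+t. p t * indicator {2*pi..<2*pi+a} t \<partial>lborel) = (\<integral>\<^sup>+t. p (t + 2*pi) * indicator {2*pi..<2*pi+a} (t + 2*pi) \<partial>lborel)"
      by (rule sh) auto
    also have "\<dots> = (\<integral>\<^sup>+t. p t * indicator {0..<a} t \<partial>lborel)"
      by (intro nn_integral_cong) (auto simp: indicator_def per)
    also have "(\<integral>\<^sup>+t. p t * indicator {a..<2*pi} t \<partial>lborel) + (\<integral>\<^sup>+t. p t * indicator {0..<a} t \<partial>lborel)
       = (\<integral>\<^sup>+t. p t * indicator {a..<2*pi} t + p t * indicator {0..<a} t \<partial>lborel)"
      by (rule nn_integral_add[symmetric]) auto
    also have "\<dots> = (\<integral>\<^sup>+t. p t * indicator {0..<2*pi} t \<partial>lborel)"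
      using a by (intro nn_integral_cong) (auto simp: indicator_def)
    finally show ?thesis .
  qed
  show ?thesis
  proof (cases "0 \<le> a")
    case False
    have "p (t + a) = p (t + (a + 2 * pi))" for t using per[of "t + a"] by (simp add: add.assoc)
    then show ?thesis using *[of "a + 2 * pi"] False a by simp
  qed (use * a in auto)
qed

text \<open>The area \<open>pi * a\<^sup>2\<close> of a disk is the integral of \<open>2 * pi * r\<close> over \<open>[0, a]\<close>.\<close>

lemma distr_lborel_cmod:
  "distr lborel borel cmod = density lborel (\<lambda>r. ennreal (2 * pi * r) * indicator {0..} r)"
proof (rule measure_eqI_generator_eq[where E = "range (\<lambda>a::real. {..a})" and \<Omega> = UNIV and A = "\<lambda>n. {..real n}"])
  show "Int_stable (range (\<lambda>a::real. {..a}))" by (auto simp: Int_stable_def)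
  show "range (\<lambda>a::real. {..a}) \<subseteq> Pow UNIV" by auto
  show "sets (distr lborel borel cmod) = sigma_sets UNIV (range (\<lambda>a::real. {..a}))"
    by (simp add: borel_eq_atMost)
  show "sets (density lborel (\<lambda>r. ennreal (2 * pi * r) * indicator {0..} r)) = sigma_sets UNIV (range (\<lambda>a::real. {..a}))"
    by (simp add: borel_eq_atMost)
  show "range (\<lambda>n. {..real n}) \<subseteq> range (\<lambda>a::real. {..a})" by auto
  show "(\<Union>n. {..real n}) = UNIV" by (auto intro: real_arch_simple)
  have emb: "emeasure (distr lborel borel cmod) {..a} = (if a < 0 then 0 else ennreal (pi * a\<^sup>2))" for a
  proof -
    have "cmod -` {..a} \<inter> space lborel = cball 0 a" by (auto simp: cball_def)
    then have "emeasure (distr lborel borel cmod) {..a} = emeasure lborel (cball (0::complex) a)"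
      by (subst emeasure_distr) auto
    then show ?thesis
      by (simp add: emeasure_cball unit_ball_vol_2)
  qed
  show "emeasure (distr lborel borel cmod) {..real n} \<noteq> \<infinity>" for n unfolding emb by simp
  fix X assume "X \<in> range (\<lambda>a::real. {..a})"
  then obtain a where X: "X = {..a}" by auto
  have "emeasure (density lborel (\<lambda>r. ennreal (2 * pi * r) * indicator {0..} r)) {..a}
      = (\<integral>\<^sup>+r. ennreal (2 * pi * r) * indicator {0..a} r \<partial>lborel)"
    by (subst emeasure_density) (auto intro!: nn_integral_cong simp: indicator_def)
  also have "\<dots> = (if a < 0 then 0 else ennreal (pi * a\<^sup>2))"
  proof (cases "a < 0")
    case False
    have "(\<integral>\<^sup>+r. ennreal (2 * pi * r) * indicator {0..a} r \<partial>lborel) = ennreal (pi * a\<^sup>2 - pi * 0\<^sup>2)"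
      using False
      by (intro nn_integral_FTC_Icc) (auto intro!: derivative_eq_intros has_real_derivative_iff_has_vector_derivative[THEN iffD1])
    then show ?thesis using False by simp
  qed simp
  finally show "emeasure (distr lborel borel cmod) X = emeasure (density lborel (\<lambda>r. ennreal (2 * pi * r) * indicator {0..} r)) X"
    unfolding X emb ..
qed

lemma nn_integral_radial:
  assumes [measurable]: "h \<in> borel_measurable borel"
  shows "(\<integral>\<^sup>+z. h (cmod z) \<partial>lborel) = (\<integral>\<^sup>+r. ennreal (2 * pi * r) * indicator {0..} r * h r \<partial>lborel)"
proof -
  have "(\<integral>\<^sup>+z. h (cmod z) \<partial>lborel) = (\<integral>\<^sup>+r. h r \<partial>distr lborel borel cmod)"
    by (subst nn_integral_distr) auto
  also have "\<dots> = (\<integral>\<^sup>+r. ennreal (2 * pi * r) * indicator {0..} r * h r \<partial>lborel)"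
    unfolding distr_lborel_cmod by (subst nn_integral_density) auto
  finally show ?thesis .
qed

lemma borel_measurable_rcis [measurable (raw)]:
  assumes [measurable]: "g \<in> borel_measurable M" "h \<in> borel_measurable M"
  shows "(\<lambda>x. rcis (g x) (h x)) \<in> borel_measurable M"
  unfolding rcis_def cis.ctr Complex_eq by measurable

text \<open>By rotation invariance the integral of \<open>F\<close> is the mean over \<open>\<theta>\<close> of the integrals of \<open>F (cis \<theta> * z)\<close>. After
an exchange of the integrals the inner one, over \<open>\<theta>\<close>, depends on \<open>cmod z\<close> only, and \<open>nn_integral_radial\<close>
applies.\<close>

theorem nn_integral_polar:
  fixes F :: "complex \<Rightarrow> ennreal"
  assumes [measurable]: "F \<in> borel_measurable borel"
  shows "(\<integral>\<^sup>+z. F z \<partial>lborel) =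
    (\<integral>\<^sup>+r. ennreal r * indicator {0..} r * (\<integral>\<^sup>+\<theta>. F (rcis r \<theta>) * indicator {0..<2*pi} \<theta> \<partial>lborel) \<partial>lborel)"
proof -
  let ?H = "\<lambda>r. \<integral>\<^sup>+\<theta>. F (rcis r \<theta>) * indicator {0..<2*pi} \<theta> \<partial>lborel"
  have [measurable]: "?H \<in> borel_measurable borel"
    by measurable
  have nz: "AE \<theta> in lborel. \<theta> \<in> {0..<2*pi} \<longrightarrow> cos (\<theta> / 2) \<noteq> 0"
  proof (rule AE_I')
    show "{pi} \<in> null_sets lborel" by (rule countable_imp_null_set_lborel) simp
    show "{\<theta> \<in> space lborel. \<not> (\<theta> \<in> {0..<2*pi} \<longrightarrow> cos (\<theta> / 2) \<noteq> 0)} \<subseteq> {pi}"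
    proof
      fix \<theta> :: real assume "\<theta> \<in> {\<theta> \<in> space lborel. \<not> (\<theta> \<in> {0..<2*pi} \<longrightarrow> cos (\<theta> / 2) \<noteq> 0)}"
      then have t: "\<theta> \<in> {0..<2*pi}" "cos (\<theta> / 2) = 0" by auto
      have "\<theta> / 2 = pi / 2"
        by (rule cos_inj_pi) (use t in auto)
      then show "\<theta> \<in> {pi}" by simp
    qed
  qed
  have "ennreal (2 * pi) * (\<integral>\<^sup>+z. F z \<partial>lborel) = (\<integral>\<^sup>+\<theta>. (\<integral>\<^sup>+z. F z \<partial>lborel) * indicator {0..<2*pi} \<theta> \<partial>lborel)"
    by (subst nn_integral_cmult_indicator) (auto simp: mult.commute)
  also have "\<dots> = (\<integral>\<^sup>+\<theta>. (\<integral>\<^sup>+z. F (cis \<theta> * z) * indicator {0..<2*pi} \<theta> \<partial>lborel) \<partial>lborel)"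
  proof (rule nn_integral_cong_AE, rule AE_mp[OF nz], rule AE_I2, rule impI)
    fix \<theta> :: real assume "\<theta> \<in> {0..<2*pi} \<longrightarrow> cos (\<theta> / 2) \<noteq> 0"
    then show "(\<integral>\<^sup>+z. F z \<partial>lborel) * indicator {0..<2*pi} \<theta> = (\<integral>\<^sup>+z. F (cis \<theta> * z) * indicator {0..<2*pi} \<theta> \<partial>lborel)"
      using nn_integral_rotate[of F \<theta>] by (cases "\<theta> \<in> {0..<2*pi}") auto
  qed
  also have "\<dots> = (\<integral>\<^sup>+z. (\<integral>\<^sup>+\<theta>. F (cis \<theta> * z) * indicator {0..<2*pi} \<theta> \<partial>lborel) \<partial>lborel)"
    by (rule lborel_pair.Fubini') (unfold cis.ctr Complex_eq, measurable)
  also have "\<dots> = (\<integral>\<^sup>+z. ?H (cmod z) \<partial>lborel)"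
  proof (rule nn_integral_cong)
    fix z :: complex
    have "(\<integral>\<^sup>+\<theta>. F (cis \<theta> * z) * indicator {0..<2*pi} \<theta> \<partial>lborel) = (\<integral>\<^sup>+\<theta>. F (rcis (cmod z) (\<theta> + Arg z)) * indicator {0..<2*pi} \<theta> \<partial>lborel)"
    proof -
      have "rcis (cmod z) (\<theta> + Arg z) = cis \<theta> * rcis (cmod z) (Arg z)" for \<theta>
        by (simp add: rcis_def cis_mult[symmetric])
      then show ?thesis by (simp add: rcis_cmod_Arg)
    qed
    also have "\<dots> = ?H (cmod z)"
    proof (rule nn_integral_periodic_shift)
      show "(\<lambda>t. F (rcis (cmod z) t)) \<in> borel_measurable borel" by measurable
      show "F (rcis (cmod z) (t + 2 * pi)) = F (rcis (cmod z) t)" for t by (simp add: rcis_def cis.ctr)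
    qed (use Arg_bounded[of z] in auto)
    finally show "(\<integral>\<^sup>+\<theta>. F (cis \<theta> * z) * indicator {0..<2*pi} \<theta> \<partial>lborel) = ?H (cmod z)" .
  qed
  also have "\<dots> = (\<integral>\<^sup>+r. ennreal (2 * pi * r) * indicator {0..} r * ?H r \<partial>lborel)"
    by (rule nn_integral_radial) measurable
  also have "\<dots> = (\<integral>\<^sup>+r. ennreal (2 * pi) * (ennreal r * indicator {0..} r * ?H r) \<partial>lborel)"
    by (intro nn_integral_cong) (auto simp: indicator_def ennreal_mult mult_ac)
  also have "\<dots> = ennreal (2 * pi) * (\<integral>\<^sup>+r. ennreal r * indicator {0..} r * ?H r \<partial>lborel)"
    by (rule nn_integral_cmult) measurable
  finally show ?thesis
    by (subst (asm) ennreal_mult_cancel_left) auto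
qed

lemma lborel_complex_eq_polar:
  "(lborel :: complex measure) = distr (density (lborel \<Otimes>\<^sub>M lborel)
      (\<lambda>p. ennreal (fst p * indicator {0..} (fst p) * indicator {0..<2*pi} (snd p)))) borel (\<lambda>p. rcis (fst p) (snd p))"
proof (rule measure_eqI)
  fix A :: "complex set" assume "A \<in> sets lborel"
  then have [measurable]: "A \<in> sets borel" by simp
  let ?w = "\<lambda>p::real \<times> real. ennreal (fst p * indicator {0..} (fst p) * indicator {0..<2*pi} (snd p))"
  have "emeasure lborel A = (\<integral>\<^sup>+z. indicator A z \<partial>lborel)" by simp
  also have "\<dots> = (\<integral>\<^sup>+r. ennreal r * indicator {0..} r * (\<integral>\<^sup>+\<theta>. indicator A (rcis r \<theta>) * indicator {0..<2*pi} \<theta> \<partial>lborel) \<partial>lborel)"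
    by (rule nn_integral_polar) measurable
  also have "\<dots> = (\<integral>\<^sup>+r. \<integral>\<^sup>+\<theta>. ?w (r, \<theta>) * indicator A (rcis r \<theta>) \<partial>lborel \<partial>lborel)"
    by (intro nn_integral_cong) (subst nn_integral_cmult[symmetric], measurable, intro nn_integral_cong, auto simp: indicator_def)
  also have "\<dots> = (\<integral>\<^sup>+p. ?w p * indicator A (rcis (fst p) (snd p)) \<partial>(lborel \<Otimes>\<^sub>M lborel))"
    by (subst lborel.nn_integral_fst[symmetric]) (auto, measurable)
  also have "\<dots> = (\<integral>\<^sup>+p. indicator A (rcis (fst p) (snd p)) \<partial>density (lborel \<Otimes>\<^sub>M lborel) ?w)"
    by (subst nn_integral_density) auto
  also have "\<dots> = (\<integral>\<^sup>+z. indicator A z \<partial>distr (density (lborel \<Otimes>\<^sub>M lborel) ?w) borel (\<lambda>p. rcis (fst p) (snd p)))"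
    by (subst nn_integral_distr) auto
  finally show "emeasure lborel A = emeasure (distr (density (lborel \<Otimes>\<^sub>M lborel) ?w) borel (\<lambda>p. rcis (fst p) (snd p))) A"
    by simp
qed simp

theorem integral_polar:
  fixes F :: "complex \<Rightarrow> complex"
  assumes F: "integrable lborel F"
  shows "integrable lborel (\<lambda>r. (r * indicator {0..} r) *\<^sub>R (\<integral>\<theta>. indicator {0..<2*pi} \<theta> *\<^sub>R F (rcis r \<theta>) \<partial>lborel))"
    and "(\<integral>z. F z \<partial>lborel) = (\<integral>r. (r * indicator {0..} r) *\<^sub>R (\<integral>\<theta>. indicator {0..<2*pi} \<theta> *\<^sub>R F (rcis r \<theta>) \<partial>lborel) \<partial>lborel)"
proof -
  let ?w = "\<lambda>p::real \<times> real. fst p * indicator {0..} (fst p) * indicator {0..<2*pi} (snd p)"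
  have [measurable]: "F \<in> borel_measurable borel" using F by auto
  have "integrable (distr (density (lborel \<Otimes>\<^sub>M lborel) (\<lambda>p. ennreal (?w p))) borel (\<lambda>p. rcis (fst p) (snd p))) F"
    using F by (subst (asm) lborel_complex_eq_polar)
  then have "integrable (density (lborel \<Otimes>\<^sub>M lborel) (\<lambda>p. ennreal (?w p))) (\<lambda>p. F (rcis (fst p) (snd p)))"
    by (subst (asm) integrable_distr_eq) auto
  then have i: "integrable (lborel \<Otimes>\<^sub>M lborel) (\<lambda>p. ?w p *\<^sub>R F (rcis (fst p) (snd p)))"
    by (subst (asm) integrable_density) (auto simp: indicator_def)
  have eq: "(\<integral>\<theta>. ?w (r, \<theta>) *\<^sub>R F (rcis (fst (r, \<theta>)) (snd (r, \<theta>))) \<partial>lborel)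
     = (r * indicator {0..} r) *\<^sub>R (\<integral>\<theta>. indicator {0..<2*pi} \<theta> *\<^sub>R F (rcis r \<theta>) \<partial>lborel)" for r
    by (simp flip: integral_scaleR_right)
  show "integrable lborel (\<lambda>r. (r * indicator {0..} r) *\<^sub>R (\<integral>\<theta>. indicator {0..<2*pi} \<theta> *\<^sub>R F (rcis r \<theta>) \<partial>lborel))"
    using lborel_pair.integrable_fst'[OF i] unfolding eq .
  have "(\<integral>z. F z \<partial>lborel) = (\<integral>z. F z \<partial>distr (density (lborel \<Otimes>\<^sub>M lborel) (\<lambda>p. ennreal (?w p))) borel (\<lambda>p. rcis (fst p) (snd p)))"
    by (subst lborel_complex_eq_polar) simp
  also have "\<dots> = (\<integral>p. F (rcis (fst p) (snd p)) \<partial>density (lborel \<Otimes>\<^sub>M lborel) (\<lambda>p. ennreal (?w p)))"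
    by (subst integral_distr) auto
  also have "\<dots> = (\<integral>p. ?w p *\<^sub>R F (rcis (fst p) (snd p)) \<partial>(lborel \<Otimes>\<^sub>M lborel))"
    by (subst integral_density) (auto simp: indicator_def)
  also have "\<dots> = (\<integral>r. (r * indicator {0..} r) *\<^sub>R (\<integral>\<theta>. indicator {0..<2*pi} \<theta> *\<^sub>R F (rcis r \<theta>) \<partial>lborel) \<partial>lborel)"
    using lborel_pair.integral_fst'[OF i] unfolding eq by simp
  finally show "(\<integral>z. F z \<partial>lborel) = (\<integral>r. (r * indicator {0..} r) *\<^sub>R (\<integral>\<theta>. indicator {0..<2*pi} \<theta> *\<^sub>R F (rcis r \<theta>) \<partial>lborel) \<partial>lborel)" .
qed

section \<open>Smooth functions in polar coordinates\<close>

lemma smooth_plane_partial: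
  assumes "smooth_plane \<phi>" "b \<in> Basis" shows "smooth_plane (partial b \<phi>)"
  unfolding smooth_plane_def
proof
  fix bs :: "complex list" assume "bs \<in> lists Basis"
  then have "bs @ [b] \<in> lists Basis" using assms(2) by auto
  then have "foldr partial (bs @ [b]) \<phi> differentiable_on UNIV" using assms(1) unfolding smooth_plane_def by blast
  then show "foldr partial bs (partial b \<phi>) differentiable_on UNIV" by simp
qed

lemma smooth_plane_has_derivative:
  assumes "smooth_plane \<phi>"
  shows "(\<phi> has_derivative (\<lambda>h. of_real (Re h) * partial 1 \<phi> z + of_real (Im h) * partial \<i> \<phi> z)) (at z)"
proof -
  have "foldr partial [] \<phi> differentiable_on UNIV" using assms unfolding smooth_plane_def by blast
  then have d: "(\<phi> has_derivative frechet_derivative \<phi> (at z)) (at z)"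
    by (simp add: differentiable_on_def frechet_derivative_works)
  then have lin: "linear (frechet_derivative \<phi> (at z))" by (rule has_derivative_linear)
  have "frechet_derivative \<phi> (at z) h = of_real (Re h) * partial 1 \<phi> z + of_real (Im h) * partial \<i> \<phi> z" for h
  proof -
    have "frechet_derivative \<phi> (at z) h = frechet_derivative \<phi> (at z) (Re h *\<^sub>R 1 + Im h *\<^sub>R \<i>)"
      by (rule arg_cong[of _ _ "frechet_derivative \<phi> (at z)"]) (simp add: complex_eq_iff)
    also have "\<dots> = Re h *\<^sub>R frechet_derivative \<phi> (at z) 1 + Im h *\<^sub>R frechet_derivative \<phi> (at z) \<i>"
      unfolding linear_add[OF lin] linear_scale[OF lin] ..
    finally show ?thesis by (simp add: partial_def scaleR_conv_of_real)
  qed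
  then have "frechet_derivative \<phi> (at z) = (\<lambda>h. of_real (Re h) * partial 1 \<phi> z + of_real (Im h) * partial \<i> \<phi> z)" by blast
  with d show ?thesis by simp
qed

lemma smooth_plane_continuous_on: "smooth_plane \<phi> \<Longrightarrow> continuous_on S \<phi>"
  by (rule has_derivative_continuous_on[OF has_derivative_at_withinI[OF smooth_plane_has_derivative]])

lemma smooth_plane_chain:
  assumes "smooth_plane \<phi>" "(\<gamma> has_vector_derivative \<gamma>') (at t within S)"
  shows "((\<lambda>t. \<phi> (\<gamma> t)) has_vector_derivative of_real (Re \<gamma>') * partial 1 \<phi> (\<gamma> t) + of_real (Im \<gamma>') * partial \<i> \<phi> (\<gamma> t)) (at t within S)"
  using vector_derivative_diff_chain_within[OF assms(2) has_derivative_at_withinI[OF smooth_plane_has_derivative[OF assms(1)]]]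
  by (simp add: comp_def)

lemma has_vector_derivative_rcis_radius: "((\<lambda>r. rcis r \<theta>) has_vector_derivative cis \<theta>) (at r within S)"
proof -
  have "((\<lambda>r. of_real r * cis \<theta>) has_vector_derivative of_real 1 * cis \<theta>) (at r within S)"
    by (intro has_vector_derivative_mult_left has_vector_derivative_of_real) simp
  then show ?thesis by (simp add: rcis_def)
qed

lemma has_vector_derivative_rcis_angle: "(rcis r has_vector_derivative of_real r * (\<i> * cis \<theta>)) (at \<theta> within S)"
proof -
  have "((\<lambda>\<theta>. of_real r * circle_exp 1 \<theta>) has_vector_derivative of_real r * (\<i> * of_int 1 * circle_exp 1 \<theta>)) (at \<theta> within S)"
    by (intro has_vector_derivative_mult_right has_vector_derivative_circle_exp)
  then show ?thesis by (simp add: rcis_def[abs_def] circle_exp_eq_cis)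
qed

lemma smooth_plane_radial_derivative:
  assumes "smooth_plane \<phi>"
  shows "((\<lambda>r. \<phi> (rcis r \<theta>)) has_vector_derivative
     of_real (cos \<theta>) * partial 1 \<phi> (rcis r \<theta>) + of_real (sin \<theta>) * partial \<i> \<phi> (rcis r \<theta>)) (at r within S)"
  using smooth_plane_chain[OF assms has_vector_derivative_rcis_radius[of \<theta> r S]] by simp

lemma smooth_plane_angular_derivative:
  assumes "smooth_plane \<phi>"
  shows "((\<lambda>\<theta>. \<phi> (rcis r \<theta>)) has_vector_derivative
     of_real r * (of_real (cos \<theta>) * partial \<i> \<phi> (rcis r \<theta>) - of_real (sin \<theta>) * partial 1 \<phi> (rcis r \<theta>))) (at \<theta> within S)"
  using smooth_plane_chain[OF assms has_vector_derivative_rcis_angle[of r \<theta> S]] by (simp add: algebra_simps)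

lemma continuous_on_rcis [continuous_intros]:
  assumes "continuous_on S g" "continuous_on S h"
  shows "continuous_on S (\<lambda>x. rcis (g x) (h x))"
  unfolding rcis_def by (intro continuous_intros assms)

locale smooth_function =
  fixes \<phi> :: "complex \<Rightarrow> complex"
  assumes smooth: "smooth_plane \<phi>"
begin

lemma smooth_partial: "smooth_plane (partial 1 \<phi>)" "smooth_plane (partial \<i> \<phi>)"
  using smooth_plane_partial[OF smooth] by (auto simp: Basis_complex_def)

lemma smooth_partial_partial: "smooth_plane (partial 1 (partial 1 \<phi>))" "smooth_plane (partial 1 (partial \<i> \<phi>))"
   "smooth_plane (partial \<i> (partial 1 \<phi>))" "smooth_plane (partial \<i> (partial \<i> \<phi>))"
  using smooth_partial smooth_plane_partial by (auto simp: Basis_complex_def)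

text \<open>The partial derivatives of \<open>\<phi> (rcis r \<theta>)\<close>, named by the variables of differentiation and written in the
form that the product rule produces.\<close>

definition polar_r :: "real \<Rightarrow> real \<Rightarrow> complex" where
  "polar_r r \<theta> = of_real (cos \<theta>) * partial 1 \<phi> (rcis r \<theta>) + of_real (sin \<theta>) * partial \<i> \<phi> (rcis r \<theta>)"

definition polar_rr :: "real \<Rightarrow> real \<Rightarrow> complex" where
  "polar_rr r \<theta> =
     of_real (cos \<theta>) * (of_real (cos \<theta>) * partial 1 (partial 1 \<phi>) (rcis r \<theta>) + of_real (sin \<theta>) * partial \<i> (partial 1 \<phi>) (rcis r \<theta>)) +
     of_real (sin \<theta>) * (of_real (cos \<theta>) * partial 1 (partial \<i> \<phi>) (rcis r \<theta>) + of_real (sin \<theta>) * partial \<i> (partial \<i> \<phi>) (rcis r \<theta>))"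

definition polar_t :: "real \<Rightarrow> real \<Rightarrow> complex" where
  "polar_t r \<theta> = of_real r * (of_real (cos \<theta>) * partial \<i> \<phi> (rcis r \<theta>) - of_real (sin \<theta>) * partial 1 \<phi> (rcis r \<theta>))"

definition polar_tt :: "real \<Rightarrow> real \<Rightarrow> complex" where
  "polar_tt r \<theta> = of_real r * (
     (of_real (cos \<theta>) * (of_real r * (of_real (cos \<theta>) * partial \<i> (partial \<i> \<phi>) (rcis r \<theta>) - of_real (sin \<theta>) * partial 1 (partial \<i> \<phi>) (rcis r \<theta>)))
       + of_real (- sin \<theta>) * partial \<i> \<phi> (rcis r \<theta>)) -
     (of_real (sin \<theta>) * (of_real r * (of_real (cos \<theta>) * partial \<i> (partial 1 \<phi>) (rcis r \<theta>) - of_real (sin \<theta>) * partial 1 (partial 1 \<phi>) (rcis r \<theta>)))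
       + of_real (cos \<theta>) * partial 1 \<phi> (rcis r \<theta>)))"

lemma has_vector_derivative_polar_r: "((\<lambda>r. \<phi> (rcis r \<theta>)) has_vector_derivative polar_r r \<theta>) (at r within S)"
  unfolding polar_r_def by (rule smooth_plane_radial_derivative[OF smooth])

lemma has_vector_derivative_polar_rr: "((\<lambda>r. polar_r r \<theta>) has_vector_derivative polar_rr r \<theta>) (at r within S)"
  unfolding polar_r_def polar_rr_def
  by (intro has_vector_derivative_add has_vector_derivative_mult_right smooth_plane_radial_derivative smooth_partial)

lemma has_vector_derivative_polar_t: "((\<lambda>\<theta>. \<phi> (rcis r \<theta>)) has_vector_derivative polar_t r \<theta>) (at \<theta> within S)"
  unfolding polar_t_def by (rule smooth_plane_angular_derivative[OF smooth])

lemma has_vector_derivative_polar_tt: "(polar_t r has_vector_derivative polar_tt r \<theta>) (at \<theta> within S)"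
proof -
  have c: "(cos has_real_derivative - sin \<theta>) (at \<theta> within S)" and s: "(sin has_real_derivative cos \<theta>) (at \<theta> within S)"
    by (auto intro!: derivative_eq_intros)
  have "((\<lambda>\<theta>. of_real (cos \<theta>)) has_vector_derivative complex_of_real (- sin \<theta>)) (at \<theta> within S)"
    "((\<lambda>\<theta>. of_real (sin \<theta>)) has_vector_derivative complex_of_real (cos \<theta>)) (at \<theta> within S)"
    using has_vector_derivative_of_real[OF c] has_vector_derivative_of_real[OF s] by blast+
  then show ?thesis
    unfolding polar_t_def[abs_def] polar_tt_def
    by (intro has_vector_derivative_mult_right has_vector_derivative_diff has_vector_derivative_mult smooth_plane_angular_derivative smooth_partial)
qed

lemma polar_laplacian:
  assumes "r > 0"
  shows "laplacian \<phi> (rcis r \<theta>) = polar_rr r \<theta> + polar_r r \<theta> / of_real r + polar_tt r \<theta> / of_real (r\<^sup>2)"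
proof -
  have "cos \<theta> * cos \<theta> = 1 - sin \<theta> * sin \<theta>" using sin_cos_squared_add3[of \<theta>] by linarith
  then have "complex_of_real (cos \<theta> * cos \<theta>) = of_real (1 - sin \<theta> * sin \<theta>)" by (rule arg_cong)
  then have cs: "complex_of_real (cos \<theta>) * of_real (cos \<theta>) = 1 - of_real (sin \<theta>) * of_real (sin \<theta>)"
    by (simp only: of_real_mult of_real_diff of_real_1)
  have alg: "a11 + a22 = (c * (c * a11 + s * a21) + s * (c * a12 + s * a22)) + (c * a1 + s * a2) / R
     + R * ((c * (R * (c * a22 - s * a12)) + (- s) * a2) - (s * (R * (c * a21 - s * a11)) + c * a1)) / R\<^sup>2"
    if "R \<noteq> 0" "c * c = 1 - s * s" for c s R a1 a2 a11 a12 a21 a22 :: complex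
  proof -
    have "R * ((c * (R * (c * a22 - s * a12)) + (- s) * a2) - (s * (R * (c * a21 - s * a11)) + c * a1)) / R\<^sup>2
      = (c * (c * a22 - s * a12) - s * (c * a21 - s * a11)) - (c * a1 + s * a2) / R"
      using that(1) by (simp add: field_simps power2_eq_square)
    then have "(c * (c * a11 + s * a21) + s * (c * a12 + s * a22)) + (c * a1 + s * a2) / R
     + R * ((c * (R * (c * a22 - s * a12)) + (- s) * a2) - (s * (R * (c * a21 - s * a11)) + c * a1)) / R\<^sup>2
      = (c * c + s * s) * (a11 + a22)" by (simp add: algebra_simps)
    then show ?thesis using that(2) by simp
  qed
  have "laplacian \<phi> (rcis r \<theta>) = partial 1 (partial 1 \<phi>) (rcis r \<theta>) + partial \<i> (partial \<i> \<phi>) (rcis r \<theta>)"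
    by (simp add: laplacian_def Basis_complex_def)
  then show ?thesis
    unfolding polar_rr_def polar_r_def polar_tt_def of_real_minus of_real_power
    using alg[of "of_real r" "of_real (cos \<theta>)" "of_real (sin \<theta>)"] cs assms by simp
qed

lemma continuous_polar:
  fixes S :: "'b::t2_space set"
  assumes "continuous_on S g" "continuous_on S h"
  shows "continuous_on S (\<lambda>x. \<phi> (rcis (g x) (h x)))" "continuous_on S (\<lambda>x. polar_r (g x) (h x))"
    "continuous_on S (\<lambda>x. polar_rr (g x) (h x))" "continuous_on S (\<lambda>x. polar_t (g x) (h x))"
    "continuous_on S (\<lambda>x. polar_tt (g x) (h x))" "continuous_on S (\<lambda>x. laplacian \<phi> (rcis (g x) (h x)))"
proof -
  have c: "continuous_on S (\<lambda>x. \<psi> (rcis (g x) (h x)))" if "smooth_plane \<psi>" for \<psi>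
    by (rule continuous_on_compose2[OF smooth_plane_continuous_on[OF that, of UNIV] continuous_on_rcis[OF assms]]) auto
  note [continuous_intros] = continuous_on_cos[OF assms(2)] continuous_on_sin[OF assms(2)] c[OF smooth] c[OF smooth_partial(1)] c[OF smooth_partial(2)] c[OF smooth_partial_partial(1)] c[OF smooth_partial_partial(2)] c[OF smooth_partial_partial(3)] c[OF smooth_partial_partial(4)]
  show "continuous_on S (\<lambda>x. \<phi> (rcis (g x) (h x)))" "continuous_on S (\<lambda>x. polar_r (g x) (h x))"
    "continuous_on S (\<lambda>x. polar_rr (g x) (h x))" "continuous_on S (\<lambda>x. polar_t (g x) (h x))"
    "continuous_on S (\<lambda>x. polar_tt (g x) (h x))" "continuous_on S (\<lambda>x. laplacian \<phi> (rcis (g x) (h x)))"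
    unfolding polar_r_def polar_rr_def polar_t_def polar_tt_def laplacian_def Basis_complex_def
    using assms by (auto intro!: continuous_intros)
qed

lemma continuous_laplacian: "continuous_on S (laplacian \<phi>)"
  unfolding laplacian_def[abs_def] Basis_complex_def
  using smooth_plane_continuous_on[OF smooth_partial_partial(1)] smooth_plane_continuous_on[OF smooth_partial_partial(4)]
  by (auto intro!: continuous_intros)

text \<open>Two integrations by parts; the boundary terms cancel because the integrands are periodic.\<close>

lemma angular_fourier:
  "integral {0..2*pi} (\<lambda>\<theta>. polar_tt r \<theta> * circle_exp m \<theta>) = - of_real ((real_of_int m)\<^sup>2) * integral {0..2*pi} (\<lambda>\<theta>. \<phi> (rcis r \<theta>) * circle_exp m \<theta>)"
proof -
  have rc: "rcis r (2 * pi) = rcis r 0" by (simp add: rcis_def)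
  have pt: "polar_t r (2 * pi) = polar_t r 0" by (simp add: polar_t_def rc)
  have int: "(\<lambda>\<theta>. \<phi> (rcis r \<theta>) * circle_exp m \<theta>) integrable_on {0..2*pi}"
    by (intro integrable_continuous_real continuous_intros continuous_polar)
  have 1: "((\<lambda>\<theta>. polar_t r \<theta> * (\<i> * of_int m * circle_exp m \<theta>) + polar_tt r \<theta> * circle_exp m \<theta>) has_integral
      polar_t r (2 * pi) * circle_exp m (2 * pi) - polar_t r 0 * circle_exp m 0) {0..2*pi}"
    by (rule fundamental_theorem_of_calculus)
       (simp, rule has_vector_derivative_mult[OF has_vector_derivative_polar_tt has_vector_derivative_circle_exp])
  have 2: "((\<lambda>\<theta>. \<phi> (rcis r \<theta>) * (\<i> * of_int m * circle_exp m \<theta>) + polar_t r \<theta> * circle_exp m \<theta>) has_integral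
      \<phi> (rcis r (2 * pi)) * circle_exp m (2 * pi) - \<phi> (rcis r 0) * circle_exp m 0) {0..2*pi}"
    by (rule fundamental_theorem_of_calculus)
       (simp, rule has_vector_derivative_mult[OF has_vector_derivative_polar_t has_vector_derivative_circle_exp])
  have 3: "((\<lambda>\<theta>. \<i> * of_int m * (\<phi> (rcis r \<theta>) * (\<i> * of_int m * circle_exp m \<theta>) + polar_t r \<theta> * circle_exp m \<theta>)) has_integral
      \<i> * of_int m * (\<phi> (rcis r (2 * pi)) * circle_exp m (2 * pi) - \<phi> (rcis r 0) * circle_exp m 0)) {0..2*pi}"
    by (rule has_integral_mult_right[OF 2])
  have 4: "((\<lambda>\<theta>. - of_real ((real_of_int m)\<^sup>2) * (\<phi> (rcis r \<theta>) * circle_exp m \<theta>)) has_integral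
      - of_real ((real_of_int m)\<^sup>2) * integral {0..2*pi} (\<lambda>\<theta>. \<phi> (rcis r \<theta>) * circle_exp m \<theta>)) {0..2*pi}"
    by (rule has_integral_mult_right[OF integrable_integral[OF int]])
  have e: "polar_t r \<theta> * (\<i> * of_int m * circle_exp m \<theta>) + polar_tt r \<theta> * circle_exp m \<theta>
      - \<i> * of_int m * (\<phi> (rcis r \<theta>) * (\<i> * of_int m * circle_exp m \<theta>) + polar_t r \<theta> * circle_exp m \<theta>)
      + - of_real ((real_of_int m)\<^sup>2) * (\<phi> (rcis r \<theta>) * circle_exp m \<theta>) = polar_tt r \<theta> * circle_exp m \<theta>" for \<theta>
    by (simp add: algebra_simps power2_eq_square)
  have "((\<lambda>\<theta>. polar_tt r \<theta> * circle_exp m \<theta>) has_integral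
     - of_real ((real_of_int m)\<^sup>2) * integral {0..2*pi} (\<lambda>\<theta>. \<phi> (rcis r \<theta>) * circle_exp m \<theta>)) {0..2*pi}"
    using has_integral_add[OF has_integral_diff[OF 1 3] 4] unfolding e by (simp add: rc pt)
  then show ?thesis by (rule integral_unique)
qed

text \<open>Angular Fourier coefficients of \<open>\<phi>\<close>, of its first two radial derivatives and of its Laplacian. The exponent
has the sign of the mode against which \<open>\<phi>\<close> is integrated.\<close>

definition mode_int :: "int \<Rightarrow> real \<Rightarrow> complex" where
  "mode_int m r = integral {0..2*pi} (\<lambda>\<theta>. \<phi> (rcis r \<theta>) * circle_exp m \<theta>)"
definition mode_int' :: "int \<Rightarrow> real \<Rightarrow> complex" where
  "mode_int' m r = integral {0..2*pi} (\<lambda>\<theta>. polar_r r \<theta> * circle_exp m \<theta>)"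
definition mode_int'' :: "int \<Rightarrow> real \<Rightarrow> complex" where
  "mode_int'' m r = integral {0..2*pi} (\<lambda>\<theta>. polar_rr r \<theta> * circle_exp m \<theta>)"
definition mode_lap :: "int \<Rightarrow> real \<Rightarrow> complex" where
  "mode_lap m r = integral {0..2*pi} (\<lambda>\<theta>. laplacian \<phi> (rcis r \<theta>) * circle_exp m \<theta>)"

lemma mode_int_derivs:
  "(mode_int m has_vector_derivative mode_int' m r) (at r within {0..1})"
  "(mode_int' m has_vector_derivative mode_int'' m r) (at r within {0..1})" if "r \<in> {0..1}"
proof -
  have ce: "continuous_on S (\<lambda>x. circle_exp m (h x))" if "continuous_on S h" for S and h :: "real \<times> real \<Rightarrow> real"
    by (rule continuous_on_compose2[OF continuous_on_circle_exp that]) auto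
  show "(mode_int m has_vector_derivative mode_int' m r) (at r within {0..1})"
    unfolding mode_int_def[abs_def] mode_int'_def cbox_interval[symmetric]
  proof (rule leibniz_rule_vector_derivative)
    show "((\<lambda>x. \<phi> (rcis x t) * circle_exp m t) has_vector_derivative polar_r x t * circle_exp m t) (at x within cbox 0 1)" for x t
      by (intro has_vector_derivative_mult_left has_vector_derivative_polar_r)
    show "(\<lambda>\<theta>. \<phi> (rcis x \<theta>) * circle_exp m \<theta>) integrable_on cbox 0 (2 * pi)" for x
      by (intro integrable_continuous continuous_intros continuous_polar)
    show "continuous_on (cbox 0 1 \<times> cbox 0 (2 * pi)) (\<lambda>(x, t). polar_r x t * circle_exp m t)"
      unfolding case_prod_beta by (intro continuous_intros continuous_polar ce)
  qed (use that in auto)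
  show "(mode_int' m has_vector_derivative mode_int'' m r) (at r within {0..1})"
    unfolding mode_int'_def[abs_def] mode_int''_def cbox_interval[symmetric]
  proof (rule leibniz_rule_vector_derivative)
    show "((\<lambda>x. polar_r x t * circle_exp m t) has_vector_derivative polar_rr x t * circle_exp m t) (at x within cbox 0 1)" for x t
      by (intro has_vector_derivative_mult_left has_vector_derivative_polar_rr)
    show "(\<lambda>\<theta>. polar_r x \<theta> * circle_exp m \<theta>) integrable_on cbox 0 (2 * pi)" for x
      by (intro integrable_continuous continuous_intros continuous_polar)
    show "continuous_on (cbox 0 1 \<times> cbox 0 (2 * pi)) (\<lambda>(x, t). polar_rr x t * circle_exp m t)"
      unfolding case_prod_beta by (intro continuous_intros continuous_polar ce)
  qed (use that in auto)
qed

lemma mode_lap_eq: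
  assumes r: "r > 0"
  shows "mode_lap m r = mode_int'' m r + mode_int' m r / of_real r - of_real ((real_of_int m)\<^sup>2 / r\<^sup>2) * mode_int m r"
proof -
  have i: "((\<lambda>\<theta>. polar_rr r \<theta> * circle_exp m \<theta>) has_integral mode_int'' m r) {0..2*pi}"
    "((\<lambda>\<theta>. polar_r r \<theta> * circle_exp m \<theta>) has_integral mode_int' m r) {0..2*pi}"
    "((\<lambda>\<theta>. polar_tt r \<theta> * circle_exp m \<theta>) has_integral - of_real ((real_of_int m)\<^sup>2) * mode_int m r) {0..2*pi}"
    unfolding mode_int''_def mode_int'_def mode_int_def angular_fourier[symmetric]
    by (intro integrable_integral integrable_continuous_real continuous_intros continuous_polar)+
  have "((\<lambda>\<theta>. polar_rr r \<theta> * circle_exp m \<theta> + (1 / of_real r) * (polar_r r \<theta> * circle_exp m \<theta>) + (1 / of_real (r\<^sup>2)) * (polar_tt r \<theta> * circle_exp m \<theta>))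
      has_integral mode_int'' m r + (1 / of_real r) * mode_int' m r + (1 / of_real (r\<^sup>2)) * (- of_real ((real_of_int m)\<^sup>2) * mode_int m r)) {0..2*pi}"
    by (intro has_integral_add has_integral_mult_right i)
  moreover have "polar_rr r \<theta> * circle_exp m \<theta> + (1 / of_real r) * (polar_r r \<theta> * circle_exp m \<theta>) + (1 / of_real (r\<^sup>2)) * (polar_tt r \<theta> * circle_exp m \<theta>)
      = laplacian \<phi> (rcis r \<theta>) * circle_exp m \<theta>" for \<theta>
    unfolding polar_laplacian[OF r] by (simp add: ring_distribs)
  ultimately have "mode_lap m r = mode_int'' m r + (1 / of_real r) * mode_int' m r + (1 / of_real (r\<^sup>2)) * (- of_real ((real_of_int m)\<^sup>2) * mode_int m r)"
    unfolding mode_lap_def by (intro integral_unique) simp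
  then show ?thesis by simp
qed

end

section \<open>The weak equation for a single mode\<close>

locale disk_test = smooth_function +
  fixes K :: "complex set"
  assumes K: "compact K" "K \<subseteq> ball 0 1" and zero: "\<And>z. z \<notin> K \<Longrightarrow> \<phi> z = 0"
begin

lemma partial_zero:
  assumes "z \<notin> K" "\<And>w. w \<notin> K \<Longrightarrow> \<psi> w = 0"
  shows "partial b \<psi> z = 0"
proof -
  have "open (- K)" using K(1) by (simp add: compact_imp_closed open_Compl)
  then have "(\<psi> has_derivative (\<lambda>_. 0)) (at z)"
    by (rule has_derivative_transform_within_open[OF has_derivative_const[of 0]]) (use assms in auto)
  then show ?thesis
    unfolding partial_def using frechet_derivative_at by metis
qed

lemma laplacian_zero: "z \<notin> K \<Longrightarrow> laplacian \<phi> z = 0"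
  unfolding laplacian_def using zero by (intro sum.neutral ballI partial_zero) auto

lemma mode_int_boundary: "mode_int m 1 = 0" "mode_int' m 1 = 0"
proof -
  have "rcis 1 \<theta> \<notin> K" for \<theta> using K(2) by (auto simp: subset_iff)
  then have "\<phi> (rcis 1 \<theta>) = 0" "polar_r 1 \<theta> = 0" for \<theta>
    unfolding polar_r_def using zero by (auto simp: partial_zero)
  then show "mode_int m 1 = 0" "mode_int' m 1 = 0" by (simp_all add: mode_int_def mode_int'_def)
qed

end

lemma integral_lborel_angle:
  fixes g :: "real \<Rightarrow> complex"
  assumes "continuous_on {0..2*pi} g"
  shows "(\<integral>\<theta>. indicator {0..<2*pi} \<theta> *\<^sub>R g \<theta> \<partial>lborel) = integral {0..2*pi} g"
proof -
  have si: "set_integrable lborel {0..2*pi} g"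
    by (rule borel_integrable_atLeastAtMost'[OF assms])
  have si': "set_integrable lborel {0..<2*pi} g"
    by (rule set_integrable_subset[OF si]) auto
  have "AE \<theta> in lborel. \<theta> \<noteq> 2 * pi" by (rule AE_lborel_singleton)
  then have "(\<integral>\<theta>. indicator {0..<2*pi} \<theta> *\<^sub>R g \<theta> \<partial>lborel) = (\<integral>\<theta>. indicator {0..2*pi} \<theta> *\<^sub>R g \<theta> \<partial>lborel)"
    using si si' unfolding set_integrable_def
    by (intro integral_cong_AE borel_measurable_integrable) (auto elim!: eventually_mono simp: indicator_def)
  also have "\<dots> = integral {0..2*pi} g"
    using set_borel_integral_eq_integral(2)[OF si] by (simp add: set_lebesgue_integral_def)
  finally show ?thesis .
qed

locale mode_test = radial_ode V "nat \<bar>mi\<bar>" y y' N + disk_test \<phi> K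
  for V mi y y' N \<phi> K
begin

text \<open>For \<open>p = mode_int mi\<close> the function \<open>z = sqrt r * p\<close> satisfies \<open>z'' + z / (4 r\<^sup>2) = sqrt r * (p'' + p' / r)\<close>.
This is the substitution that takes the first derivative out of the radial Laplacian, so by \<open>mode_lap_eq\<close>
Green's identity for \<open>y\<close> and \<open>z\<close> contains only \<open>V * p - mode_lap mi\<close>. At \<open>r = 1\<close> both \<open>z\<close> and \<open>z'\<close> are \<open>0\<close>.\<close>

lemma green_mode:
  assumes a: "0 < a" "a \<le> 1"
  shows "((\<lambda>r. y r * of_real (sqrt r) * (V r * mode_int mi r - mode_lap mi r)) has_integral
     of_real (sqrt a) * y a * mode_int' mi a - (of_real (sqrt a) * y' a - y a / (2 * of_real (sqrt a))) * mode_int mi a) {a..1}"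
proof -
  define z where "z r = of_real (sqrt r) * mode_int mi r" for r
  define z' where "z' r = of_real (sqrt r) * mode_int' mi r + of_real (1 / (2 * sqrt r)) * mode_int mi r" for r
  define z'' where "z'' r = (of_real (sqrt r) * mode_int'' mi r + of_real (1 / (2 * sqrt r)) * mode_int' mi r)
      + (of_real (1 / (2 * sqrt r)) * mode_int' mi r + of_real (- 1 / (4 * (r * sqrt r))) * mode_int mi r)" for r
  have sub: "(mode_int mi has_vector_derivative mode_int' mi r) (at r within {a..1})"
    "(mode_int' mi has_vector_derivative mode_int'' mi r) (at r within {a..1})" if "r \<in> {a..1}" for r
    using has_vector_derivative_within_subset[OF mode_int_derivs(1), of r "{a..1}"]
      has_vector_derivative_within_subset[OF mode_int_derivs(2), of r "{a..1}"] that a by auto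
  have d1: "((\<lambda>r. complex_of_real (sqrt r)) has_vector_derivative of_real (1 / (2 * sqrt r))) (at r within S)"
    and d2: "((\<lambda>r. complex_of_real (1 / (2 * sqrt r))) has_vector_derivative of_real (- 1 / (4 * (r * sqrt r)))) (at r within S)"
    if "r > 0" for r S
  proof -
    have "(sqrt has_real_derivative 1 / (2 * sqrt r)) (at r within S)"
      using that by (auto intro!: derivative_eq_intros simp: field_simps)
    then show "((\<lambda>r. complex_of_real (sqrt r)) has_vector_derivative of_real (1 / (2 * sqrt r))) (at r within S)"
      by (rule has_vector_derivative_of_real)
    have "((\<lambda>r. 1 / (2 * sqrt r)) has_real_derivative - 1 / (4 * (r * sqrt r))) (at r within S)"
      using that by (auto intro!: derivative_eq_intros simp: field_simps)
    then show "((\<lambda>r. complex_of_real (1 / (2 * sqrt r))) has_vector_derivative of_real (- 1 / (4 * (r * sqrt r)))) (at r within S)"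
      by (rule has_vector_derivative_of_real)
  qed
  have dz: "(z has_vector_derivative z' r) (at r within {a..1})" if "r \<in> {a..1}" for r
    unfolding z_def[abs_def] z'_def using that a by (intro has_vector_derivative_mult d1 sub) auto
  have dz': "(z' has_vector_derivative z'' r) (at r within {a..1})" if "r \<in> {a..1}" for r
    unfolding z'_def[abs_def] z''_def using that a
    by (intro has_vector_derivative_add has_vector_derivative_mult d1 d2 sub) auto
  have "((\<lambda>r. of_real (((real (nat \<bar>mi\<bar>))\<^sup>2 - 1/4) / r\<^sup>2) * y r * z r + V r * y r * z r - y r * z'' r) has_integral
           ((y' 1 * z 1 - y 1 * z' 1) - (y' a * z a - y a * z' a))) {a..1}"
    by (rule green_identity) (use a dz dz' in auto)
  moreover have "z 1 = 0" "z' 1 = 0" by (simp_all add: z_def z'_def mode_int_boundary)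
  moreover have "- (y' a * z a - y a * z' a) = of_real (sqrt a) * y a * mode_int' mi a - (of_real (sqrt a) * y' a - y a / (2 * of_real (sqrt a))) * mode_int mi a"
    by (simp add: z_def z'_def algebra_simps)
  ultimately have "((\<lambda>r. of_real (((real (nat \<bar>mi\<bar>))\<^sup>2 - 1/4) / r\<^sup>2) * y r * z r + V r * y r * z r - y r * z'' r) has_integral
      of_real (sqrt a) * y a * mode_int' mi a - (of_real (sqrt a) * y' a - y a / (2 * of_real (sqrt a))) * mode_int mi a) {a..1}"
    by simp
  then show ?thesis
  proof (rule has_integral_eq[rotated])
    fix r assume "r \<in> {a..1}"
    then have r: "r > 0" using a by auto
    have n: "(real (nat \<bar>mi\<bar>))\<^sup>2 = (real_of_int mi)\<^sup>2" by simp
    \<comment> \<open>The integrands agree as rational functions of \<open>s = sqrt r\<close>; \<open>poly\<close> clears the denominators.\<close>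
    have alg: "(M - 1/4) / (s ^ 4) * Y * (s * P) + v * Y * (s * P) - Y * ((s * P2 + 1 / (2 * s) * P1) + (1 / (2 * s) * P1 + (- 1) / (4 * (s\<^sup>2 * s)) * P))
      = Y * s * (v * P - (P2 + P1 / s\<^sup>2 - M / s ^ 4 * P))" if "s \<noteq> 0" for M s Y P v P1 P2 :: complex
    proof -
      have poly: "(M - q) * i ^ 4 * Y * (s * P) + v * Y * (s * P) - Y * ((s * P2 + h * i * P1) + (h * i * P1 - q * i ^ 3 * P))
        = Y * s * (v * P - (P2 + P1 * i ^ 2 - M * i ^ 4 * P))" if "s * i = 1" "h + h = 1" for i h q :: complex
        using that by algebra
      show ?thesis
        using poly[of "1 / s" "1 / 2" "1 / 4"] that
        by (simp add: power_one_over power3_eq_cube power2_eq_square[of s] mult.assoc)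
    qed
    have s: "complex_of_real (sqrt r) \<noteq> 0" "complex_of_real r = (of_real (sqrt r))\<^sup>2"
      using r by (simp_all flip: of_real_power)
    have s4: "(complex_of_real r)\<^sup>2 = (of_real (sqrt r)) ^ 4" unfolding s(2) by simp
    show "of_real (((real (nat \<bar>mi\<bar>))\<^sup>2 - 1/4) / r\<^sup>2) * y r * z r + V r * y r * z r - y r * z'' r
       = y r * of_real (sqrt r) * (V r * mode_int mi r - mode_lap mi r)"
      unfolding mode_lap_eq[OF r] n z_def z''_def
      using alg[OF s(1), of "of_real ((real_of_int mi)\<^sup>2)" "y r" "mode_int mi r" "V r" "mode_int'' mi r" "mode_int' mi r"]
      by (simp add: s4[symmetric] s(2)[symmetric])
  qed
qed

text \<open>Let \<open>a \<rightarrow> 0\<close> in \<open>green_mode\<close>: the boundary term vanishes by \<open>tendsto_sqrt_y\<close> and \<open>tendsto_sqrt_y'\<close>.\<close>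

lemma integral_mode_eq_zero:
  assumes "(\<lambda>r. y r * of_real (sqrt r) * (V r * mode_int mi r - mode_lap mi r)) integrable_on {0..1}"
  shows "integral {0..1} (\<lambda>r. y r * of_real (sqrt r) * (V r * mode_int mi r - mode_lap mi r)) = 0"
proof -
  let ?G = "\<lambda>r. y r * of_real (sqrt r) * (V r * mode_int mi r - mode_lap mi r)"
  have "continuous_on {0..1} (mode_int mi)" "continuous_on {0..1} (mode_int' mi)"
    using mode_int_derivs has_vector_derivative_continuous unfolding continuous_on_eq_continuous_within by blast+
  then have p: "(mode_int mi \<longlongrightarrow> mode_int mi 0) (at_right 0)" "(mode_int' mi \<longlongrightarrow> mode_int' mi 0) (at_right 0)"
    by (auto simp: continuous_on_def at_within_Icc_at_right dest!: bspec[of _ _ 0])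
  let ?T = "\<lambda>a. of_real (sqrt a) * y a * mode_int' mi a - (of_real (sqrt a) * y' a - y a / (2 * of_real (sqrt a))) * mode_int mi a"
  have "(?T \<longlongrightarrow> 0 * mode_int' mi 0 - 0 * mode_int mi 0) (at_right 0)"
    by (intro tendsto_intros p tendsto_sqrt_y tendsto_sqrt_y')
  moreover have "\<forall>\<^sub>F a in at_right 0. ?T a = integral {a..1} ?G"
    using eventually_at_right_real[of 0 1]
    by (auto elim!: eventually_mono intro!: integral_unique[symmetric] green_mode)
  ultimately have "((\<lambda>a. integral {a..1} ?G) \<longlongrightarrow> 0) (at_right 0)"
    using Lim_transform_eventually by fastforce
  moreover have "((\<lambda>a. integral {a..1} ?G) \<longlongrightarrow> integral {0..1} ?G) (at_right 0)"
    using indefinite_integral_continuous_1'[OF assms] by (auto simp: continuous_on_def at_within_Icc_at_right dest!: bspec[of _ _ 0])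
  ultimately show ?thesis
    using tendsto_unique[OF trivial_limit_at_right_real] by blast
qed

text \<open>In polar coordinates the angular integral produces the Fourier coefficients of \<open>\<phi>\<close> and of its Laplacian,
and \<open>r * (\<alpha> r * r^\<bar>mi\<bar>) = y r * sqrt r\<close> identifies what is left with the integral of \<open>integral_mode_eq_zero\<close>.\<close>

theorem weak_equation_mode:
  assumes "integrable lborel (\<lambda>z. indicator (ball 0 1) z *\<^sub>R (alpha (\<lambda>_. y) (nat \<bar>mi\<bar>) (cmod z) * disk_power mi z * (V (cmod z) * \<phi> z - laplacian \<phi> z)))"
  shows "integral\<^sup>L lborel (\<lambda>z. indicator (ball 0 1) z *\<^sub>R (alpha (\<lambda>_. y) (nat \<bar>mi\<bar>) (cmod z) * disk_power mi z * (V (cmod z) * \<phi> z - laplacian \<phi> z))) = 0"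
proof -
  let ?F = "\<lambda>z. indicator (ball 0 1) z *\<^sub>R (alpha (\<lambda>_. y) (nat \<bar>mi\<bar>) (cmod z) * disk_power mi z * (V (cmod z) * \<phi> z - laplacian \<phi> z))"
  let ?G = "\<lambda>r. y r * of_real (sqrt r) * (V r * mode_int mi r - mode_lap mi r)"
  let ?H = "\<lambda>r. (r * indicator {0..} r) *\<^sub>R (\<integral>\<theta>. indicator {0..<2*pi} \<theta> *\<^sub>R ?F (rcis r \<theta>) \<partial>lborel)"
  have H0: "?H r = 0" if "r \<notin> {0<..<1}" for r
    using that by (auto simp: indicator_def)
  have HG: "?H r = ?G r" if r: "r \<in> {0<..<1}" for r
  proof -
    have F: "?F (rcis r \<theta>) = alpha (\<lambda>_. y) (nat \<bar>mi\<bar>) r * of_real r ^ nat \<bar>mi\<bar> *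
        (V r * (\<phi> (rcis r \<theta>) * circle_exp mi \<theta>) - laplacian \<phi> (rcis r \<theta>) * circle_exp mi \<theta>)" for \<theta>
      using r by (simp add: disk_power_rcis algebra_simps)
    have i: "(\<lambda>\<theta>. \<phi> (rcis r \<theta>) * circle_exp mi \<theta>) integrable_on {0..2*pi}" "(\<lambda>\<theta>. laplacian \<phi> (rcis r \<theta>) * circle_exp mi \<theta>) integrable_on {0..2*pi}"
      by (intro integrable_continuous_real continuous_intros continuous_polar)+
    have "(\<integral>\<theta>. indicator {0..<2*pi} \<theta> *\<^sub>R ?F (rcis r \<theta>) \<partial>lborel) = integral {0..2*pi} (\<lambda>\<theta>. ?F (rcis r \<theta>))"
      unfolding F by (intro integral_lborel_angle continuous_intros continuous_polar)
    also have "\<dots> = alpha (\<lambda>_. y) (nat \<bar>mi\<bar>) r * of_real r ^ nat \<bar>mi\<bar> * (V r * mode_int mi r - mode_lap mi r)"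
      unfolding F mode_int_def mode_lap_def integral_mult_right
      by (rule arg_cong, rule integral_unique)
         (intro has_integral_diff has_integral_mult_right integrable_integral i)
    finally have "?H r = of_real r * (alpha (\<lambda>_. y) (nat \<bar>mi\<bar>) r * of_real r ^ nat \<bar>mi\<bar>) * (V r * mode_int mi r - mode_lap mi r)"
      using r by (simp add: scaleR_conv_of_real mult.assoc)
    moreover have "of_real r * (alpha (\<lambda>_. y) (nat \<bar>mi\<bar>) r * of_real r ^ nat \<bar>mi\<bar>) = y r * of_real (sqrt r)"
    proof -
      have "r powr (real (nat \<bar>mi\<bar>) + 1/2) * sqrt r = r ^ nat \<bar>mi\<bar> * r"
      proof -
        have "r powr (real n + 1/2) * sqrt r = r ^ n * r" for n
          using r by (simp add: powr_add powr_realpow powr_half_sqrt mult.assoc)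
        then show ?thesis .
      qed
      then have "complex_of_real (r powr (real (nat \<bar>mi\<bar>) + 1/2)) * of_real (sqrt r) = of_real r ^ nat \<bar>mi\<bar> * of_real r"
        by (metis of_real_mult of_real_power)
      then show ?thesis using r by (simp add: y_eq_alpha[of r] mult_ac)
    qed
    ultimately show ?thesis by simp
  qed
  have "(?H has_integral (\<integral>r. ?H r \<partial>lborel)) UNIV"
    by (rule has_integral_integral_lborel[OF integral_polar(1)[OF assms]])
  moreover have "?H = (\<lambda>r. if r \<in> {0..1} then ?H r else 0)"
  proof
    fix r :: real
    show "?H r = (if r \<in> {0..1} then ?H r else 0)"
      using H0[of r] by (cases "r \<in> {0..1}") auto
  qed
  ultimately have "(?H has_integral (\<integral>r. ?H r \<partial>lborel)) {0..1}"
    using has_integral_restrict_UNIV[of "{0..1}" ?H] by simp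
  then have G: "(?G has_integral (\<integral>r. ?H r \<partial>lborel)) {0..1}"
    by (rule has_integral_spike_finite[of "{0, 1}", rotated 2]) (use HG in auto)
  have "(\<integral>r. ?H r \<partial>lborel) = 0"
    by (rule trans[OF integral_unique[OF G, symmetric] integral_mode_eq_zero[OF has_integral_integrable[OF G]]])
  then show ?thesis unfolding integral_polar(2)[OF assms] .
qed

end

section \<open>The weak equation for the series\<close>

text \<open>Fubini's theorem calls for a Borel measurable potential; the passage from a Lebesgue measurable one is made
at the end.\<close>

locale weak_setup = radial_series y K f + disk_test \<phi> S
  for y K f \<phi> S +
  fixes V :: "real \<Rightarrow> complex"
  assumes V_borel [measurable]: "V \<in> borel_measurable borel"
    and V_int: "integrable lborel (\<lambda>z::complex. indicator (ball 0 1) z *\<^sub>R V (cmod z))"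
    and sol: "\<And>m. radial_solution V m (y m)"
begin

abbreviation (input) op_test :: "complex \<Rightarrow> complex" where
  "op_test z \<equiv> V (cmod z) * \<phi> z - laplacian \<phi> z"

abbreviation (input) tested :: "(complex \<Rightarrow> complex) \<Rightarrow> complex \<Rightarrow> complex" where
  "tested c z \<equiv> indicator (ball 0 1) z *\<^sub>R (c z * op_test z)"

lemma test_measurable [measurable]: "\<phi> \<in> borel_measurable borel" "laplacian \<phi> \<in> borel_measurable borel"
  using smooth_plane_continuous_on[OF smooth] continuous_laplacian by (auto intro: borel_measurable_continuous_onI)

lemma bounded_on_support:
  assumes "continuous_on (ball 0 1) c"
  obtains B where "B \<ge> 0" "\<And>z. z \<in> S \<Longrightarrow> cmod (c z) \<le> B"
proof -
  have "bounded (c ` S)"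
    using compact_imp_bounded[OF compact_continuous_image[OF continuous_on_subset[OF assms K(2)] K(1)]] .
  then obtain B where "\<forall>x\<in>c ` S. cmod x \<le> B" unfolding bounded_iff by blast
  then show ?thesis by (intro that[of "max B 0"]) (auto simp: le_max_iff_disj)
qed

text \<open>The factor \<open>c\<close> may be unbounded near the unit circle, but it is bounded on the support of \<open>\<phi>\<close>.\<close>

lemma integrable_test:
  assumes c: "continuous_on (ball 0 1) c"
  shows "integrable lborel (\<lambda>z. indicator (ball 0 1) z *\<^sub>R (c z * (V (cmod z) * \<phi> z)))"
    and "integrable lborel (\<lambda>z. indicator (ball 0 1) z *\<^sub>R (c z * laplacian \<phi> z))"
proof -
  obtain B where B: "B \<ge> 0" "\<And>z. z \<in> S \<Longrightarrow> cmod (c z) \<le> B" using bounded_on_support[OF c] by blast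
  obtain B1 where B1: "B1 \<ge> 0" "\<And>z. z \<in> S \<Longrightarrow> cmod (\<phi> z) \<le> B1"
    using bounded_on_support[OF smooth_plane_continuous_on[OF smooth]] by blast
  obtain B2 where B2: "B2 \<ge> 0" "\<And>z. z \<in> S \<Longrightarrow> cmod (laplacian \<phi> z) \<le> B2"
    using bounded_on_support[OF continuous_laplacian] by blast
  have [measurable]: "(\<lambda>z. indicator (ball 0 1) z *\<^sub>R c z) \<in> borel_measurable borel"
    by (rule borel_measurable_continuous_on_indicator[OF _ c]) simp
  have m: "(\<lambda>z. (indicator (ball 0 1) z *\<^sub>R c z) * (V (cmod z) * \<phi> z)) \<in> borel_measurable borel"
     "(\<lambda>z. (indicator (ball 0 1) z *\<^sub>R c z) * laplacian \<phi> z) \<in> borel_measurable borel" by measurable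
  have d1: "integrable lborel (\<lambda>z::complex. (B * B1) *\<^sub>R (indicator (ball 0 1) z *\<^sub>R V (cmod z)))"
    using V_int by (rule integrable_scaleR_right)
  show "integrable lborel (\<lambda>z. indicator (ball 0 1) z *\<^sub>R (c z * (V (cmod z) * \<phi> z)))"
  proof (rule Bochner_Integration.integrable_bound[OF d1])
    show "(\<lambda>z. indicator (ball 0 1) z *\<^sub>R (c z * (V (cmod z) * \<phi> z))) \<in> borel_measurable lborel"
      using m(1) by simp
    have "norm (indicator (ball 0 1) z *\<^sub>R (c z * (V (cmod z) * \<phi> z))) \<le> norm ((B * B1) *\<^sub>R (indicator (ball 0 1) z *\<^sub>R V (cmod z)))" for z
    proof (cases "z \<in> S")
      case True
      have "cmod (c z) * (cmod (V (cmod z)) * cmod (\<phi> z)) \<le> B * (cmod (V (cmod z)) * B1)"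
        using B B1 True by (intro mult_mono) auto
      then show ?thesis using True K(2) B(1) B1(1) by (auto simp: norm_mult mult_ac)
    next
      case False
      then show ?thesis using zero by simp
    qed
    then show "AE z in lborel. norm (indicator (ball 0 1) z *\<^sub>R (c z * (V (cmod z) * \<phi> z))) \<le> norm ((B * B1) *\<^sub>R (indicator (ball 0 1) z *\<^sub>R V (cmod z)))"
      by simp
  qed
  have d2: "integrable lborel (\<lambda>z::complex. (B * B2) *\<^sub>R (indicator (ball 0 1) z :: real))"
    by (intro integrable_scaleR_right integrable_real_indicator)
       (use emeasure_bounded_finite[OF bounded_ball[of "0::complex" 1]] in auto)
  show "integrable lborel (\<lambda>z. indicator (ball 0 1) z *\<^sub>R (c z * laplacian \<phi> z))"
  proof (rule Bochner_Integration.integrable_bound[OF d2])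
    show "(\<lambda>z. indicator (ball 0 1) z *\<^sub>R (c z * laplacian \<phi> z)) \<in> borel_measurable lborel"
      using m(2) by simp
    have "norm (indicator (ball 0 1) z *\<^sub>R (c z * laplacian \<phi> z)) \<le> norm ((B * B2) *\<^sub>R (indicator (ball 0 1) z :: real))" for z
    proof (cases "z \<in> S")
      case True
      have "cmod (c z) * cmod (laplacian \<phi> z) \<le> B * B2"
        using B B2 True by (intro mult_mono) auto
      then show ?thesis using True K(2) B(1) B2(1) by (auto simp: norm_mult)
    next
      case False
      then show ?thesis using laplacian_zero by simp
    qed
    then show "AE z in lborel. norm (indicator (ball 0 1) z *\<^sub>R (c z * laplacian \<phi> z)) \<le> norm ((B * B2) *\<^sub>R (indicator (ball 0 1) z :: real))"
      by simp
  qed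
qed

lemma integrable_op_test:
  assumes c: "continuous_on (ball 0 1) c"
  shows "integrable lborel (\<lambda>z. tested c z)"
  using Bochner_Integration.integrable_diff[OF integrable_test[OF c]]
  by (simp add: right_diff_distrib scaleR_diff_right)

lemma weak_equation_radial_mode:
  "(\<integral>z. tested (radial_mode y m) z \<partial>lborel) = 0"
proof -
  let ?n = "nat \<bar>m\<bar>"
  obtain y' N where "radial_ode V ?n (y ?n) y' N"
    using radial_solution_imp_radial_ode[OF sol] by blast
  then interpret mode: mode_test V m "y ?n" y' N \<phi> S
    by (intro mode_test.intro disk_test_axioms)
  have al: "alpha (\<lambda>_. y ?n) ?n r = alpha y ?n r" for r by (simp add: alpha_def)
  have "continuous_on (ball 0 1) (\<lambda>z. alpha y ?n (cmod z) * disk_power m z)"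
    by (intro continuous_intros continuous_on_disk_power continuous_on_compose2[OF alpha_cont]) auto
  from integrable_op_test[OF this]
  have "(\<integral>z. indicator (ball 0 1) z *\<^sub>R (alpha y ?n (cmod z) * disk_power m z * op_test z) \<partial>lborel) = 0"
    using mode.weak_equation_mode unfolding al by blast
  note int0 = this
  have "(\<integral>z. tested (radial_mode y m) z \<partial>lborel)
     = (\<integral>z. (1 / alpha y ?n 1) * (indicator (ball 0 1) z *\<^sub>R (alpha y ?n (cmod z) * disk_power m z * op_test z)) \<partial>lborel)"
    by (rule Bochner_Integration.integral_cong) (auto simp: radial_mode_def)
  then show ?thesis unfolding integral_mult_right_zero int0 by simp
qed

lemma support_radius: obtains \<rho> where "0 \<le> \<rho>" "\<rho> < 1" "S \<subseteq> cball 0 \<rho>"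
proof (cases "S = {}")
  case True
  then show ?thesis by (intro that[of 0]) auto
next
  case False
  then obtain x where "x \<in> S" "\<And>y. y \<in> S \<Longrightarrow> cmod y \<le> cmod x"
    using continuous_attains_sup[OF K(1) False continuous_on_norm_id] by blast
  then show ?thesis using K(2) by (intro that[of "cmod x"]) auto
qed

text \<open>The partial sums \<open>s F\<close> satisfy the equation by \<open>weak_equation_radial_mode\<close>, and they approximate
\<open>u_fun y f\<close> uniformly on the support of \<open>\<phi>\<close>. So the integral is at most \<open>\<epsilon> * D\<close> for every positive \<open>\<epsilon>\<close>.\<close>

theorem weak_equation_u_fun:
  "(\<integral>z. tested (u_fun y f) z \<partial>lborel) = 0" (is "?I = 0")
proof -
  define s where "s F z = (\<Sum>m\<in>F. fourier_coeff f m * radial_mode y m z)" for F z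
  have cm: "continuous_on (ball 0 1) (radial_mode y m)" for m
    by (rule continuous_on_subset[OF continuous_on_radial_mode]) auto
  have cs: "continuous_on (ball 0 1) (s F)" for F
    unfolding s_def[abs_def] by (intro continuous_intros cm)
  have s0: "(\<integral>z. tested (s F) z \<partial>lborel) = 0" for F
  proof -
    have "(\<integral>z. tested (s F) z \<partial>lborel)
      = (\<integral>z. (\<Sum>m\<in>F. fourier_coeff f m * (tested (radial_mode y m) z)) \<partial>lborel)"
      by (rule Bochner_Integration.integral_cong) (auto simp: s_def sum_distrib_right scaleR_sum_right mult.assoc)
    also have "\<dots> = (\<Sum>m\<in>F. \<integral>z. fourier_coeff f m * (tested (radial_mode y m) z) \<partial>lborel)"
      by (intro Bochner_Integration.integral_sum integrable_mult_right integrable_op_test cm)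
    also have "\<dots> = 0" unfolding integral_mult_right_zero weak_equation_radial_mode by simp
    finally show ?thesis .
  qed
  define D where "D = (\<integral>z. norm (tested (\<lambda>_. 1) z) \<partial>lborel)"
  have D0: "D \<ge> 0" unfolding D_def by (rule Bochner_Integration.integral_nonneg) simp
  have iD: "integrable lborel (\<lambda>z. norm (tested (\<lambda>_. 1) z))"
    using integrable_op_test[of "\<lambda>_. 1"] by (intro integrable_norm) simp
  obtain \<rho> where \<rho>: "0 \<le> \<rho>" "\<rho> < 1" "S \<subseteq> cball 0 \<rho>" by (rule support_radius) blast
  have bound: "cmod ?I \<le> \<epsilon> * D" if \<epsilon>: "\<epsilon> > 0" for \<epsilon>
  proof -
    have "\<forall>\<^sub>F F in finite_subsets_at_top UNIV. \<forall>z\<in>cball 0 \<rho>. dist (s F z) (u_fun y f z) < \<epsilon>"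
      unfolding s_def using uniform_limitD[OF uniform_limit_u_fun[OF \<rho>(1,2)] \<epsilon>] .
    then obtain F where F: "\<And>z. z \<in> cball 0 \<rho> \<Longrightarrow> dist (s F z) (u_fun y f z) < \<epsilon>"
      using eventually_happens'[OF finite_subsets_at_top_neq_bot] by blast
    have iu: "integrable lborel (\<lambda>z. tested (u_fun y f) z)"
      "integrable lborel (\<lambda>z. tested (s F) z)"
      "integrable lborel (\<lambda>z. tested (\<lambda>z. u_fun y f z - s F z) z)"
      by (intro integrable_op_test continuous_intros continuous_on_u_fun cs)+
    have "?I = ?I - (\<integral>z. tested (s F) z \<partial>lborel)" using s0 by simp
    also have "\<dots> = (\<integral>z. tested (u_fun y f) z - tested (s F) z \<partial>lborel)"
      by (rule Bochner_Integration.integral_diff[OF iu(1,2), symmetric])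
    also have "\<dots> = (\<integral>z. tested (\<lambda>z. u_fun y f z - s F z) z \<partial>lborel)"
      by (rule Bochner_Integration.integral_cong) (auto simp: algebra_simps)
    finally have eq: "?I = (\<integral>z. tested (\<lambda>z. u_fun y f z - s F z) z \<partial>lborel)" .
    have "cmod ?I \<le> (\<integral>z. \<epsilon> * norm (tested (\<lambda>_. 1) z) \<partial>lborel)"
      unfolding eq
    proof (rule order_trans[OF integral_norm_bound], rule integral_mono)
      show "integrable lborel (\<lambda>z. norm (tested (\<lambda>z. u_fun y f z - s F z) z))"
        using iu(3) by (rule integrable_norm)
      show "integrable lborel (\<lambda>z. \<epsilon> * norm (tested (\<lambda>_. 1) z))"
        by (rule integrable_mult_right[OF iD])
      fix z
      show "norm (tested (\<lambda>z. u_fun y f z - s F z) z) \<le> \<epsilon> * norm (tested (\<lambda>_. 1) z)"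
      proof (cases "z \<in> S")
        case True
        then have "cmod (u_fun y f z - s F z) \<le> \<epsilon>"
          using F[of z] \<rho>(3) by (auto simp: dist_norm norm_minus_commute less_imp_le)
        then have "cmod (u_fun y f z - s F z) * cmod (op_test z) \<le> \<epsilon> * cmod (op_test z)"
          by (rule mult_right_mono) simp
        then show ?thesis by (simp add: norm_mult indicator_def)
      next
        case False
        then show ?thesis using zero laplacian_zero by simp
      qed
    qed
    also have "\<dots> = \<epsilon> * D" unfolding D_def by (rule integral_mult_right_zero)
    finally show ?thesis .
  qed
  have "cmod ?I \<le> 0 + e" if "e > 0" for e
  proof -
    have "cmod ?I \<le> e / (D + 1) * D" by (rule bound) (use that D0 in simp)
    also have "\<dots> \<le> e" using that D0 by (simp add: divide_le_eq field_simps)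
    finally show ?thesis by simp
  qed
  then have "cmod ?I \<le> 0" by (rule field_le_epsilon)
  then show ?thesis by simp
qed

end

section \<open>From Borel to Lebesgue measurable potentials\<close>

lemma lebesgue_measurable_borel_version:
  fixes V :: "real \<Rightarrow> complex"
  assumes "V \<in> borel_measurable (lebesgue_on {0<..<1})"
  obtains V' where "V' \<in> borel_measurable borel" "AE r in lborel. r \<in> {0<..<1} \<longrightarrow> V r = V' r"
proof -
  define V0 where "V0 r = indicator {0<..<1} r *\<^sub>R V r" for r
  have V0: "V0 \<in> borel_measurable lebesgue"
    unfolding V0_def[abs_def] using assms by (subst (asm) borel_measurable_restrict_space_iff) auto
  then have "(\<lambda>r. Re (V0 r)) \<in> borel_measurable lebesgue" "(\<lambda>r. Im (V0 r)) \<in> borel_measurable lebesgue"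
    by measurable
  then obtain g h where g: "g \<in> borel_measurable lborel" "AE r in lborel. Re (V0 r) = g r"
    and h: "h \<in> borel_measurable lborel" "AE r in lborel. Im (V0 r) = h r"
    using completion_ex_borel_measurable_real by blast
  show ?thesis
  proof (rule that[of "\<lambda>r. of_real (g r) + \<i> * of_real (h r)"])
    show "(\<lambda>r. complex_of_real (g r) + \<i> * of_real (h r)) \<in> borel_measurable borel"
      using g(1) h(1) by simp
    show "AE r in lborel. r \<in> {0<..<1} \<longrightarrow> V r = of_real (g r) + \<i> * of_real (h r)"
      using g(2) h(2) by eventually_elim (auto simp: V0_def complex_eq_iff)
  qed
qed

text \<open>The image of Lebesgue measure under the modulus has a density, so preimages of null sets are null sets.\<close>

lemma AE_cmod:
  assumes "AE r in lborel. P r"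
  shows "AE z in (lborel :: complex measure). P (cmod z)"
proof -
  obtain N where N: "{r \<in> space lborel. \<not> P r} \<subseteq> N" "emeasure lborel N = 0" "N \<in> sets lborel"
    using assms by (rule AE_E) blast
  have [measurable]: "N \<in> sets borel" using N(3) by simp
  have pre: "cmod -` N \<in> sets borel"
    using measurable_sets[of cmod borel borel N] by simp
  have "emeasure lborel (cmod -` N) = (\<integral>\<^sup>+z. indicator (cmod -` N) z \<partial>lborel)"
    using pre by simp
  also have "\<dots> = (\<integral>\<^sup>+z. indicator N (cmod z) \<partial>lborel)"
    by (intro nn_integral_cong) (simp add: indicator_def)
  also have "\<dots> = (\<integral>\<^sup>+r. ennreal (2 * pi * r) * indicator {0..} r * indicator N r \<partial>lborel)"
    by (rule nn_integral_radial) measurable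
  also have "\<dots> = 0"
  proof (subst nn_integral_0_iff_AE)
    have "AE r in lborel. r \<notin> N" using N(2,3) by (intro AE_not_in) auto
    then show "AE r in lborel. ennreal (2 * pi * r) * indicator {0..} r * indicator N r = 0"
      by eventually_elim simp
  qed simp
  finally have "cmod -` N \<in> null_sets lborel"
    using pre by (auto intro!: null_setsI)
  then show ?thesis
    by (rule AE_I') (use N(1) in auto)
qed

lemma integrable_potential_on_disk:
  fixes V :: "real \<Rightarrow> complex"
  assumes [measurable]: "V \<in> borel_measurable borel"
    and i: "integrable lborel (\<lambda>r. indicator {0<..<1} r *\<^sub>R (r * cmod (V r)))"
  shows "integrable lborel (\<lambda>z::complex. indicator (ball 0 1) z *\<^sub>R V (cmod z))"
proof (rule integrableI_bounded)
  show "(\<lambda>z::complex. indicator (ball 0 1) z *\<^sub>R V (cmod z)) \<in> borel_measurable lborel"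
  proof (intro borel_measurable_scaleR borel_measurable_indicator)
    have "(\<lambda>z::complex. V (cmod z)) \<in> borel_measurable borel" by measurable
    then show "(\<lambda>z::complex. V (cmod z)) \<in> borel_measurable lborel" by simp
  qed simp
  have "(\<integral>\<^sup>+z. ennreal (norm (indicator (ball 0 1) z *\<^sub>R V (cmod z))) \<partial>(lborel :: complex measure))
     = (\<integral>\<^sup>+z. (\<lambda>r. ennreal (cmod (V r)) * indicator {..<1} r) (cmod z) \<partial>(lborel :: complex measure))"
    by (intro nn_integral_cong) (auto simp: indicator_def)
  also have "\<dots> = (\<integral>\<^sup>+r. ennreal (2 * pi * r) * indicator {0..} r * (ennreal (cmod (V r)) * indicator {..<1} r) \<partial>lborel)"
    by (rule nn_integral_radial) measurable
  also have "\<dots> \<le> (\<integral>\<^sup>+r. ennreal (2 * pi) * ennreal (norm (indicator {0<..<1} r *\<^sub>R (r * cmod (V r)))) \<partial>lborel)"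
  proof (rule nn_integral_mono)
    fix r :: real
    show "ennreal (2 * pi * r) * indicator {0..} r * (ennreal (cmod (V r)) * indicator {..<1} r)
       \<le> ennreal (2 * pi) * ennreal (norm (indicator {0<..<1} r *\<^sub>R (r * cmod (V r))))"
    proof (cases "r \<in> {0<..<1}")
      case True
      then have "ennreal (2 * pi * r) * ennreal (cmod (V r)) = ennreal (2 * pi) * ennreal (r * cmod (V r))"
        by (simp add: ennreal_mult[symmetric] mult.assoc)
      then show ?thesis using True by (simp add: abs_mult)
    next
      case False
      then have "r = 0 \<or> r \<notin> {0..} \<or> r \<notin> {..<1}" by auto
      then show ?thesis by auto
    qed
  qed
  also have "\<dots> = ennreal (2 * pi) * (\<integral>\<^sup>+r. ennreal (norm (indicator {0<..<1} r *\<^sub>R (r * cmod (V r)))) \<partial>lborel)"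
    by (rule nn_integral_cmult) measurable
  also have "\<dots> < \<infinity>"
    using i by (simp add: integrable_iff_bounded ennreal_mult_less_top)
  finally show "(\<integral>\<^sup>+z. ennreal (norm (indicator (ball 0 1) z *\<^sub>R V (cmod z))) \<partial>(lborel :: complex measure)) < \<infinity>" .
qed

lemma lebesgue_integral_AE_borel:
  fixes g h :: "'a::euclidean_space \<Rightarrow> 'b::euclidean_space"
  assumes g: "integrable lborel g" and ae: "AE z in lborel. g z = h z"
  shows "integrable lebesgue h" "integral\<^sup>L lebesgue h = integral\<^sup>L lborel g"
proof -
  have gb: "g \<in> borel_measurable lborel" using g by auto
  have gl: "integrable lebesgue g" using g integrable_completion[OF gb] by simp
  have ael: "AE z in lebesgue. g z = h z" using ae by (rule AE_completion)
  have hm: "h \<in> borel_measurable lebesgue"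
    by (rule borel_measurable_AE[OF borel_measurable_integrable[OF gl] ael])
  show "integrable lebesgue h" using integrable_cong_AE_imp[OF gl hm] ael by simp
  have "integral\<^sup>L lebesgue h = integral\<^sup>L lebesgue g"
    by (rule integral_cong_AE[OF hm borel_measurable_integrable[OF gl]]) (use ael in \<open>auto elim: eventually_mono\<close>)
  also have "\<dots> = integral\<^sup>L lborel g" by (rule integral_completion[OF gb])
  finally show "integral\<^sup>L lebesgue h = integral\<^sup>L lborel g" .
qed

lemma radial_solution_cong_AE:
  assumes "radial_solution V m y" and ae: "AE r in lborel. r \<in> {0<..<1} \<longrightarrow> V r = V' r"
  shows "radial_solution V' m y"
proof -
  obtain y' where y': "\<forall>r\<in>{0<..1}. (y has_vector_derivative y' r) (at r within {0<..1})"
     "\<forall>a\<in>{0<..1}. abs_continuous_on a 1 y'"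
     and eq: "AE r in lebesgue_on {0<..<1}. \<exists>y2. (y' has_vector_derivative y2) (at r) \<and>
        - y2 + of_real (ell m * (ell m + 1) / r\<^sup>2) * y r + V r * y r = 0"
     and a: "y \<sim>[at_right 0] (\<lambda>r. of_real (r powr (ell m + 1)))"
     "y' \<sim>[at_right 0] (\<lambda>r. of_real ((ell m + 1) * r powr ell m))"
    using assms(1) unfolding radial_solution_def by blast
  have "AE r in lebesgue_on {0<..<1}. V r = V' r"
    using AE_completion[OF ae] by (subst AE_restrict_space_iff) auto
  with eq have "AE r in lebesgue_on {0<..<1}. \<exists>y2. (y' has_vector_derivative y2) (at r) \<and>
        - y2 + of_real (ell m * (ell m + 1) / r\<^sup>2) * y r + V' r * y r = 0"
    by eventually_elim simp
  with y' a show ?thesis unfolding radial_solution_def by blast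
qed

text \<open>The logarithmic weight is at least \<open>1\<close> on \<open>(0, 1)\<close>.\<close>

lemma set_integrable_first_moment:
  fixes V :: "real \<Rightarrow> complex"
  assumes V: "V \<in> borel_measurable (lebesgue_on {0<..<1})"
    and int: "set_integrable lebesgue {0<..<1} (\<lambda>r. r * (1 - ln r) * cmod (V r))"
  shows "set_integrable lebesgue {0<..<1} (\<lambda>r. r * cmod (V r))"
proof (rule set_integrable_bound[OF int])
  have "(\<lambda>r::real. r) \<in> borel_measurable (lebesgue_on {0<..<1})"
    by (rule measurable_restrict_space1) (rule measurable_completion, simp)
  then have "(\<lambda>r. r * cmod (V r)) \<in> borel_measurable (lebesgue_on {0<..<1})"
    using V by measurable
  then show "set_borel_measurable lebesgue {0<..<1} (\<lambda>r. r * cmod (V r))"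
    unfolding set_borel_measurable_def by (subst (asm) borel_measurable_restrict_space_iff) auto
  have "norm (r * cmod (V r)) \<le> norm (r * (1 - ln r) * cmod (V r))" if "r \<in> {0<..<1}" for r
  proof -
    have "r * 1 * cmod (V r) \<le> r * (1 - ln r) * cmod (V r)"
      using that ln_le_zero_iff[of r] by (intro mult_right_mono mult_left_mono) auto
    also have "\<dots> \<le> norm (r * (1 - ln r) * cmod (V r))" by simp
    finally show ?thesis using that by simp
  qed
  then show "AE r in lebesgue. r \<in> {0<..<1} \<longrightarrow> norm (r * cmod (V r)) \<le> norm (r * (1 - ln r) * cmod (V r))"
    by simp
qed

theorem theorem32:
  fixes V :: "real \<Rightarrow> complex"
    and y :: "nat \<Rightarrow> real \<Rightarrow> complex"
    and f :: "(real \<Rightarrow> complex) \<Rightarrow> complex"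
  assumes "V \<in> borel_measurable (lebesgue_on {0<..<1})"
    and "set_integrable lebesgue {0<..<1} (\<lambda>r. r * (1 - ln r) * cmod (V r))"
    and "\<And>m. radial_solution V m (y m)"
    and "\<And>m. alpha y m 1 \<noteq> 0"
    and "circle_distribution f"
  shows "(\<forall>r\<in>{0..<1}. \<forall>\<theta>. u_term y f r \<theta> summable_on UNIV) \<and>
         u_fun y f \<in> Sol_dist V \<and>
         has_dist_boundary_value (u_fun y f) f"
proof -
  obtain V' where V': "V' \<in> borel_measurable borel" and ae: "AE r in lborel. r \<in> {0<..<1} \<longrightarrow> V r = V' r"
    using lebesgue_measurable_borel_version[OF assms(1)] by blast
  have sol: "radial_solution V' m (y m)" for m
    by (rule radial_solution_cong_AE[OF assms(3) ae])
  have moment: "integrable lebesgue (\<lambda>r. indicator {0<..<1} r *\<^sub>R (r * cmod (V r)))"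
    using set_integrable_first_moment[OF assms(1,2)] by (simp add: set_integrable_def)
  have m': "(\<lambda>r. indicator {0<..<1} r *\<^sub>R (r * cmod (V' r))) \<in> borel_measurable lborel"
    using V' by measurable
  have "integrable lebesgue (\<lambda>r. indicator {0<..<1} r *\<^sub>R (r * cmod (V' r)))"
  proof (rule integrable_cong_AE_imp[OF moment measurable_completion[OF m']])
    show "AE r in lebesgue. indicator {0<..<1} r *\<^sub>R (r * cmod (V r)) = indicator {0<..<1} r *\<^sub>R (r * cmod (V' r))"
      using AE_completion[OF ae] by eventually_elim (auto simp: indicator_def)
  qed
  then have il: "set_integrable lebesgue {0<..<1} (\<lambda>r. r * cmod (V' r))"
    and ib: "integrable lborel (\<lambda>r. indicator {0<..<1} r *\<^sub>R (r * cmod (V' r)))"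
    using integrable_completion[OF m'] by (simp_all add: set_integrable_def)
  have "(\<lambda>r. r * cmod (V' r)) integrable_on {0..1}"
    using set_lebesgue_integral_eq_integral(1)[OF il] by (simp add: integrable_on_Icc_iff_Ioo)
  then obtain J where J: "((\<lambda>r. r * cmod (V' r)) has_integral J) {0..1}" by blast
  obtain C c where Cc: "C > 0" "c > 0" "\<And>m r. r \<in> {0..1} \<Longrightarrow> cmod (alpha y m r) \<le> C"
    "\<And>m. c \<le> cmod (alpha y m 1)" "\<And>m. continuous_on {0..1} (alpha y m)"
    using alpha_uniform_bounds[OF J sol assms(4)] by metis
  interpret radial_series y "C / c" f
  proof
    show "cmod (alpha y m r / alpha y m 1) \<le> C / c" if "r \<in> {0..1}" for m r
      unfolding norm_divide using Cc(1-4) that by (intro frac_le) auto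
  qed (use Cc(5) assms(4,5) in auto)
  have V'int: "integrable lborel (\<lambda>z::complex. indicator (ball 0 1) z *\<^sub>R V' (cmod z))"
    by (rule integrable_potential_on_disk[OF V' ib])
  have aez: "AE z in (lborel::complex measure). cmod z \<in> {0<..<1} \<longrightarrow> V (cmod z) = V' (cmod z)"
    by (rule AE_cmod[OF ae])
  have aeb: "AE z in (lborel::complex measure). z \<in> ball 0 1 \<longrightarrow> V (cmod z) = V' (cmod z)"
    using aez AE_lborel_singleton[of "0::complex"] by eventually_elim auto
  have "u_fun y f \<in> Sol_dist V"
    unfolding Sol_dist_def
  proof (intro CollectI conjI allI impI)
    show "disk_L1_loc (u_fun y f)"
      unfolding disk_L1_loc_def set_integrable_def
    proof (intro allI impI)
      fix S :: "complex set" assume S: "compact S \<and> S \<subseteq> ball 0 1"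
      have "integrable lborel (\<lambda>x. indicator S x *\<^sub>R u_fun y f x)"
        using S continuous_on_subset[OF continuous_on_u_fun] by (intro borel_integrable_compact) auto
      then show "integrable lebesgue (\<lambda>x. indicator S x *\<^sub>R u_fun y f x)"
        by (rule lebesgue_integral_AE_borel) simp
    qed
  next
    fix \<phi> assume "disk_test_function \<phi>"
    then obtain S where S: "smooth_plane \<phi>" "compact S" "S \<subseteq> ball 0 1" "\<And>x. x \<notin> S \<Longrightarrow> \<phi> x = 0"
      unfolding disk_test_function_def by blast
    interpret weak_setup y "C / c" f \<phi> S V'
      by unfold_locales (use S V' V'int sol in auto)
    show "set_integrable lebesgue (ball 0 1) (\<lambda>x. V (cmod x) * u_fun y f x * \<phi> x)"
      unfolding set_integrable_def
    proof (rule lebesgue_integral_AE_borel[OF integrable_test(1)[OF continuous_on_u_fun]])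
      show "AE z in lborel. indicator (ball 0 1) z *\<^sub>R (u_fun y f z * (V' (cmod z) * \<phi> z)) = indicator (ball 0 1) z *\<^sub>R (V (cmod z) * u_fun y f z * \<phi> z)"
        using aeb by eventually_elim (auto simp: indicator_def)
    qed
    have "(LINT x:ball 0 1|lebesgue. u_fun y f x * (- laplacian \<phi> x + V (cmod x) * \<phi> x))
      = (\<integral>z. indicator (ball 0 1) z *\<^sub>R (u_fun y f z * (V' (cmod z) * \<phi> z - laplacian \<phi> z)) \<partial>lborel)"
      unfolding set_lebesgue_integral_def
    proof (rule lebesgue_integral_AE_borel[OF integrable_op_test[OF continuous_on_u_fun]])
      show "AE z in lborel. indicator (ball 0 1) z *\<^sub>R (u_fun y f z * (V' (cmod z) * \<phi> z - laplacian \<phi> z))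
        = indicator (ball 0 1) z *\<^sub>R (u_fun y f z * (- laplacian \<phi> z + V (cmod z) * \<phi> z))"
        using aeb by eventually_elim (auto simp: indicator_def)
    qed
    then show "(LINT x:ball 0 1|lebesgue. u_fun y f x * (- laplacian \<phi> x + V (cmod x) * \<phi> x)) = 0"
      using weak_equation_u_fun by simp
  qed
  then show ?thesis
    using summable_u_term has_dist_boundary_value_u_fun by blast
qed

end
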